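(* Let $T\in{\rm Aut}(X,\mathcal B,\mu)$ be ergodic and suppose the topological lens $(C_2(\mu),\widetilde T)$ is distal. Then $T$ has discrete spectrum, and consequently $\widetilde T$ is equicontinuous.
   Context: $C_2(\mu)$: probability measures on $X\times X$ with both marginals $\mu$, with the compact metrizable topology $\rho_n\to\rho$ iff $\rho_n(A\times B)\to\rho(A\times B)$ for all measurable $A,B$; $\widetilde T(\rho)(A\times B)=\rho(T^{-1}A\times T^{-1}B)$. A homeomorphism $R$ of a compact metric space $Z$ is distal if for every pair of distinct points $z_1,z_2$ the closure of the $R\times R$-orbit of $(z_1,z_2)$ is disjoint from the diagonal of $Z\times Z$; equicontinuous if $\{R^n:n\in\mathbb Z\}$ is an equicontinuous family. $T$ has discrete spectrum if $L^2(\mu)$ is spanned by eigenfunctions of $U_Tf=f\circ T$. *)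

theory Defs
  imports "HOL-Probability.Probability"
begin

definition mp_aut :: "'a measure \<Rightarrow> ('a \<Rightarrow> 'a) \<Rightarrow> bool" where
  "mp_aut M T \<longleftrightarrow> bij_betw T (space M) (space M)
     \<and> T \<in> measurable M M
     \<and> inv_into (space M) T \<in> measurable M M
     \<and> distr M M T = M"

definition ergodic :: "'a measure \<Rightarrow> ('a \<Rightarrow> 'a) \<Rightarrow> bool" where
  "ergodic M T \<longleftrightarrow> (\<forall>A\<in>sets M. T -` A \<inter> space M = A \<longrightarrow>
       measure M A = 0 \<or> measure M A = 1)"

definition L2fun :: "'a measure \<Rightarrow> ('a \<Rightarrow> complex) \<Rightarrow> bool" where
  "L2fun M f \<longleftrightarrow> f \<in> borel_measurable M \<and> integrable M (\<lambda>x. (cmod (f x))\<^sup>2)"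

definition eigenfunction :: "'a measure \<Rightarrow> ('a \<Rightarrow> 'a) \<Rightarrow> ('a \<Rightarrow> complex) \<Rightarrow> bool" where
  "eigenfunction M T f \<longleftrightarrow> L2fun M f \<and> \<not> (AE x in M. f x = 0)
     \<and> (\<exists>c::complex. AE x in M. f (T x) = c * f x)"

definition discrete_spectrum :: "'a measure \<Rightarrow> ('a \<Rightarrow> 'a) \<Rightarrow> bool" where
  "discrete_spectrum M T \<longleftrightarrow> (\<forall>g. L2fun M g \<longrightarrow> (\<forall>e>0. \<exists>F c. finite F
      \<and> (\<forall>f\<in>F. eigenfunction M T f)
      \<and> (\<integral>x. (cmod (g x - (\<Sum>f\<in>F. c f * f x)))\<^sup>2 \<partial>M) < e))"

definition C2 :: "'a measure \<Rightarrow> ('a \<times> 'a) measure set" where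
  "C2 M = {\<rho>. sets \<rho> = sets (M \<Otimes>\<^sub>M M) \<and> prob_space \<rho>
      \<and> (\<forall>A\<in>sets M. emeasure \<rho> (A \<times> space M) = emeasure M A)
      \<and> (\<forall>B\<in>sets M. emeasure \<rho> (space M \<times> B) = emeasure M B)}"

text \<open>The topology on C_2(mu): the coarsest one making all maps rho |-> rho(A x B) continuous
  (its convergent sequences are exactly those with rho_n(A x B) -> rho(A x B) for all A, B).\<close>
definition C2_topology :: "'a measure \<Rightarrow> ('a \<times> 'a) measure topology" where
  "C2_topology M = topology_generated_by
     {{\<rho>\<in>C2 M. measure \<rho> (A \<times> B) \<in> U} | A B U. A \<in> sets M \<and> B \<in> sets M \<and> open U}"

definition lift_map :: "'a measure \<Rightarrow> ('a \<Rightarrow> 'a) \<Rightarrow> ('a \<times> 'a) measure \<Rightarrow> ('a \<times> 'a) measure" where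
  "lift_map M T \<rho> = distr \<rho> (M \<Otimes>\<^sub>M M) (\<lambda>(x, y). (T x, T y))"

definition zpow :: "'b topology \<Rightarrow> ('b \<Rightarrow> 'b) \<Rightarrow> int \<Rightarrow> 'b \<Rightarrow> 'b" where
  "zpow Z R n = (if 0 \<le> n then R ^^ nat n else inv_into (topspace Z) R ^^ nat (- n))"

definition distal :: "'b topology \<Rightarrow> ('b \<Rightarrow> 'b) \<Rightarrow> bool" where
  "distal Z R \<longleftrightarrow> homeomorphic_map Z Z R \<and>
     (\<forall>z1\<in>topspace Z. \<forall>z2\<in>topspace Z. z1 \<noteq> z2 \<longrightarrow>
        (prod_topology Z Z) closure_of {(zpow Z R n z1, zpow Z R n z2) | n. True}
          \<inter> {(z, z) | z. True} = {})"

text \<open>Equicontinuity of {R^n : n in Z}, with respect to any metric inducing the (compact) topology.\<close>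
definition equicontinuous :: "'b topology \<Rightarrow> ('b \<Rightarrow> 'b) \<Rightarrow> bool" where
  "equicontinuous Z R \<longleftrightarrow> (\<forall>d. Metric_space (topspace Z) d
      \<and> Metric_space.mtopology (topspace Z) d = Z \<longrightarrow>
      (\<forall>e>0. \<exists>\<delta>>0. \<forall>z\<in>topspace Z. \<forall>w\<in>topspace Z. d z w < \<delta> \<longrightarrow>
          (\<forall>n::int. d (zpow Z R n z) (zpow Z R n w) < e)))"

end

theory Submission
  imports Defs
begin

text \<open>
  If \<open>f\<close> is bounded and orthogonal to all eigenfunctions, then along suitable \<open>n\<close> the functions
  \<open>f \<circ> T\<^sup>n\<close> tend weakly to \<open>0\<close>. Up to scaling, the measure with density \<open>1 + f(x) f(y)\<close> with
  respect to \<open>M \<times> M\<close> is then a self-coupling that is proximal to the fixed point \<open>M \<times> M\<close>, so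
  distality forces \<open>f = 0\<close>.

  The weak convergence is proved without spectral measures. By the mean ergodic theorem the averages of
  \<open>l\<^sup>n (f \<circ> T\<^sup>n)\<close> are small for every \<open>l\<close> on the circle, hence uniformly small by compactness, and
  averaging the square of their squared norm over roots of unity bounds the mean square of the
  correlations of \<open>f\<close>.

  The functions with totally bounded orbit in \<open>L\<^sup>2\<close> form a closed subspace that is stable under truncation
  and contains the eigenfunctions. Hence the best approximation of an indicator function from this subspace
  is bounded, and so is the remainder; being orthogonal to the eigenfunctions, the remainder vanishes. So
  indicator functions have totally bounded orbits. A function orthogonal to the eigenfunctions has small
  correlations, so it is orthogonal to everything with totally bounded orbit and vanishes. Moreover the
  iterates of the lift act equicontinuously on the measures of rectangles, which determine self-couplings,
  and compactness of the space of self-couplings turns this into equicontinuity for every metric.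
\<close>

lemma obtain_scaled_epsilon:
  fixes c e :: real
  assumes "0 \<le> c" "0 < e"
  obtains d where "d > 0" "d * (c + 1) = e"
  using assms that[of "e / (c + 1)"] by simp

section \<open>Square-integrable functions\<close>

definition L2inner :: "'a measure \<Rightarrow> ('a \<Rightarrow> complex) \<Rightarrow> ('a \<Rightarrow> complex) \<Rightarrow> complex" where
  "L2inner M f g = (\<integral>x. f x * cnj (g x) \<partial>M)"

definition L2norm :: "'a measure \<Rightarrow> ('a \<Rightarrow> complex) \<Rightarrow> real" where
  "L2norm M f = sqrt (\<integral>x. (cmod (f x))\<^sup>2 \<partial>M)"

lemma borel_measurable_cnj [measurable]: "cnj \<in> borel_measurable borel"
  by (intro borel_measurable_continuous_onI continuous_intros)

lemma L2fun_measurable [measurable_dest]: "L2fun M f \<Longrightarrow> f \<in> borel_measurable M"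
  by (simp add: L2fun_def)

lemma L2fun_integrable_norm_square: "L2fun M f \<Longrightarrow> integrable M (\<lambda>x. (cmod (f x))\<^sup>2)"
  by (simp add: L2fun_def)

lemma L2fun_dominated:
  assumes f: "L2fun M f" and [measurable]: "g \<in> borel_measurable M"
    and le: "\<And>x. x \<in> space M \<Longrightarrow> cmod (g x) \<le> cmod (f x)"
  shows "L2fun M g"
  unfolding L2fun_def
proof
  show "integrable M (\<lambda>x. (cmod (g x))\<^sup>2)"
    by (rule Bochner_Integration.integrable_bound[OF L2fun_integrable_norm_square[OF f]])
      (use le in \<open>auto intro!: AE_I2 power_mono\<close>)
qed fact

lemma L2fun_cmult: "L2fun M f \<Longrightarrow> L2fun M (\<lambda>x. c * f x)"
  by (auto simp: L2fun_def norm_mult power_mult_distrib)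

lemma L2fun_zero: "L2fun M (\<lambda>x. 0)"
  by (simp add: L2fun_def)

lemma L2fun_add:
  assumes f: "L2fun M f" and g: "L2fun M g"
  shows "L2fun M (\<lambda>x. f x + g x)"
  unfolding L2fun_def
proof
  note [measurable] = f g
  show "(\<lambda>x. f x + g x) \<in> borel_measurable M" by measurable
  have parallelogram: "(cmod (a + b))\<^sup>2 + (cmod (a - b))\<^sup>2 = 2 * (cmod a)\<^sup>2 + 2 * (cmod b)\<^sup>2" for a b
    unfolding cmod_power2 by (simp add: power2_eq_square algebra_simps)
  have "(cmod (a + b))\<^sup>2 \<le> 2 * (cmod a)\<^sup>2 + 2 * (cmod b)\<^sup>2" for a b
    using parallelogram[of a b] zero_le_power2[of "cmod (a - b)"] by linarith
  then have bound: "norm ((cmod (f x + g x))\<^sup>2) \<le> norm (2 * (cmod (f x))\<^sup>2 + 2 * (cmod (g x))\<^sup>2)" for x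
    by simp
  show "integrable M (\<lambda>x. (cmod (f x + g x))\<^sup>2)"
  proof (rule Bochner_Integration.integrable_bound)
    show "integrable M (\<lambda>x. 2 * (cmod (f x))\<^sup>2 + 2 * (cmod (g x))\<^sup>2)"
      using f g by (simp add: L2fun_def)
  qed (measurable, rule AE_I2, rule bound)
qed

lemma L2fun_uminus: "L2fun M f \<Longrightarrow> L2fun M (\<lambda>x. - f x)"
  using L2fun_cmult[of M f "-1"] by simp

lemma L2fun_diff: "L2fun M f \<Longrightarrow> L2fun M g \<Longrightarrow> L2fun M (\<lambda>x. f x - g x)"
  using L2fun_add[of M f "\<lambda>x. - g x"] L2fun_uminus[of M g] by simp

lemma L2fun_sum: "(\<And>i. i \<in> I \<Longrightarrow> L2fun M (f i)) \<Longrightarrow> L2fun M (\<lambda>x. \<Sum>i\<in>I. f i x)"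
  by (induction I rule: infinite_finite_induct) (auto intro: L2fun_add L2fun_zero)

lemma L2fun_norm: "L2fun M f \<Longrightarrow> L2fun M (\<lambda>x. complex_of_real (cmod (f x)))"
  by (auto simp: L2fun_def)

lemmas L2fun_intros = L2fun_add L2fun_cmult L2fun_zero L2fun_diff L2fun_sum

lemma (in finite_measure) L2fun_bounded:
  assumes "f \<in> borel_measurable M" and "\<And>x. x \<in> space M \<Longrightarrow> cmod (f x) \<le> B"
  shows "L2fun M f"
  unfolding L2fun_def using assms
  by (intro conjI integrable_const_bound[of _ "B\<^sup>2"]) (auto intro!: AE_I2 power_mono)

lemma (in finite_measure) L2fun_indicator: "A \<in> sets M \<Longrightarrow> L2fun M (\<lambda>x. indicator A x)"
  by (rule L2fun_bounded[of _ 1]) (auto simp: indicator_def)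

lemma integrable_mult_cnj:
  assumes f: "L2fun M f" and g: "L2fun M g"
  shows "integrable M (\<lambda>x. f x * cnj (g x))"
proof -
  note [measurable] = f g
  have bound: "norm (f x * cnj (g x)) \<le> norm ((cmod (f x))\<^sup>2 + (cmod (g x))\<^sup>2)" for x
  proof -
    have "cmod (f x) * cmod (g x) \<le> 2 * (cmod (f x) * cmod (g x))"
      by simp
    also have "\<dots> \<le> (cmod (f x))\<^sup>2 + (cmod (g x))\<^sup>2"
      using sum_squares_bound[of "cmod (f x)" "cmod (g x)"] by simp
    finally show ?thesis by (simp add: norm_mult)
  qed
  have "integrable M (\<lambda>x. (cmod (f x))\<^sup>2 + (cmod (g x))\<^sup>2)"
    using f g by (simp add: L2fun_def)
  then show ?thesis
    by (rule Bochner_Integration.integrable_bound) (measurable, rule AE_I2, rule bound)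
qed

lemma (in finite_measure) L2fun_integrable: "L2fun M f \<Longrightarrow> integrable M f"
  using integrable_mult_cnj[of M f "\<lambda>x. 1"] by (simp add: L2fun_bounded[of _ 1])

subsection \<open>Inner product and norm\<close>

lemma L2inner_add_left:
  "L2fun M f \<Longrightarrow> L2fun M g \<Longrightarrow> L2fun M h \<Longrightarrow>
    L2inner M (\<lambda>x. f x + g x) h = L2inner M f h + L2inner M g h"
  unfolding L2inner_def
  by (subst Bochner_Integration.integral_add[symmetric]) (auto simp: integrable_mult_cnj algebra_simps)

lemma cnj_L2inner: "cnj (L2inner M f g) = L2inner M g f"
  unfolding L2inner_def Bochner_Integration.integral_cnj[symmetric] by (simp add: mult.commute)

lemma L2inner_cmult_left: "L2inner M (\<lambda>x. c * f x) g = c * L2inner M f g"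
  by (simp add: L2inner_def mult.assoc)

lemma L2inner_cmult_right: "L2inner M f (\<lambda>x. c * g x) = cnj c * L2inner M f g"
  using L2inner_cmult_left[of M c g f] by (metis cnj_L2inner complex_cnj_mult)

lemma L2inner_add_right:
  "L2fun M f \<Longrightarrow> L2fun M g \<Longrightarrow> L2fun M h \<Longrightarrow>
    L2inner M f (\<lambda>x. g x + h x) = L2inner M f g + L2inner M f h"
  unfolding cnj_L2inner[of M _ f, symmetric] by (simp add: L2inner_add_left)

lemma L2inner_diff_left:
  "L2fun M f \<Longrightarrow> L2fun M g \<Longrightarrow> L2fun M h \<Longrightarrow>
    L2inner M (\<lambda>x. f x - g x) h = L2inner M f h - L2inner M g h"
  using L2inner_add_left[of M f "\<lambda>x. (-1) * g x" h] L2inner_cmult_left[of M "-1" g h] L2fun_uminus[of M g]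
  by simp

lemma L2inner_diff_right:
  "L2fun M f \<Longrightarrow> L2fun M g \<Longrightarrow> L2fun M h \<Longrightarrow>
    L2inner M f (\<lambda>x. g x - h x) = L2inner M f g - L2inner M f h"
  unfolding cnj_L2inner[of M _ f, symmetric] by (simp add: L2inner_diff_left)

lemma L2inner_sum_left:
  "(\<And>i. i \<in> I \<Longrightarrow> L2fun M (f i)) \<Longrightarrow> L2fun M g \<Longrightarrow>
    L2inner M (\<lambda>x. \<Sum>i\<in>I. f i x) g = (\<Sum>i\<in>I. L2inner M (f i) g)"
  by (induction I rule: infinite_finite_induct)
    (auto simp: L2inner_add_left L2fun_sum, auto simp: L2inner_def)

lemma L2inner_sum_right:
  "(\<And>i. i \<in> I \<Longrightarrow> L2fun M (f i)) \<Longrightarrow> L2fun M g \<Longrightarrow>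
    L2inner M g (\<lambda>x. \<Sum>i\<in>I. f i x) = (\<Sum>i\<in>I. L2inner M g (f i))"
  unfolding cnj_L2inner[of M _ g, symmetric] by (simp add: L2inner_sum_left)

lemma L2norm_nonneg [simp]: "0 \<le> L2norm M f"
  by (simp add: L2norm_def)

lemma L2norm_square: "(L2norm M f)\<^sup>2 = (\<integral>x. (cmod (f x))\<^sup>2 \<partial>M)"
  by (simp add: L2norm_def)

lemma L2norm_zero [simp]: "L2norm M (\<lambda>x. 0) = 0"
  by (simp add: L2norm_def)

lemma L2inner_self: "L2inner M f f = of_real ((L2norm M f)\<^sup>2)"
  unfolding L2inner_def L2norm_square integral_complex_of_real[symmetric]
  by (simp only: complex_norm_square)

lemma L2norm_cmult: "L2norm M (\<lambda>x. c * f x) = cmod c * L2norm M f"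
  by (simp add: L2norm_def norm_mult power_mult_distrib real_sqrt_mult)

lemma L2norm_minus_commute: "L2norm M (\<lambda>x. f x - g x) = L2norm M (\<lambda>x. g x - f x)"
  by (simp add: L2norm_def norm_minus_commute)

lemma L2norm_square_add:
  assumes "L2fun M f" "L2fun M g"
  shows "(L2norm M (\<lambda>x. f x + g x))\<^sup>2 = (L2norm M f)\<^sup>2 + 2 * Re (L2inner M f g) + (L2norm M g)\<^sup>2"
proof -
  have "L2inner M (\<lambda>x. f x + g x) (\<lambda>x. f x + g x)
      = L2inner M f f + L2inner M f g + (cnj (L2inner M f g) + L2inner M g g)"
    using assms by (simp add: L2inner_add_left L2inner_add_right L2fun_add cnj_L2inner)
  from arg_cong[OF this, of Re] show ?thesis
    by (simp add: L2inner_self)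
qed

lemma L2norm_square_diff:
  assumes "L2fun M f" "L2fun M g"
  shows "(L2norm M (\<lambda>x. f x - g x))\<^sup>2 = (L2norm M f)\<^sup>2 - 2 * Re (L2inner M f g) + (L2norm M g)\<^sup>2"
  using L2norm_square_add[of M f "\<lambda>x. (-1) * g x"] L2inner_cmult_right[of M f "-1" g] assms
    L2norm_cmult[of M "-1" g] L2fun_uminus[of M g] by simp

lemma L2norm_parallelogram:
  assumes "L2fun M f" "L2fun M g"
  shows "(L2norm M (\<lambda>x. f x + g x))\<^sup>2 + (L2norm M (\<lambda>x. f x - g x))\<^sup>2
    = 2 * (L2norm M f)\<^sup>2 + 2 * (L2norm M g)\<^sup>2"
  by (simp add: L2norm_square_add[OF assms] L2norm_square_diff[OF assms])

lemma L2norm_square_sum: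
  fixes c :: "'i \<Rightarrow> complex"
  assumes F: "\<And>i. i \<in> I \<Longrightarrow> L2fun M (F i)"
  shows "complex_of_real ((L2norm M (\<lambda>x. \<Sum>i\<in>I. c i * F i x))\<^sup>2)
    = (\<Sum>i\<in>I. \<Sum>j\<in>I. c i * cnj (c j) * L2inner M (F i) (F j))"
proof -
  have sum_in_L2: "L2fun M (\<lambda>x. \<Sum>j\<in>I. c j * F j x)"
    by (intro L2fun_sum L2fun_cmult F)
  have "complex_of_real ((L2norm M (\<lambda>x. \<Sum>i\<in>I. c i * F i x))\<^sup>2)
      = (\<Sum>i\<in>I. c i * L2inner M (F i) (\<lambda>x. \<Sum>j\<in>I. c j * F j x))"
    using F sum_in_L2 by (simp only: L2inner_self[symmetric] L2inner_sum_left L2fun_cmult L2inner_cmult_left)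
  also have "\<dots> = (\<Sum>i\<in>I. c i * (\<Sum>j\<in>I. cnj (c j) * L2inner M (F i) (F j)))"
    using F by (intro sum.cong refl) (simp only: L2inner_sum_right L2fun_cmult L2inner_cmult_right)
  finally show ?thesis
    by (simp add: sum_distrib_left mult.assoc)
qed

lemma L2norm_eq_0_iff:
  assumes "L2fun M f"
  shows "L2norm M f = 0 \<longleftrightarrow> (AE x in M. f x = 0)"
proof -
  have "L2norm M f = 0 \<longleftrightarrow> (\<integral>x. (cmod (f x))\<^sup>2 \<partial>M) = 0"
    by (simp add: L2norm_def)
  also have "\<dots> \<longleftrightarrow> (AE x in M. (cmod (f x))\<^sup>2 = 0)"
    using assms by (intro integral_nonneg_eq_0_iff_AE) (auto simp: L2fun_def)
  finally show ?thesis by simp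
qed

lemma L2inner_eq_0_if_AE: "AE x in M. f x = 0 \<Longrightarrow> L2inner M f g = 0"
  unfolding L2inner_def by (rule integral_eq_zero_AE) auto

lemma L2norm_cong_AE:
  assumes "f \<in> borel_measurable M" "g \<in> borel_measurable M" "AE x in M. f x = g x"
  shows "L2norm M f = L2norm M g"
  unfolding L2norm_def
  by (rule arg_cong[where f = sqrt], rule integral_cong_AE)
    (use assms in \<open>auto elim!: eventually_mono\<close>)

lemma nn_integral_eq_L2norm_square:
  "L2fun M f \<Longrightarrow> (\<integral>\<^sup>+x. ennreal ((cmod (f x))\<^sup>2) \<partial>M) = ennreal ((L2norm M f)\<^sup>2)"
  unfolding L2norm_square L2fun_def by (subst nn_integral_eq_integral) auto

lemma L2norm_mono:
  assumes f: "L2fun M f" and g: "g \<in> borel_measurable M"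
    and le: "\<And>x. x \<in> space M \<Longrightarrow> cmod (g x) \<le> cmod (f x)"
  shows "L2norm M g \<le> L2norm M f"
  unfolding L2norm_def
  by (intro real_sqrt_le_mono integral_mono L2fun_integrable_norm_square f L2fun_dominated[OF f g le])
    (auto intro: power_mono le)

lemma L2_Cauchy_Schwarz:
  assumes f: "L2fun M f" and g: "L2fun M g"
  shows "cmod (L2inner M f g) \<le> L2norm M f * L2norm M g"
proof -
  note [measurable] = f g
  have "ennreal (cmod (L2inner M f g)) \<le> (\<integral>\<^sup>+x. ennreal (cmod (f x * cnj (g x))) \<partial>M)"
    unfolding L2inner_def by (rule integral_norm_bound_ennreal[OF integrable_mult_cnj[OF f g]])
  then have "(ennreal (cmod (L2inner M f g)))\<^sup>2 \<le> (\<integral>\<^sup>+x. ennreal (cmod (f x)) * ennreal (cmod (g x)) \<partial>M)\<^sup>2"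
    by (intro power_mono) (auto simp: norm_mult ennreal_mult)
  also have "\<dots> \<le> (\<integral>\<^sup>+x. (ennreal (cmod (f x)))\<^sup>2 \<partial>M) * (\<integral>\<^sup>+x. (ennreal (cmod (g x)))\<^sup>2 \<partial>M)"
    by (rule Cauchy_Schwarz_nn_integral) measurable
  also have "\<dots> = ennreal ((L2norm M f * L2norm M g)\<^sup>2)"
    by (simp add: ennreal_power nn_integral_eq_L2norm_square f g power_mult_distrib ennreal_mult)
  finally have "(cmod (L2inner M f g))\<^sup>2 \<le> (L2norm M f * L2norm M g)\<^sup>2"
    by (simp add: ennreal_power)
  then show ?thesis
    by (rule power2_le_imp_le) simp
qed

lemma L2norm_triangle:
  assumes "L2fun M f" "L2fun M g"
  shows "L2norm M (\<lambda>x. f x + g x) \<le> L2norm M f + L2norm M g"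
proof (rule power2_le_imp_le)
  have "Re (L2inner M f g) \<le> L2norm M f * L2norm M g"
    using L2_Cauchy_Schwarz[OF assms] complex_Re_le_cmod order_trans by blast
  then show "(L2norm M (\<lambda>x. f x + g x))\<^sup>2 \<le> (L2norm M f + L2norm M g)\<^sup>2"
    by (simp add: L2norm_square_add[OF assms] power2_sum)
qed simp

lemma L2norm_triangle_diff:
  assumes "L2fun M f" "L2fun M g"
  shows "L2norm M (\<lambda>x. f x - g x) \<le> L2norm M f + L2norm M g"
  using L2norm_triangle[of M f "\<lambda>x. (-1) * g x"] assms L2norm_cmult[of M "-1" g] L2fun_uminus[of M g]
  by simp

lemma L2norm_diff_triangle:
  assumes "L2fun M f" "L2fun M g" "L2fun M h"
  shows "L2norm M (\<lambda>x. f x - h x) \<le> L2norm M (\<lambda>x. f x - g x) + L2norm M (\<lambda>x. g x - h x)"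
  using L2norm_triangle[of M "\<lambda>x. f x - g x" "\<lambda>x. g x - h x"] assms by (simp add: L2fun_diff)

lemma L2norm_sum_le:
  assumes "\<And>i. i \<in> I \<Longrightarrow> L2fun M (f i)"
  shows "L2norm M (\<lambda>x. \<Sum>i\<in>I. f i x) \<le> (\<Sum>i\<in>I. L2norm M (f i))"
  using assms
proof (induction I rule: infinite_finite_induct)
  case (insert i I)
  then have "L2norm M (\<lambda>x. \<Sum>i\<in>insert i I. f i x) \<le> L2norm M (f i) + L2norm M (\<lambda>x. \<Sum>i\<in>I. f i x)"
    using L2norm_triangle[of M "f i" "\<lambda>x. \<Sum>i\<in>I. f i x"] by (simp add: L2fun_sum)
  with insert show ?case by simp
qed auto

lemma L2norm_diff_le_suminf:
  assumes g: "\<And>k. L2fun M (g k)" and summable: "summable (\<lambda>k. L2norm M (\<lambda>x. g (Suc k) x - g k x))"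
  shows "L2norm M (\<lambda>x. g (k + j) x - g k x) \<le> (\<Sum>i. L2norm M (\<lambda>x. g (Suc (i + k)) x - g (i + k) x))"
proof -
  let ?d = "\<lambda>i. L2norm M (\<lambda>x. g (Suc (i + k)) x - g (i + k) x)"
  have "g (k + j) x - g k x = (\<Sum>i<j. g (Suc (i + k)) x - g (i + k) x)" for x
    using sum_lessThan_telescope[of "\<lambda>i. g (i + k) x" j] by (simp add: add.commute)
  then have "L2norm M (\<lambda>x. g (k + j) x - g k x) \<le> (\<Sum>i<j. ?d i)"
    by (simp only:) (intro L2norm_sum_le L2fun_diff g)
  also have "\<dots> \<le> (\<Sum>i. ?d i)"
  proof (rule sum_le_suminf)
    show "summable ?d"
      using summable summable_iff_shift[of "\<lambda>i. L2norm M (\<lambda>x. g (Suc i) x - g i x)" k] by simp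
  qed auto
  finally show ?thesis .
qed

subsection \<open>Completeness\<close>

lemma L2_Fatou:
  assumes f: "\<And>n. L2fun M (f n)" and h [measurable]: "h \<in> borel_measurable M"
    and lim: "AE x in M. (\<lambda>n. f n x) \<longlonglongrightarrow> h x" and bound: "\<And>n. L2norm M (f n) \<le> C"
  shows "L2fun M h" and "L2norm M h \<le> C"
proof -
  note [measurable] = f
  have "0 \<le> C"
    using bound[of 0] L2norm_nonneg order_trans by blast
  have "(\<integral>\<^sup>+x. ennreal ((cmod (h x))\<^sup>2) \<partial>M) = (\<integral>\<^sup>+x. liminf (\<lambda>n. ennreal ((cmod (f n x))\<^sup>2)) \<partial>M)"
  proof (rule nn_integral_cong_AE, use lim in eventually_elim)
    case (elim x)
    then have "(\<lambda>n. ennreal ((cmod (f n x))\<^sup>2)) \<longlonglongrightarrow> ennreal ((cmod (h x))\<^sup>2)"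
      by (intro tendsto_intros)
    then show ?case
      using lim_imp_Liminf trivial_limit_sequentially by metis
  qed
  also have "\<dots> \<le> liminf (\<lambda>n. \<integral>\<^sup>+x. ennreal ((cmod (f n x))\<^sup>2) \<partial>M)"
    by (rule nn_integral_liminf) measurable
  also have "\<dots> \<le> liminf (\<lambda>n::nat. ennreal (C\<^sup>2))"
    by (intro Liminf_mono always_eventually allI)
      (simp add: nn_integral_eq_L2norm_square f bound power_mono ennreal_leI)
  also have "\<dots> = ennreal (C\<^sup>2)"
    by (simp add: Liminf_const)
  finally have integral_le: "(\<integral>\<^sup>+x. ennreal ((cmod (h x))\<^sup>2) \<partial>M) \<le> ennreal (C\<^sup>2)" .
  have "integrable M (\<lambda>x. (cmod (h x))\<^sup>2)"
    by (rule integrableI_nonneg) (use le_less_trans[OF integral_le ennreal_less_top] in auto)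
  then show L2: "L2fun M h"
    by (simp add: L2fun_def)
  show "L2norm M h \<le> C"
    using integral_le \<open>0 \<le> C\<close> unfolding nn_integral_eq_L2norm_square[OF L2]
    by (subst (asm) ennreal_le_iff) (auto intro: power2_le_imp_le)
qed

lemma bounded_if_SUP_square_finite:
  fixes a :: "nat \<Rightarrow> real"
  assumes "(SUP n. ennreal ((a n)\<^sup>2)) \<noteq> \<infinity>"
  shows "\<exists>B. \<forall>n. a n \<le> B"
proof -
  obtain B where "0 \<le> B" and sup: "(SUP n. ennreal ((a n)\<^sup>2)) = ennreal B"
    using assms by (metis ennreal_cases infinity_ennreal_def)
  have "a n \<le> sqrt B" for n
  proof (rule real_le_rsqrt)
    have "ennreal ((a n)\<^sup>2) \<le> ennreal B"
      unfolding sup[symmetric] by (rule SUP_upper) simp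
    then show "(a n)\<^sup>2 \<le> B"
      using \<open>0 \<le> B\<close> by simp
  qed
  then show ?thesis
    by blast
qed

lemma AE_bounded_if_L2norm_bounded:
  fixes s :: "nat \<Rightarrow> 'a \<Rightarrow> real"
  assumes L2: "\<And>n. L2fun M (\<lambda>x. complex_of_real (s n x))"
    and nonneg: "\<And>n x. 0 \<le> s n x" and mono: "\<And>m n x. m \<le> n \<Longrightarrow> s m x \<le> s n x"
    and bound: "\<And>n. L2norm M (\<lambda>x. complex_of_real (s n x)) \<le> C"
  shows "AE x in M. \<exists>B. \<forall>n. s n x \<le> B"
proof -
  have "(\<lambda>x. Re (complex_of_real (s n x))) \<in> borel_measurable M" for n
    using L2fun_measurable[OF L2] by measurable
  then have [measurable]: "s n \<in> borel_measurable M" for n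
    by simp
  have "(\<integral>\<^sup>+x. (SUP n. ennreal ((s n x)\<^sup>2)) \<partial>M) = (SUP n. \<integral>\<^sup>+x. ennreal ((s n x)\<^sup>2) \<partial>M)"
    by (intro nn_integral_monotone_convergence_SUP)
      (auto simp: incseq_def le_fun_def intro!: ennreal_leI power_mono mono nonneg)
  also have "\<dots> \<le> ennreal (C\<^sup>2)"
  proof (rule SUP_least)
    fix n
    have "(\<integral>\<^sup>+x. ennreal ((s n x)\<^sup>2) \<partial>M) = ennreal ((L2norm M (\<lambda>x. complex_of_real (s n x)))\<^sup>2)"
      using nn_integral_eq_L2norm_square[OF L2[of n]] by simp
    then show "(\<integral>\<^sup>+x. ennreal ((s n x)\<^sup>2) \<partial>M) \<le> ennreal (C\<^sup>2)"
      using bound by (auto intro!: ennreal_leI power_mono)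
  qed
  also have "\<dots> < \<infinity>"
    by simp
  finally have "(\<integral>\<^sup>+x. (SUP n. ennreal ((s n x)\<^sup>2)) \<partial>M) \<noteq> \<infinity>"
    by simp
  then have "AE x in M. (SUP n. ennreal ((s n x)\<^sup>2)) \<noteq> \<infinity>"
    by (intro nn_integral_PInf_AE) auto
  then show ?thesis
    by eventually_elim (rule bounded_if_SUP_square_finite)
qed

lemma AE_summable_if_L2norm_summable:
  assumes u: "\<And>k. L2fun M (u k)" and summable: "summable (\<lambda>k. L2norm M (u k))"
  shows "AE x in M. summable (\<lambda>k. u k x)"
proof -
  define s where "s n x = (\<Sum>k<n. cmod (u k x))" for n x
  have "AE x in M. \<exists>B. \<forall>n. s n x \<le> B"
  proof (rule AE_bounded_if_L2norm_bounded)
    fix n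
    show "L2fun M (\<lambda>x. complex_of_real (s n x))"
      unfolding s_def of_real_sum by (intro L2fun_sum L2fun_norm u)
    have "L2norm M (\<lambda>x. complex_of_real (s n x)) \<le> (\<Sum>k<n. L2norm M (\<lambda>x. complex_of_real (cmod (u k x))))"
      unfolding s_def of_real_sum by (intro L2norm_sum_le L2fun_norm u)
    also have "\<dots> = (\<Sum>k<n. L2norm M (u k))"
      by (simp add: L2norm_def)
    also have "\<dots> \<le> (\<Sum>k. L2norm M (u k))"
      by (intro sum_le_suminf summable) auto
    finally show "L2norm M (\<lambda>x. complex_of_real (s n x)) \<le> (\<Sum>k. L2norm M (u k))" .
  qed (auto simp: s_def intro: sum_nonneg sum_mono2)
  then show ?thesis
  proof eventually_elim
    case (elim x)
    then obtain B where "\<And>n. s n x \<le> B"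
      by blast
    then have "summable (\<lambda>k. cmod (u k x))"
      by (intro summableI_nonneg_bounded[where x = B]) (auto simp: s_def)
    then show ?case
      by (rule summable_norm_cancel)
  qed
qed

lemma L2norm_diff_limit_le:
  assumes g: "\<And>k. L2fun M (g k)" and [measurable]: "h \<in> borel_measurable M"
    and lim: "AE x in M. (\<lambda>k. g k x) \<longlonglongrightarrow> h x"
    and bound: "\<And>j. L2norm M (\<lambda>x. g (k + j) x - g k x) \<le> C"
  shows "L2fun M (\<lambda>x. h x - g k x)" and "L2norm M (\<lambda>x. h x - g k x) \<le> C"
proof -
  note [measurable] = g
  have diff: "L2fun M (\<lambda>x. g (k + j) x - g k x)" for j
    by (intro L2fun_diff g)
  have diff_lim: "AE x in M. (\<lambda>j. g (k + j) x - g k x) \<longlonglongrightarrow> h x - g k x"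
    using lim
  proof eventually_elim
    case (elim x)
    have "(\<lambda>j. g (k + j) x) \<longlonglongrightarrow> h x"
      using LIMSEQ_ignore_initial_segment[OF elim, of k] by (simp only: add.commute)
    then show ?case
      by (intro tendsto_diff tendsto_const)
  qed
  have "(\<lambda>x. h x - g k x) \<in> borel_measurable M"
    by measurable
  from L2_Fatou[OF diff this diff_lim bound]
  show "L2fun M (\<lambda>x. h x - g k x)" "L2norm M (\<lambda>x. h x - g k x) \<le> C" .
qed

theorem L2_complete:
  assumes g: "\<And>k. L2fun M (g k)"
    and summable: "summable (\<lambda>k. L2norm M (\<lambda>x. g (Suc k) x - g k x))"
  obtains h where "L2fun M h" "(\<lambda>k. L2norm M (\<lambda>x. g k x - h x)) \<longlonglongrightarrow> 0"
proof -
  note [measurable] = g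
  define d where "d k = L2norm M (\<lambda>x. g (Suc k) x - g k x)" for k
  have d_summable: "summable d"
    using summable by (simp add: d_def[abs_def])
  define tail where "tail k = (\<Sum>i. d (i + k))" for k
  define h where "h x = lim (\<lambda>k. g k x)" for x
  have h: "h \<in> borel_measurable M"
    unfolding h_def by measurable
  have lim: "AE x in M. (\<lambda>k. g k x) \<longlonglongrightarrow> h x"
    using AE_summable_if_L2norm_summable[OF L2fun_diff[OF g g] summable]
  proof eventually_elim
    case (elim x)
    then have "convergent (\<lambda>n. g n x - g 0 x)"
      by (simp only: summable_iff_convergent sum_lessThan_telescope[of "\<lambda>k. g k x"])
    then have "convergent (\<lambda>n. g n x)"
      by (simp add: convergent_diff_const_right_iff)
    then show ?case
      by (simp add: h_def convergent_LIMSEQ_iff)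
  qed
  have "L2norm M (\<lambda>x. g (k + j) x - g k x) \<le> tail k" for k j
    using L2norm_diff_le_suminf[OF g summable] by (simp add: tail_def d_def)
  note limit = L2norm_diff_limit_le[OF g h lim this]
  show thesis
  proof (rule that)
    have "L2fun M (\<lambda>x. (h x - g 0 x) + g 0 x)"
      by (intro L2fun_add limit(1) g)
    then show "L2fun M h"
      by simp
    have "(\<lambda>k. suminf d - (\<Sum>i<k. d i)) \<longlonglongrightarrow> suminf d - suminf d"
      by (intro tendsto_intros summable_LIMSEQ d_summable)
    then have "tail \<longlonglongrightarrow> 0"
      by (simp add: tail_def[abs_def] suminf_minus_initial_segment[OF d_summable])
    then show "(\<lambda>k. L2norm M (\<lambda>x. g k x - h x)) \<longlonglongrightarrow> 0"
      by (rule Lim_null_comparison[rotated])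
        (use limit(2) L2norm_minus_commute[of M _ h] in simp)
  qed
qed

subsection \<open>Orthogonal projection\<close>

lemma quadratic_bound_imp_eq_0:
  fixes z :: complex
  assumes "\<And>c. 2 * Re (cnj c * z) \<le> (cmod c)\<^sup>2 * b" and "0 \<le> b"
  shows "z = 0"
proof -
  define t where "t = 1 / (b + 1)"
  have t: "0 < t" "t * b < 1"
    using assms(2) by (auto simp: t_def field_simps)
  have "cnj (of_real t * z) * z = of_real (t * (cmod z)\<^sup>2)"
    by (simp add: complex_norm_square mult.commute del: of_real_power)
  moreover have "(cmod (of_real t * z))\<^sup>2 = t\<^sup>2 * (cmod z)\<^sup>2"
    by (simp add: norm_mult power_mult_distrib)
  ultimately have "2 * (t * (cmod z)\<^sup>2) \<le> t\<^sup>2 * (cmod z)\<^sup>2 * b"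
    using assms(1)[of "of_real t * z"] by (simp only: Re_complex_of_real)
  also have "\<dots> = (t * b) * (t * (cmod z)\<^sup>2)"
    by (simp add: power2_eq_square)
  also have "\<dots> \<le> 1 * (t * (cmod z)\<^sup>2)"
    using t by (intro mult_right_mono) auto
  finally show "z = 0"
    using t(1) by (simp add: mult_le_0_iff)
qed

definition L2_subspace :: "'a measure \<Rightarrow> ('a \<Rightarrow> complex) set \<Rightarrow> bool" where
  "L2_subspace M V \<longleftrightarrow> (\<forall>v\<in>V. L2fun M v) \<and> (\<lambda>x. 0) \<in> V
     \<and> (\<forall>u\<in>V. \<forall>v\<in>V. \<forall>c. (\<lambda>x. u x + c * v x) \<in> V)"

definition L2_closure :: "'a measure \<Rightarrow> ('a \<Rightarrow> complex) set \<Rightarrow> ('a \<Rightarrow> complex) set" where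
  "L2_closure M V = {p. L2fun M p \<and> (\<forall>e>0. \<exists>v\<in>V. L2norm M (\<lambda>x. p x - v x) < e)}"

lemma L2_subspaceD:
  assumes "L2_subspace M V"
  shows "\<And>v. v \<in> V \<Longrightarrow> L2fun M v" and "(\<lambda>x. 0) \<in> V"
    and "\<And>u v c. u \<in> V \<Longrightarrow> v \<in> V \<Longrightarrow> (\<lambda>x. u x + c * v x) \<in> V"
  using assms by (auto simp: L2_subspace_def)

lemma L2_subspace_cmult: "L2_subspace M V \<Longrightarrow> v \<in> V \<Longrightarrow> (\<lambda>x. c * v x) \<in> V"
  using L2_subspaceD(3)[of M V "\<lambda>x. 0" v c] L2_subspaceD(2)[of M V] by simp

lemma L2_closureE:
  assumes "p \<in> L2_closure M V" "e > 0"
  obtains v where "v \<in> V" "L2norm M (\<lambda>x. p x - v x) < e"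
  using assms by (auto simp: L2_closure_def)

lemma L2_closure_L2fun: "p \<in> L2_closure M V \<Longrightarrow> L2fun M p"
  by (simp add: L2_closure_def)

lemma L2_closureI_LIMSEQ:
  assumes "L2fun M p" "\<And>n. v n \<in> V" "(\<lambda>n. L2norm M (\<lambda>x. v n x - p x)) \<longlonglongrightarrow> 0"
  shows "p \<in> L2_closure M V"
proof -
  have "\<exists>n. L2norm M (\<lambda>x. p x - v n x) < e" if "e > 0" for e
    using order_tendstoD(2)[OF assms(3) that] unfolding eventually_sequentially
    by (auto simp: L2norm_minus_commute[of M p])
  then show ?thesis
    using assms(1,2) by (fastforce simp: L2_closure_def)
qed

lemma L2inner_L2_closure_eq_0:
  assumes r: "L2fun M r" and V: "\<And>v. v \<in> V \<Longrightarrow> L2fun M v" and p: "p \<in> L2_closure M V"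
    and orthogonal: "\<And>v. v \<in> V \<Longrightarrow> L2inner M r v = 0"
  shows "L2inner M r p = 0"
proof (rule ccontr)
  assume nonzero: "L2inner M r p \<noteq> 0"
  then obtain e where e: "e > 0" "e * (L2norm M r + 1) = cmod (L2inner M r p)"
    using obtain_scaled_epsilon[of "L2norm M r" "cmod (L2inner M r p)"] by auto
  obtain v where v: "v \<in> V" "L2norm M (\<lambda>x. p x - v x) < e"
    using L2_closureE[OF p e(1)] by blast
  note pL2 = L2_closure_L2fun[OF p] and vL2 = V[OF v(1)]
  have "cmod (L2inner M r p) = cmod (L2inner M r (\<lambda>x. p x - v x))"
    by (simp add: L2inner_diff_right[OF r pL2 vL2] orthogonal v)
  also have "\<dots> \<le> L2norm M r * L2norm M (\<lambda>x. p x - v x)"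
    by (rule L2_Cauchy_Schwarz[OF r L2fun_diff[OF pL2 vL2]])
  also have "\<dots> \<le> L2norm M r * e"
    using v(2) by (intro mult_left_mono) auto
  also have "\<dots> < cmod (L2inner M r p)"
    unfolding e(2)[symmetric] using e(1) by (simp add: algebra_simps)
  finally show False by simp
qed

definition L2_infdist :: "'a measure \<Rightarrow> ('a \<Rightarrow> complex) \<Rightarrow> ('a \<Rightarrow> complex) set \<Rightarrow> real" where
  "L2_infdist M f V = (INF v\<in>V. L2norm M (\<lambda>x. f x - v x))"

lemma bdd_below_L2_dist: "bdd_below ((\<lambda>v. L2norm M (\<lambda>x. f x - v x)) ` V)"
  by (rule bdd_belowI[of _ 0]) auto

lemma L2_infdist_le: "v \<in> V \<Longrightarrow> L2_infdist M f V \<le> L2norm M (\<lambda>x. f x - v x)"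
  unfolding L2_infdist_def by (rule cINF_lower[OF bdd_below_L2_dist])

lemma L2_infdist_nonneg: "V \<noteq> {} \<Longrightarrow> 0 \<le> L2_infdist M f V"
  unfolding L2_infdist_def by (rule cINF_greatest) auto

lemma L2_infdist_approx:
  assumes "V \<noteq> {}" "L2_infdist M f V < c"
  obtains v where "v \<in> V" "L2norm M (\<lambda>x. f x - v x) < c"
  using assms bdd_below_L2_dist[of M f V] unfolding L2_infdist_def by (auto simp: cINF_less_iff)

lemma L2_infdist_le_closure:
  assumes f: "L2fun M f" and V: "L2_subspace M V" and p: "p \<in> L2_closure M V"
  shows "L2_infdist M f V \<le> L2norm M (\<lambda>x. f x - p x)"
proof (rule field_le_epsilon)
  fix e :: real assume "e > 0"
  then obtain v where v: "v \<in> V" "L2norm M (\<lambda>x. p x - v x) < e"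
    using L2_closureE[OF p] by blast
  have "L2_infdist M f V \<le> L2norm M (\<lambda>x. f x - v x)"
    by (rule L2_infdist_le[OF v(1)])
  also have "\<dots> \<le> L2norm M (\<lambda>x. f x - p x) + e"
    using L2norm_diff_triangle[OF f L2_closure_L2fun[OF p] L2_subspaceD(1)[OF V v(1)]] v(2) by linarith
  finally show "L2_infdist M f V \<le> L2norm M (\<lambda>x. f x - p x) + e" .
qed

lemma L2_closure_add_cmult:
  assumes V: "L2_subspace M V" and p: "p \<in> L2_closure M V" and v: "v \<in> V"
  shows "(\<lambda>x. p x + c * v x) \<in> L2_closure M V"
proof -
  have "\<exists>u\<in>V. L2norm M (\<lambda>x. (p x + c * v x) - u x) < e" if e: "e > 0" for e
  proof -
    obtain u where "u \<in> V" "L2norm M (\<lambda>x. p x - u x) < e"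
      using L2_closureE[OF p e] by blast
    then show ?thesis
      using L2_subspaceD(3)[OF V _ v, of u c] by (intro bexI[of _ "\<lambda>x. u x + c * v x"]) auto
  qed
  moreover have "L2fun M (\<lambda>x. p x + c * v x)"
    by (intro L2fun_intros L2_closure_L2fun[OF p] L2_subspaceD(1)[OF V v])
  ultimately show ?thesis
    by (simp add: L2_closure_def)
qed

lemma L2norm_square_diff_le_infdist:
  assumes f: "L2fun M f" and V: "L2_subspace M V" and v: "v \<in> V" and w: "w \<in> V"
  shows "(L2norm M (\<lambda>x. v x - w x))\<^sup>2
    \<le> 2 * (L2norm M (\<lambda>x. f x - v x))\<^sup>2 + 2 * (L2norm M (\<lambda>x. f x - w x))\<^sup>2 - 4 * (L2_infdist M f V)\<^sup>2"
proof -
  let ?a = "\<lambda>x. f x - v x" and ?b = "\<lambda>x. f x - w x" and ?mid = "\<lambda>x. 1/2 * v x + 1/2 * w x"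
  have "?mid \<in> V"
    by (intro L2_subspaceD(3)[OF V] L2_subspace_cmult[OF V] v w)
  then have "L2_infdist M f V \<le> L2norm M (\<lambda>x. f x - ?mid x)"
    by (rule L2_infdist_le)
  also have "(\<lambda>x. f x - ?mid x) = (\<lambda>x. 1/2 * (?a x + ?b x))"
    by (auto simp: algebra_simps)
  finally have "2 * L2_infdist M f V \<le> L2norm M (\<lambda>x. ?a x + ?b x)"
    unfolding L2norm_cmult by simp
  moreover have "0 \<le> L2_infdist M f V"
    using v by (intro L2_infdist_nonneg) auto
  ultimately have "(2 * L2_infdist M f V)\<^sup>2 \<le> (L2norm M (\<lambda>x. ?a x + ?b x))\<^sup>2"
    by (intro power_mono) auto
  moreover have "L2norm M (\<lambda>x. ?a x - ?b x) = L2norm M (\<lambda>x. v x - w x)"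
    using L2norm_minus_commute[of M w v] by simp
  moreover have "L2fun M ?a" "L2fun M ?b"
    by (intro L2fun_diff f L2_subspaceD(1)[OF V] v w)+
  ultimately show ?thesis
    using L2norm_parallelogram[of M ?a ?b] by (simp add: power_mult_distrib)
qed

lemma L2_minimizing_sequence:
  assumes "V \<noteq> {}"
  obtains v where "\<And>n. v n \<in> V"
    "\<And>n. (L2norm M (\<lambda>x. f x - v n x))\<^sup>2 \<le> (L2_infdist M f V)\<^sup>2 + ((1/2)^n / 2)\<^sup>2"
proof -
  have "\<exists>v\<in>V. (L2norm M (\<lambda>x. f x - v x))\<^sup>2 \<le> (L2_infdist M f V)\<^sup>2 + ((1/2)^n / 2)\<^sup>2" for n :: nat
  proof -
    let ?c = "sqrt ((L2_infdist M f V)\<^sup>2 + ((1/2)^n / 2)\<^sup>2)"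
    have "L2_infdist M f V < ?c"
      by (rule real_less_rsqrt) simp
    then obtain v where v: "v \<in> V" "L2norm M (\<lambda>x. f x - v x) < ?c"
      by (rule L2_infdist_approx[OF assms])
    then have "(L2norm M (\<lambda>x. f x - v x))\<^sup>2 \<le> ?c\<^sup>2"
      by (intro power_mono) auto
    then show ?thesis
      using v(1) by auto
  qed
  then show thesis
    using that by metis
qed

lemma L2_minimizing_sequence_summable:
  assumes f: "L2fun M f" and V: "L2_subspace M V" and v: "\<And>n. v n \<in> V"
    and near: "\<And>n. (L2norm M (\<lambda>x. f x - v n x))\<^sup>2 \<le> (L2_infdist M f V)\<^sup>2 + ((1/2)^n / 2)\<^sup>2"
  shows "summable (\<lambda>n. L2norm M (\<lambda>x. v (Suc n) x - v n x))"
proof -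
  have "L2norm M (\<lambda>x. v (Suc n) x - v n x) \<le> (1/2)^n" for n
  proof (rule power2_le_imp_le)
    have "((1/2)^Suc n / 2)\<^sup>2 \<le> ((1/2)^n / 2 :: real)\<^sup>2"
      by (intro power_mono) auto
    then show "(L2norm M (\<lambda>x. v (Suc n) x - v n x))\<^sup>2 \<le> ((1/2)^n)\<^sup>2"
      using L2norm_square_diff_le_infdist[OF f V v v, of "Suc n" n] near[of n] near[of "Suc n"]
      unfolding power_divide by simp
  qed simp
  then show ?thesis
    by (intro summable_comparison_test[OF _ summable_geometric[of "1/2"]]) auto
qed

lemma L2_infdist_attained:
  assumes f: "L2fun M f" and V: "L2_subspace M V"
  obtains p where "p \<in> L2_closure M V" "L2norm M (\<lambda>x. f x - p x) = L2_infdist M f V"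
proof -
  define \<delta> where "\<delta> = L2_infdist M f V"
  have nonempty: "V \<noteq> {}"
    using L2_subspaceD(2)[OF V] by blast
  have \<delta>: "0 \<le> \<delta>"
    unfolding \<delta>_def by (rule L2_infdist_nonneg[OF nonempty])
  obtain v where v: "\<And>n. v n \<in> V"
    and near: "\<And>n. (L2norm M (\<lambda>x. f x - v n x))\<^sup>2 \<le> \<delta>\<^sup>2 + ((1/2)^n / 2)\<^sup>2"
    unfolding \<delta>_def using L2_minimizing_sequence[OF nonempty] by blast
  note vL2 = L2_subspaceD(1)[OF V v]
  have "summable (\<lambda>n. L2norm M (\<lambda>x. v (Suc n) x - v n x))"
    using near unfolding \<delta>_def by (rule L2_minimizing_sequence_summable[OF f V v])
  from L2_complete[OF vL2 this]
  obtain p where p: "L2fun M p" and lim: "(\<lambda>n. L2norm M (\<lambda>x. v n x - p x)) \<longlonglongrightarrow> 0"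
    by blast
  have closure: "p \<in> L2_closure M V"
    by (rule L2_closureI_LIMSEQ[OF p v lim])
  have "L2norm M (\<lambda>x. f x - p x) \<le> \<delta>"
  proof (rule LIMSEQ_le_const)
    let ?bound = "\<lambda>n. sqrt (\<delta>\<^sup>2 + ((1/2)^n / 2)\<^sup>2) + L2norm M (\<lambda>x. v n x - p x)"
    have "?bound \<longlonglongrightarrow> sqrt (\<delta>\<^sup>2 + (0 / 2)\<^sup>2) + 0"
      by (intro tendsto_intros lim LIMSEQ_realpow_zero) auto
    then show "?bound \<longlonglongrightarrow> \<delta>"
      using \<delta> by simp
    have "L2norm M (\<lambda>x. f x - p x) \<le> ?bound n" for n
      using real_le_rsqrt[OF near[of n]] L2norm_diff_triangle[OF f vL2[of n] p] by linarith
    then show "\<exists>N. \<forall>n\<ge>N. L2norm M (\<lambda>x. f x - p x) \<le> ?bound n"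
      by blast
  qed
  moreover have "\<delta> \<le> L2norm M (\<lambda>x. f x - p x)"
    unfolding \<delta>_def by (rule L2_infdist_le_closure[OF f V closure])
  ultimately show thesis
    using that[OF closure] by (simp add: \<delta>_def)
qed

theorem L2_projection:
  assumes f: "L2fun M f" and V: "L2_subspace M V"
  obtains p where "p \<in> L2_closure M V" "\<And>v. v \<in> V \<Longrightarrow> L2inner M (\<lambda>x. f x - p x) v = 0"
proof -
  obtain p where p: "p \<in> L2_closure M V" and dist: "L2norm M (\<lambda>x. f x - p x) = L2_infdist M f V"
    by (rule L2_infdist_attained[OF f V])
  let ?r = "\<lambda>x. f x - p x"
  have r: "L2fun M ?r"
    by (intro L2fun_diff f L2_closure_L2fun[OF p])
  have "L2inner M ?r v = 0" if v: "v \<in> V" for v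
  proof (rule quadratic_bound_imp_eq_0)
    fix c
    have vL2: "L2fun M v"
      by (rule L2_subspaceD(1)[OF V v])
    have "L2norm M ?r \<le> L2norm M (\<lambda>x. ?r x - c * v x)"
      using L2_infdist_le_closure[OF f V L2_closure_add_cmult[OF V p v, of c]]
      by (simp add: dist diff_diff_eq)
    then have "(L2norm M ?r)\<^sup>2 \<le> (L2norm M (\<lambda>x. ?r x - c * v x))\<^sup>2"
      by (intro power_mono) auto
    also have "\<dots> = (L2norm M ?r)\<^sup>2 - 2 * Re (cnj c * L2inner M ?r v) + (cmod c * L2norm M v)\<^sup>2"
      by (simp only: L2norm_square_diff[OF r L2fun_cmult[OF vL2]] L2inner_cmult_right L2norm_cmult)
    finally show "2 * Re (cnj c * L2inner M ?r v) \<le> (cmod c)\<^sup>2 * (L2norm M v)\<^sup>2"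
      by (simp add: power_mult_distrib)
  qed simp
  with p show thesis by (rule that)
qed

corollary L2_closureI_orthogonal:
  assumes f: "L2fun M f" and V: "L2_subspace M V"
    and orthogonal: "\<And>r. L2fun M r \<Longrightarrow> (\<And>v. v \<in> V \<Longrightarrow> L2inner M r v = 0) \<Longrightarrow> L2inner M r f = 0"
  shows "f \<in> L2_closure M V"
proof -
  obtain p where p: "p \<in> L2_closure M V" and perp: "\<And>v. v \<in> V \<Longrightarrow> L2inner M (\<lambda>x. f x - p x) v = 0"
    using L2_projection[OF f V] by blast
  let ?r = "\<lambda>x. f x - p x"
  note pL2 = L2_closure_L2fun[OF p]
  have r: "L2fun M ?r"
    by (rule L2fun_diff[OF f pL2])
  have "L2inner M ?r ?r = L2inner M ?r f - L2inner M ?r p"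
    by (rule L2inner_diff_right[OF r f pL2])
  also have "\<dots> = 0"
    using orthogonal[OF r perp] L2inner_L2_closure_eq_0[OF r L2_subspaceD(1)[OF V] p perp] by simp
  finally have "L2norm M ?r = 0"
    by (simp add: L2inner_self)
  then have "L2norm M (\<lambda>x. f x - v x) \<le> L2norm M (\<lambda>x. p x - v x)" if "v \<in> V" for v
    using L2norm_diff_triangle[OF f pL2 L2_subspaceD(1)[OF V that]] by simp
  then show ?thesis
    using p f unfolding L2_closure_def mem_Collect_eq by (meson le_less_trans)
qed

lemma L2_projection_unique:
  assumes f: "L2fun M f" and V: "L2_subspace M V" and p: "p \<in> L2_closure M V" and q: "q \<in> V"
    and orthogonal: "\<And>v. v \<in> V \<Longrightarrow> L2inner M (\<lambda>x. f x - p x) v = 0"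
    and closer: "L2norm M (\<lambda>x. f x - q x) \<le> L2norm M (\<lambda>x. f x - p x)"
  shows "L2norm M (\<lambda>x. p x - q x) = 0"
proof -
  note pL2 = L2_closure_L2fun[OF p] and qL2 = L2_subspaceD(1)[OF V q]
  have fp: "L2fun M (\<lambda>x. f x - p x)" and pq: "L2fun M (\<lambda>x. p x - q x)"
    by (intro L2fun_diff f pL2 qL2)+
  have "L2inner M (\<lambda>x. f x - p x) (\<lambda>x. p x - q x) = 0"
    using L2inner_L2_closure_eq_0[OF fp L2_subspaceD(1)[OF V] p orthogonal] orthogonal[OF q]
    by (simp add: L2inner_diff_right[OF fp pL2 qL2])
  then have "(L2norm M (\<lambda>x. f x - q x))\<^sup>2 = (L2norm M (\<lambda>x. f x - p x))\<^sup>2 + (L2norm M (\<lambda>x. p x - q x))\<^sup>2"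
    using L2norm_square_add[OF fp pq] by simp
  moreover have "(L2norm M (\<lambda>x. f x - q x))\<^sup>2 \<le> (L2norm M (\<lambda>x. f x - p x))\<^sup>2"
    using closer by (intro power_mono) auto
  ultimately show ?thesis
    by simp
qed

lemma (in finite_measure) AE_eq_0_if_orthogonal_indicators:
  assumes r: "L2fun M r" and orthogonal: "\<And>A. A \<in> sets M \<Longrightarrow> L2inner M r (\<lambda>x. indicator A x) = 0"
  shows "AE x in M. r x = 0"
proof (rule density_zero[OF L2fun_integrable[OF r]])
  fix A assume "A \<in> sets M"
  have "set_lebesgue_integral M A r = L2inner M r (\<lambda>x. indicator A x)"
    unfolding set_lebesgue_integral_def L2inner_def
    by (intro Bochner_Integration.integral_cong refl) (simp add: indicator_def)
  then show "set_lebesgue_integral M A r = 0"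
    using orthogonal \<open>A \<in> sets M\<close> by simp
qed

section \<open>Functions orthogonal to the eigenfunctions\<close>

subsection \<open>Composition with measure-preserving maps\<close>

definition mp_map :: "'a measure \<Rightarrow> ('a \<Rightarrow> 'a) \<Rightarrow> bool" where
  "mp_map M R \<longleftrightarrow> R \<in> measurable M M \<and> distr M M R = M"

lemma mp_map_measurable [measurable_dest]: "mp_map M R \<Longrightarrow> R \<in> measurable M M"
  by (simp add: mp_map_def)

lemma mp_map_funpow: "mp_map M R \<Longrightarrow> mp_map M (R ^^ n)"
proof (induction n)
  case 0
  have "distr M M (\<lambda>x. x) = M"
    by (rule distr_id2) simp
  then show ?case
    by (simp add: mp_map_def id_def)
next
  case (Suc n)
  then have R: "R \<in> measurable M M" "R ^^ n \<in> measurable M M"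
    and distr: "distr M M R = M" "distr M M (R ^^ n) = M"
    by (auto simp: mp_map_def)
  have "distr M M (R \<circ> R ^^ n) = M"
    using distr_distr[OF R] distr by simp
  then show ?case
    using measurable_comp[OF R(2,1)] by (simp add: mp_map_def comp_def)
qed

lemma AE_mp_map: "mp_map M R \<Longrightarrow> AE x in M. P x \<Longrightarrow> AE x in M. P (R x)"
  unfolding mp_map_def by (metis AE_distrD)

lemma integrable_mp_map:
  fixes f :: "'a \<Rightarrow> 'b::{banach, second_countable_topology}"
  shows "mp_map M R \<Longrightarrow> integrable M f \<Longrightarrow> integrable M (\<lambda>x. f (R x))"
  using integrable_distr[of R M M f] by (simp add: mp_map_def)

lemma integral_mp_map:
  fixes f :: "'a \<Rightarrow> 'b::{banach, second_countable_topology}"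
  shows "mp_map M R \<Longrightarrow> f \<in> borel_measurable M \<Longrightarrow> (\<integral>x. f (R x) \<partial>M) = (\<integral>x. f x \<partial>M)"
  using integral_distr[of R M M f] by (simp add: mp_map_def)

lemma emeasure_mp_map:
  "mp_map M R \<Longrightarrow> A \<in> sets M \<Longrightarrow> emeasure M (R -` A \<inter> space M) = emeasure M A"
  using emeasure_distr[of R M M A] by (simp add: mp_map_def)

lemma L2fun_mp_map: "mp_map M R \<Longrightarrow> L2fun M f \<Longrightarrow> L2fun M (\<lambda>x. f (R x))"
  unfolding L2fun_def using integrable_mp_map[of M R "\<lambda>x. (cmod (f x))\<^sup>2"]
  by (auto simp: mp_map_def)

lemma L2inner_mp_map:
  "mp_map M R \<Longrightarrow> L2fun M f \<Longrightarrow> L2fun M g \<Longrightarrow>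
    L2inner M (\<lambda>x. f (R x)) (\<lambda>x. g (R x)) = L2inner M f g"
  unfolding L2inner_def using integral_mp_map[of M R "\<lambda>x. f x * cnj (g x)"] integrable_mult_cnj[of M f g]
  by auto

lemma L2norm_mp_map: "mp_map M R \<Longrightarrow> L2fun M f \<Longrightarrow> L2norm M (\<lambda>x. f (R x)) = L2norm M f"
  unfolding L2norm_def using integral_mp_map[of M R "\<lambda>x. (cmod (f x))\<^sup>2"] by (auto simp: L2fun_def)

lemma L2fun_funpow: "mp_map M T \<Longrightarrow> L2fun M f \<Longrightarrow> L2fun M (\<lambda>x. f ((T ^^ n) x))"
  by (rule L2fun_mp_map[OF mp_map_funpow])

lemma L2norm_funpow: "mp_map M T \<Longrightarrow> L2fun M f \<Longrightarrow> L2norm M (\<lambda>x. f ((T ^^ n) x)) = L2norm M f"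
  by (rule L2norm_mp_map[OF mp_map_funpow])

subsection \<open>Twisted ergodic sums\<close>

definition eigen_orthogonal :: "'a measure \<Rightarrow> ('a \<Rightarrow> 'a) \<Rightarrow> ('a \<Rightarrow> complex) \<Rightarrow> bool" where
  "eigen_orthogonal M T f \<longleftrightarrow> L2fun M f \<and> (\<forall>g. eigenfunction M T g \<longrightarrow> L2inner M f g = 0)"

definition twisted_coboundaries :: "'a measure \<Rightarrow> ('a \<Rightarrow> 'a) \<Rightarrow> complex \<Rightarrow> ('a \<Rightarrow> complex) set" where
  "twisted_coboundaries M T l = {\<lambda>x. h x - l * h (T x) | h. L2fun M h}"

definition twisted_sum :: "('a \<Rightarrow> 'a) \<Rightarrow> complex \<Rightarrow> ('a \<Rightarrow> complex) \<Rightarrow> nat \<Rightarrow> 'a \<Rightarrow> complex" where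
  "twisted_sum T l f n x = (\<Sum>k<n. l ^ k * f ((T ^^ k) x))"

lemma eigen_orthogonal_L2fun: "eigen_orthogonal M T f \<Longrightarrow> L2fun M f"
  by (simp add: eigen_orthogonal_def)

lemma twisted_coboundariesI:
  assumes "L2fun M h" "\<And>x. s x = h x - l * h (T x)"
  shows "s \<in> twisted_coboundaries M T l"
  using assms by (auto simp: twisted_coboundaries_def)

lemma twisted_coboundariesE:
  assumes "s \<in> twisted_coboundaries M T l"
  obtains h where "L2fun M h" "s = (\<lambda>x. h x - l * h (T x))"
  using assms unfolding twisted_coboundaries_def mem_Collect_eq by blast

lemma L2_subspace_twisted_coboundaries:
  assumes T: "mp_map M T"
  shows "L2_subspace M (twisted_coboundaries M T l)"
  unfolding L2_subspace_def
proof (intro conjI ballI allI)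
  show "(\<lambda>x. 0) \<in> twisted_coboundaries M T l"
    by (rule twisted_coboundariesI[OF L2fun_zero]) simp
next
  fix s assume "s \<in> twisted_coboundaries M T l"
  then show "L2fun M s"
    by (elim twisted_coboundariesE) (simp add: L2fun_diff L2fun_cmult L2fun_mp_map[OF T])
next
  fix s t c assume "s \<in> twisted_coboundaries M T l" "t \<in> twisted_coboundaries M T l"
  then obtain h k where h: "L2fun M h" "s = (\<lambda>x. h x - l * h (T x))"
    and k: "L2fun M k" "t = (\<lambda>x. k x - l * k (T x))"
    by (elim twisted_coboundariesE)
  show "(\<lambda>x. s x + c * t x) \<in> twisted_coboundaries M T l"
    by (rule twisted_coboundariesI[of M "\<lambda>x. h x + c * k x"])
      (auto simp: h k algebra_simps intro!: L2fun_intros)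
qed

lemma eigen_equation_if_orthogonal_twisted_coboundaries:
  assumes T: "mp_map M T" and l: "cmod l = 1" and r: "L2fun M r"
    and orthogonal: "\<And>s. s \<in> twisted_coboundaries M T l \<Longrightarrow> L2inner M r s = 0"
  shows "AE x in M. r (T x) = cnj l * r x"
proof -
  let ?Ur = "\<lambda>x. l * r (T x)"
  have Ur: "L2fun M ?Ur"
    by (intro L2fun_cmult L2fun_mp_map[OF T] r)
  have "L2inner M r (\<lambda>x. r x - ?Ur x) = 0"
    by (intro orthogonal twisted_coboundariesI[OF r]) simp
  then have "L2inner M r ?Ur = of_real ((L2norm M r)\<^sup>2)"
    by (simp add: L2inner_diff_right[OF r r Ur] L2inner_self)
  then have "Re (L2inner M r ?Ur) = (L2norm M r)\<^sup>2"
    by (simp only: Re_complex_of_real)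
  moreover have "L2norm M ?Ur = L2norm M r"
    by (simp add: L2norm_cmult l L2norm_mp_map[OF T r])
  ultimately have "(L2norm M (\<lambda>x. r x - ?Ur x))\<^sup>2 = 0"
    by (simp add: L2norm_square_diff[OF r Ur])
  then have "AE x in M. r x - ?Ur x = 0"
    using L2norm_eq_0_iff[OF L2fun_diff[OF r Ur]] by simp
  then show ?thesis
  proof eventually_elim
    case (elim x)
    have "cnj l * l = 1"
      using l by (metis complex_norm_square mult.commute of_real_1 one_power2)
    then have "r (T x) = cnj l * ?Ur x"
      by (simp flip: mult.assoc)
    then show ?case
      using elim by simp
  qed
qed

text \<open>Von Neumann's argument: the orthogonal complement of the twisted coboundaries consists of
  eigenfunctions (and \<open>0\<close>).\<close>

lemma eigen_orthogonal_in_closure_twisted_coboundaries: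
  assumes T: "mp_map M T" and f: "eigen_orthogonal M T f" and l: "cmod l = 1"
  shows "f \<in> L2_closure M (twisted_coboundaries M T l)"
proof (rule L2_closureI_orthogonal[OF eigen_orthogonal_L2fun[OF f] L2_subspace_twisted_coboundaries[OF T]])
  fix r assume r: "L2fun M r" and "\<And>s. s \<in> twisted_coboundaries M T l \<Longrightarrow> L2inner M r s = 0"
  then have equation: "AE x in M. r (T x) = cnj l * r x"
    by (intro eigen_equation_if_orthogonal_twisted_coboundaries[OF T l])
  show "L2inner M r f = 0"
  proof (cases "AE x in M. r x = 0")
    case True
    then show ?thesis
      by (rule L2inner_eq_0_if_AE)
  next
    case False
    then have "eigenfunction M T r"
      using r equation by (auto simp: eigenfunction_def)
    then show ?thesis
      using f cnj_L2inner[of M f r] by (simp add: eigen_orthogonal_def)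
  qed
qed

lemma L2fun_twisted_sum: "mp_map M T \<Longrightarrow> L2fun M f \<Longrightarrow> L2fun M (twisted_sum T l f n)"
  unfolding twisted_sum_def[abs_def] by (intro L2fun_sum L2fun_cmult L2fun_funpow)

lemma twisted_sum_add:
  "twisted_sum T l f (m + n) x = twisted_sum T l f m x + l ^ m * twisted_sum T l f n ((T ^^ m) x)"
proof (induction n)
  case (Suc n)
  have "(T ^^ (m + n)) x = (T ^^ n) ((T ^^ m) x)"
    by (metis add.commute comp_apply funpow_add)
  with Suc show ?case
    by (simp add: twisted_sum_def power_add algebra_simps)
qed (simp add: twisted_sum_def)

lemma L2norm_twisted_sum_mult_le:
  assumes T: "mp_map M T" and f: "L2fun M f" and l: "cmod l = 1"
  shows "L2norm M (twisted_sum T l f (k * n)) \<le> real k * L2norm M (twisted_sum T l f n)"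
proof (induction k)
  case 0
  then show ?case
    by (simp add: twisted_sum_def[abs_def])
next
  case (Suc k)
  let ?S = "twisted_sum T l f" and ?R = "T ^^ (k * n)"
  note S = L2fun_twisted_sum[OF T f]
  have "L2norm M (?S (Suc k * n)) = L2norm M (\<lambda>x. ?S (k * n) x + l ^ (k * n) * ?S n (?R x))"
    by (simp add: add.commute[of n] flip: twisted_sum_add)
  also have "\<dots> \<le> L2norm M (?S (k * n)) + L2norm M (\<lambda>x. l ^ (k * n) * ?S n (?R x))"
    by (intro L2norm_triangle L2fun_cmult L2fun_funpow T S)
  also have "\<dots> = L2norm M (?S (k * n)) + L2norm M (?S n)"
    by (simp add: L2norm_cmult norm_power l L2norm_funpow[OF T S])
  finally show ?case
    using Suc.IH by (simp add: algebra_simps)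
qed

lemma L2norm_twisted_sum_le:
  assumes "mp_map M T" "L2fun M f" "cmod l = 1"
  shows "L2norm M (twisted_sum T l f n) \<le> real n * L2norm M f"
  using L2norm_twisted_sum_mult_le[OF assms, of n 1] by (simp add: twisted_sum_def[abs_def])

lemma twisted_sum_coboundary:
  "twisted_sum T l (\<lambda>x. h x - l * h (T x)) n x = h x - l ^ n * h ((T ^^ n) x)"
  by (induction n) (auto simp: twisted_sum_def algebra_simps)

lemma L2norm_twisted_sum_coboundary_le:
  assumes T: "mp_map M T" and h: "L2fun M h" and l: "cmod l = 1"
  shows "L2norm M (twisted_sum T l (\<lambda>x. h x - l * h (T x)) n) \<le> 2 * L2norm M h"
proof -
  have "L2norm M (twisted_sum T l (\<lambda>x. h x - l * h (T x)) n) = L2norm M (\<lambda>x. h x - l ^ n * h ((T ^^ n) x))"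
    by (simp add: twisted_sum_coboundary[abs_def])
  also have "\<dots> \<le> L2norm M h + L2norm M (\<lambda>x. l ^ n * h ((T ^^ n) x))"
    by (intro L2norm_triangle_diff h L2fun_cmult L2fun_funpow T)
  also have "\<dots> = 2 * L2norm M h"
    by (simp add: L2norm_cmult norm_power l L2norm_funpow[OF T h])
  finally show ?thesis .
qed

lemma twisted_sum_small:
  assumes T: "mp_map M T" and f: "eigen_orthogonal M T f" and l: "cmod l = 1" and e: "e > 0"
  obtains n where "n \<ge> 1" "L2norm M (twisted_sum T l f n) < e * real n"
proof -
  note fL2 = eigen_orthogonal_L2fun[OF f]
  obtain s where "s \<in> twisted_coboundaries M T l" and near: "L2norm M (\<lambda>x. f x - s x) < e / 2"
    using L2_closureE[OF eigen_orthogonal_in_closure_twisted_coboundaries[OF T f l], of "e / 2"] e by auto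
  then obtain h where h: "L2fun M h" and s: "s = (\<lambda>x. h x - l * h (T x))"
    by (elim twisted_coboundariesE)
  have sL2: "L2fun M s"
    unfolding s by (intro L2fun_intros h L2fun_mp_map[OF T])
  obtain n where "4 * L2norm M h / e < real n"
    using reals_Archimedean2 by blast
  then have n: "4 * L2norm M h < e * real n"
    using e by (simp add: field_simps)
  have "L2norm M (twisted_sum T l f n)
      = L2norm M (\<lambda>x. twisted_sum T l s n x + twisted_sum T l (\<lambda>x. f x - s x) n x)"
    by (simp add: twisted_sum_def[abs_def] algebra_simps flip: sum.distrib)
  also have "\<dots> \<le> L2norm M (twisted_sum T l s n) + L2norm M (twisted_sum T l (\<lambda>x. f x - s x) n)"
    by (intro L2norm_triangle L2fun_twisted_sum T L2fun_diff fL2 sL2)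
  also have "\<dots> \<le> 2 * L2norm M h + real n * L2norm M (\<lambda>x. f x - s x)"
    unfolding s by (intro add_mono L2norm_twisted_sum_coboundary_le L2norm_twisted_sum_le T h l)
      (use sL2 fL2 in \<open>auto simp: s intro: L2fun_diff\<close>)
  also have "\<dots> \<le> 2 * L2norm M h + real n * (e / 2)"
    using near by (intro add_left_mono mult_left_mono) auto
  also have "\<dots> < e * real n"
    using n by (simp add: field_simps)
  finally have "L2norm M (twisted_sum T l f n) < e * real n" .
  moreover have "n \<ge> 1"
    using n L2norm_nonneg[of M h] by (cases n) auto
  ultimately show thesis
    using that by blast
qed

lemma L2norm_twisted_sum_square:
  assumes T: "mp_map M T" and f: "L2fun M f"
  shows "complex_of_real ((L2norm M (twisted_sum T l f n))\<^sup>2)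
    = (\<Sum>i<n. \<Sum>j<n. l ^ i * cnj (l ^ j) * L2inner M (\<lambda>x. f ((T ^^ i) x)) (\<lambda>x. f ((T ^^ j) x)))"
  unfolding twisted_sum_def[abs_def]
  by (rule L2norm_square_sum) (intro L2fun_funpow T f)

lemma continuous_on_L2norm_twisted_sum:
  assumes T: "mp_map M T" and f: "L2fun M f"
  shows "continuous_on UNIV (\<lambda>l. L2norm M (twisted_sum T l f n))"
proof -
  have "continuous_on UNIV (\<lambda>l. sqrt (Re (complex_of_real ((L2norm M (twisted_sum T l f n))\<^sup>2))))"
    unfolding L2norm_twisted_sum_square[OF T f] by (intro continuous_intros)
  then show ?thesis
    by simp
qed

text \<open>A Dini argument: the normalised sums decrease along multiples, and the circle is compact.\<close>

lemma twisted_sum_uniformly_small: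
  assumes T: "mp_map M T" and f: "eigen_orthogonal M T f" and e: "e > 0"
  obtains n where "n \<ge> 1" "\<And>k l. cmod l = 1 \<Longrightarrow> L2norm M (twisted_sum T l f (k * n)) \<le> e * real (k * n)"
proof -
  let ?S = "\<lambda>n l. L2norm M (twisted_sum T l f n)"
  note fL2 = eigen_orthogonal_L2fun[OF f]
  have small_open: "open {l. ?S n l < e * real n}" for n
    by (intro open_Collect_less continuous_on_L2norm_twisted_sum[OF T fL2] continuous_on_const)
  have small_cover: "sphere 0 1 \<subseteq> (\<Union>n\<in>{1..}. {l. ?S n l < e * real n})"
  proof
    fix l :: complex assume "l \<in> sphere 0 1"
    then have "cmod l = 1" by simp
    then obtain n where "n \<ge> 1" "?S n l < e * real n"
      by (rule twisted_sum_small[OF T f _ e])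
    then show "l \<in> (\<Union>n\<in>{1..}. {l. ?S n l < e * real n})"
      by auto
  qed
  obtain C where C: "C \<subseteq> {1..}" "finite C" "sphere 0 1 \<subseteq> (\<Union>n\<in>C. {l. ?S n l < e * real n})"
    by (rule compactE_image[OF compact_sphere small_open small_cover])
  have "?S (k * \<Prod>C) l \<le> e * real (k * \<Prod>C)" if l: "cmod l = 1" for k l
  proof -
    obtain n where n: "n \<in> C" "?S n l < e * real n"
      using C(3) l by auto
    then have "n dvd k * \<Prod>C"
      using dvd_prodI[OF C(2) n(1), of id] by simp
    then obtain j where j: "k * \<Prod>C = j * n"
      by (metis dvd_def mult.commute)
    have "?S (j * n) l \<le> real j * ?S n l"
      by (rule L2norm_twisted_sum_mult_le[OF T fL2 l])
    also have "\<dots> \<le> real j * (e * real n)"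
      using n(2) by (intro mult_left_mono) auto
    finally show ?thesis
      unfolding j by (simp add: mult.left_commute)
  qed
  moreover have "\<Prod>C \<ge> 1"
    using C(1) by (intro prod_ge_1) auto
  ultimately show thesis
    using that by blast
qed

subsection \<open>Toeplitz forms and roots of unity\<close>

lemma powi_mult_cnj_powi: "cmod z = 1 \<Longrightarrow> z powi j * cnj (z powi k) = z powi (j - k)"
  by (metis divide_conv_cnj norm_power_int norm_zero power_int_1_left power_int_diff zero_neq_one)

lemma exists_root_unity_powi_ne_1:
  fixes L :: nat and k :: int
  assumes L: "L > 0" and k: "\<not> int L dvd k"
  shows "\<exists>w::complex. w \<noteq> 0 \<and> w ^ L = 1 \<and> w powi k \<noteq> 1"
proof -
  define \<omega> where "\<omega> j = cis (2 * pi * real j / real L)" for j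
  have inj: "inj_on \<omega> {..<L}"
    unfolding \<omega>_def using Complex.bij_betw_roots_unity[OF L] by (rule bij_betw_imp_inj_on)
  define w where "w = \<omega> 1"
  have w: "w \<noteq> 0" "w ^ L = 1"
    using L by (auto simp: w_def \<omega>_def Complex.DeMoivre)
  define m where "m = k mod int L"
  have m: "0 \<le> m" "m < int L" "m \<noteq> 0"
    using L k by (auto simp: m_def dvd_eq_mod_eq_0)
  define r where "r = nat m"
  have r: "int r = m" "r < L" "r \<noteq> 0"
    using m by (auto simp: r_def)
  have "k = int L * (k div int L) + int r"
    by (simp add: r(1) m_def)
  from arg_cong[OF this, of "\<lambda>k. w powi k"] have "w powi k = w ^ r"
    using w by (simp add: power_int_add power_int_mult)
  also have "w ^ r = \<omega> r"
    by (simp add: w_def \<omega>_def Complex.DeMoivre field_simps)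
  also have "\<omega> r \<noteq> \<omega> 0"
    using inj_onD[OF inj, of r 0] r L by auto
  finally have "w powi k \<noteq> 1"
    by (simp add: \<omega>_def)
  with w show ?thesis
    by blast
qed

lemma sum_powi_roots_unity:
  fixes L :: nat and k :: int
  assumes L: "L > 0"
  shows "(\<Sum>z | z ^ L = 1. (z::complex) powi k) = (if int L dvd k then of_nat L else 0)"
proof (cases "int L dvd k")
  case True
  then obtain j where j: "k = int L * j" by blast
  have "z powi k = 1" if "z ^ L = 1" for z :: complex
    using that by (simp add: j power_int_mult)
  then show ?thesis
    using True card_roots_unity_eq[OF L] by simp
next
  case False
  then obtain w :: complex where w: "w \<noteq> 0" "w ^ L = 1" "w powi k \<noteq> 1"
    using exists_root_unity_powi_ne_1[OF L] by blast
  have "(\<Sum>z | z ^ L = 1. z powi k) = (\<Sum>z | z ^ L = 1. (w * z) powi k)"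
    by (rule sum.reindex_bij_witness[where i = "\<lambda>z. w * z" and j = "\<lambda>z. z / w"])
      (use w in \<open>auto simp: power_mult_distrib power_divide\<close>)
  also have "\<dots> = w powi k * (\<Sum>z | z ^ L = 1. z powi k)"
    by (simp add: power_int_mult_distrib sum_distrib_left)
  finally show ?thesis
    using w(3) False by simp
qed

lemma sum_roots_unity_laurent:
  fixes a :: "int \<Rightarrow> complex"
  assumes L: "L > 0" and S: "finite S" "0 \<in> S" and sep: "\<And>k. k \<in> S \<Longrightarrow> int L dvd k \<Longrightarrow> k = 0"
  shows "(\<Sum>z | z ^ L = 1. \<Sum>k\<in>S. a k * z powi k) = of_nat L * a 0"
proof -
  have "(\<Sum>z | z ^ L = 1. \<Sum>k\<in>S. a k * z powi k) = (\<Sum>k\<in>S. a k * (\<Sum>z | z ^ L = 1. z powi k))"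
    by (subst sum.swap) (simp add: sum_distrib_left)
  also have "\<dots> = (\<Sum>k\<in>S. if k = 0 then of_nat L * a 0 else 0)"
    using sep by (intro sum.cong refl) (auto simp: sum_powi_roots_unity[OF L])
  finally show ?thesis
    using S by simp
qed

lemma Parseval_roots_unity:
  fixes a :: "int \<Rightarrow> complex"
  assumes L: "L > 0" and S: "finite S" and sep: "\<And>j k. j \<in> S \<Longrightarrow> k \<in> S \<Longrightarrow> int L dvd j - k \<Longrightarrow> j = k"
  shows "(\<Sum>z | z ^ L = 1. (cmod (\<Sum>k\<in>S. a k * z powi k))\<^sup>2) = real L * (\<Sum>k\<in>S. (cmod (a k))\<^sup>2)"
proof -
  have square: "complex_of_real ((cmod (\<Sum>k\<in>S. a k * z powi k))\<^sup>2)
      = (\<Sum>j\<in>S. \<Sum>k\<in>S. a j * cnj (a k) * z powi (j - k))" if z: "z ^ L = 1" for z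
  proof -
    have "cmod z = 1"
      using power_eq_1_iff[OF z] L by simp
    then have "(a j * z powi j) * cnj (a k * z powi k) = a j * cnj (a k) * z powi (j - k)" for j k
      by (simp add: mult_ac del: complex_cnj_power_int flip: powi_mult_cnj_powi)
    then show ?thesis
      by (simp only: complex_norm_square cnj_sum sum_product)
  qed
  have "complex_of_real (\<Sum>z | z ^ L = 1. (cmod (\<Sum>k\<in>S. a k * z powi k))\<^sup>2)
      = (\<Sum>z | z ^ L = 1. \<Sum>j\<in>S. \<Sum>k\<in>S. a j * cnj (a k) * z powi (j - k))"
    unfolding of_real_sum by (intro sum.cong refl square) simp
  also have "\<dots> = (\<Sum>j\<in>S. \<Sum>k\<in>S. a j * cnj (a k) * (\<Sum>z | z ^ L = 1. z powi (j - k)))"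
    by (subst sum.swap, intro sum.cong refl, subst sum.swap) (simp add: sum_distrib_left)
  also have "\<dots> = (\<Sum>j\<in>S. \<Sum>k\<in>S. if j = k then of_nat L * (a j * cnj (a j)) else 0)"
    using sep by (intro sum.cong refl) (auto simp: sum_powi_roots_unity[OF L])
  also have "\<dots> = complex_of_real (real L * (\<Sum>k\<in>S. (cmod (a k))\<^sup>2))"
    using S by (simp add: sum_distrib_left complex_norm_square del: of_real_power)
  finally show ?thesis
    by (simp only: of_real_eq_iff)
qed

lemma sum_symmetric_int_interval:
  fixes \<phi> :: "int \<Rightarrow> 'a::comm_monoid_add"
  shows "(\<Sum>k\<in>{- int N..int N}. \<phi> k) = \<phi> 0 + (\<Sum>n<N. \<phi> (int n - int N)) + (\<Sum>n<N. \<phi> (int N - int n))"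
proof -
  have "{- int N..int N} = insert 0 ({- int N..<0} \<union> {0<..int N})"
    by auto
  then have "(\<Sum>k\<in>{- int N..int N}. \<phi> k) = \<phi> 0 + ((\<Sum>k\<in>{- int N..<0}. \<phi> k) + (\<Sum>k\<in>{0<..int N}. \<phi> k))"
    by (simp add: sum.union_disjoint disjoint_iff)
  also have "(\<Sum>k\<in>{- int N..<0}. \<phi> k) = (\<Sum>n<N. \<phi> (int n - int N))"
    by (rule sum.reindex_bij_witness[where i = "\<lambda>n. int n - int N" and j = "\<lambda>k. nat (k + int N)"]) auto
  also have "(\<Sum>k\<in>{0<..int N}. \<phi> k) = (\<Sum>n<N. \<phi> (int N - int n))"
    by (rule sum.reindex_bij_witness[where i = "\<lambda>n. int N - int n" and j = "\<lambda>k. nat (int N - k)"]) auto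
  finally show ?thesis
    by (simp add: add.assoc)
qed

lemma sum_int_differences:
  fixes \<phi> :: "int \<Rightarrow> 'a::comm_ring_1"
  shows "(\<Sum>n<N. \<Sum>m<N. \<phi> (int n - int m)) = (\<Sum>k\<in>{- int N<..<int N}. of_int (int N - \<bar>k\<bar>) * \<phi> k)"
proof (induction N)
  case (Suc N)
  have boundary: "{- int N..int N} = {- int N<..<int N} \<union> {- int N, int N}"
    by auto
  have "(\<Sum>n<Suc N. \<Sum>m<Suc N. \<phi> (int n - int m))
      = (\<Sum>n<N. \<Sum>m<N. \<phi> (int n - int m)) + (\<Sum>k\<in>{- int N..int N}. \<phi> k)"
    unfolding sum_symmetric_int_interval by (simp add: sum.distrib algebra_simps)
  also have "(\<Sum>n<N. \<Sum>m<N. \<phi> (int n - int m)) = (\<Sum>k\<in>{- int N..int N}. of_int (int N - \<bar>k\<bar>) * \<phi> k)"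
    unfolding Suc.IH by (rule sum.mono_neutral_left) (auto simp: boundary)
  also have "\<dots> + (\<Sum>k\<in>{- int N..int N}. \<phi> k) = (\<Sum>k\<in>{- int N..int N}. of_int (int (Suc N) - \<bar>k\<bar>) * \<phi> k)"
    by (simp add: algebra_simps flip: sum.distrib)
  also have "{- int N..int N} = {- int (Suc N)<..<int (Suc N)}"
    by auto
  finally show ?case .
qed simp

lemma sum_square_Toeplitz_le_Fejer:
  fixes a :: "int \<Rightarrow> complex"
  shows "real K * (\<Sum>n<K. \<Sum>m<K. (cmod (a (int n - int m)))\<^sup>2)
    \<le> (\<Sum>k\<in>{- int (2 * K)<..<int (2 * K)}. (cmod (of_int (int (2 * K) - \<bar>k\<bar>) * a k))\<^sup>2)"
proof -
  have "real K * (\<Sum>n<K. \<Sum>m<K. (cmod (a (int n - int m)))\<^sup>2)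
      = (\<Sum>k\<in>{- int K<..<int K}. (real K * of_int (int K - \<bar>k\<bar>)) * (cmod (a k))\<^sup>2)"
    unfolding sum_int_differences[of "\<lambda>k. (cmod (a k))\<^sup>2"] by (simp add: sum_distrib_left mult.assoc)
  also have "\<dots> \<le> (\<Sum>k\<in>{- int K<..<int K}. (cmod (of_int (int (2 * K) - \<bar>k\<bar>) * a k))\<^sup>2)"
  proof (rule sum_mono)
    fix k assume "k \<in> {- int K<..<int K}"
    then have "real K * of_int (int K - \<bar>k\<bar>) \<le> of_int (int (2 * K) - \<bar>k\<bar>) * of_int (int (2 * K) - \<bar>k\<bar>)"
      by (intro mult_mono) auto
    then show "(real K * of_int (int K - \<bar>k\<bar>)) * (cmod (a k))\<^sup>2 \<le> (cmod (of_int (int (2 * K) - \<bar>k\<bar>) * a k))\<^sup>2"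
      unfolding norm_mult power_mult_distrib norm_of_int power2_abs power2_eq_square[of "of_int _"]
      by (rule mult_right_mono) simp
  qed
  also have "\<dots> \<le> (\<Sum>k\<in>{- int (2 * K)<..<int (2 * K)}. (cmod (of_int (int (2 * K) - \<bar>k\<bar>) * a k))\<^sup>2)"
    by (rule sum_mono2) auto
  finally show ?thesis .
qed

text \<open>The Fejer kernel turns a nonnegative Toeplitz form into a trigonometric polynomial with
  coefficients \<open>(2 K - \<bar>k\<bar>) a k\<close>, whose mean square over the roots of unity is at most \<open>C\<close> times its mean.\<close>

lemma sum_square_Toeplitz_le:
  fixes a :: "int \<Rightarrow> complex" and g :: "complex \<Rightarrow> real"
  assumes K: "K > 0" and form: "\<And>z. cmod z = 1 \<Longrightarrow>
      complex_of_real (g z) = (\<Sum>n<2 * K. \<Sum>m<2 * K. z powi (int n - int m) * a (int n - int m))"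
    and nonneg: "\<And>z. cmod z = 1 \<Longrightarrow> 0 \<le> g z" and bound: "\<And>z. cmod z = 1 \<Longrightarrow> g z \<le> C"
  shows "(\<Sum>n<K. \<Sum>m<K. (cmod (a (int n - int m)))\<^sup>2) \<le> 2 * C * Re (a 0)"
proof -
  define N L where "N = 2 * K" and "L = 2 * N"
  define S where "S = {- int N<..<int N}"
  define b where "b k = of_int (int N - \<bar>k\<bar>) * a k" for k
  have L: "L > 0"
    using K by (simp add: L_def N_def)
  have unit: "cmod z = 1" if "z \<in> {z. z ^ L = 1}" for z
    using that L power_eq_1_iff[of z L] by simp
  have g: "complex_of_real (g z) = (\<Sum>k\<in>S. b k * z powi k)" if "z \<in> {z. z ^ L = 1}" for z
    using form[OF unit[OF that]] unfolding sum_int_differences[of "\<lambda>k. z powi k * a k"]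
    by (simp add: S_def N_def b_def mult_ac)
  have separated: "j = k" if "j \<in> S" "k \<in> S" "int L dvd j - k" for j k
    using that zdvd_imp_le[of "int L" "\<bar>j - k\<bar>"] by (fastforce simp: S_def L_def)
  have "complex_of_real (\<Sum>z | z ^ L = 1. g z) = (\<Sum>z | z ^ L = 1. \<Sum>k\<in>S. b k * z powi k)"
    unfolding of_real_sum by (intro sum.cong refl g)
  also have "\<dots> = of_nat L * b 0"
    using K separated[of _ 0] by (intro sum_roots_unity_laurent L) (auto simp: S_def N_def)
  finally have mean: "(\<Sum>z | z ^ L = 1. g z) = real L * (real N * Re (a 0))"
    by (simp add: b_def complex_eq_iff)
  have "real L * (real K * (\<Sum>n<K. \<Sum>m<K. (cmod (a (int n - int m)))\<^sup>2)) \<le> real L * (\<Sum>k\<in>S. (cmod (b k))\<^sup>2)"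
    using sum_square_Toeplitz_le_Fejer[of K a] by (intro mult_left_mono) (auto simp: S_def N_def b_def)
  also have "\<dots> = (\<Sum>z | z ^ L = 1. (cmod (\<Sum>k\<in>S. b k * z powi k))\<^sup>2)"
    using separated by (intro Parseval_roots_unity[symmetric] L) (auto simp: S_def)
  also have "\<dots> = (\<Sum>z | z ^ L = 1. g z * g z)"
    by (intro sum.cong refl) (simp add: power2_eq_square flip: g)
  also have "\<dots> \<le> (\<Sum>z | z ^ L = 1. C * g z)"
    using unit by (intro sum_mono mult_right_mono bound nonneg) auto
  also have "\<dots> = real L * (real K * (2 * C * Re (a 0)))"
    unfolding sum_distrib_left[symmetric] mean by (simp add: N_def)
  finally show ?thesis
    using L K by simp
qed

subsection \<open>Small correlations\<close>

definition autocorrelation :: "'a measure \<Rightarrow> ('a \<Rightarrow> 'a) \<Rightarrow> ('a \<Rightarrow> complex) \<Rightarrow> int \<Rightarrow> complex" where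
  "autocorrelation M T f k = L2inner M (\<lambda>x. f ((T ^^ nat k) x)) (\<lambda>x. f ((T ^^ nat (- k)) x))"

lemma L2inner_funpow_eq_autocorrelation:
  assumes T: "mp_map M T" and f: "L2fun M f"
  shows "L2inner M (\<lambda>x. f ((T ^^ n) x)) (\<lambda>x. f ((T ^^ m) x)) = autocorrelation M T f (int n - int m)"
proof -
  have shift: "L2inner M (\<lambda>x. f ((T ^^ (i + k)) x)) (\<lambda>x. f ((T ^^ (j + k)) x))
      = L2inner M (\<lambda>x. f ((T ^^ i) x)) (\<lambda>x. f ((T ^^ j) x))" for i j k
    using L2inner_mp_map[OF mp_map_funpow[OF T, of k] L2fun_funpow[OF T f, of i] L2fun_funpow[OF T f, of j]]
    by (simp add: funpow_add)
  show ?thesis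
  proof (cases "m \<le> n")
    case True
    then show ?thesis
      using shift[of "n - m" m 0] by (simp add: autocorrelation_def nat_diff_distrib')
  next
    case False
    then show ?thesis
      using shift[of 0 n "m - n"] by (simp add: autocorrelation_def nat_diff_distrib')
  qed
qed

lemma mean_square_autocorrelation_small:
  assumes T: "mp_map M T" and f: "eigen_orthogonal M T f" and e: "e > 0"
  obtains K where "K \<ge> 1"
    "(\<Sum>n<K. \<Sum>m<K. (cmod (autocorrelation M T f (int n - int m)))\<^sup>2) \<le> (e * real K)\<^sup>2"
proof -
  note fL2 = eigen_orthogonal_L2fun[OF f]
  obtain \<delta> where \<delta>: "\<delta> > 0" "\<delta> * (L2norm M f + 1) = e / 3"
    using obtain_scaled_epsilon[of "L2norm M f" "e / 3"] e by auto
  obtain K where K: "K \<ge> 1"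
    and small: "\<And>k l. cmod l = 1 \<Longrightarrow> L2norm M (twisted_sum T l f (k * K)) \<le> \<delta> * real (k * K)"
    using twisted_sum_uniformly_small[OF T f \<delta>(1)] by blast
  have "(\<Sum>n<K. \<Sum>m<K. (cmod (autocorrelation M T f (int n - int m)))\<^sup>2)
      \<le> 2 * (\<delta> * real (2 * K))\<^sup>2 * Re (autocorrelation M T f 0)"
  proof (rule sum_square_Toeplitz_le)
    show "K > 0"
      using K by simp
    fix z :: complex assume z: "cmod z = 1"
    then have "z ^ i * cnj (z ^ j) = z powi (int i - int j)" for i j
      using powi_mult_cnj_powi[of z "int i" "int j"] by simp
    then show "complex_of_real ((L2norm M (twisted_sum T z f (2 * K)))\<^sup>2)
        = (\<Sum>n<2 * K. \<Sum>m<2 * K. z powi (int n - int m) * autocorrelation M T f (int n - int m))"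
      by (simp only: L2norm_twisted_sum_square[OF T fL2] L2inner_funpow_eq_autocorrelation[OF T fL2])
    show "(L2norm M (twisted_sum T z f (2 * K)))\<^sup>2 \<le> (\<delta> * real (2 * K))\<^sup>2"
      by (intro power_mono small z) simp
  qed simp
  also have "\<dots> = 8 * (\<delta> * real K * L2norm M f)\<^sup>2"
    by (simp add: autocorrelation_def L2inner_self power_mult_distrib flip: of_real_power)
  also have "\<dots> \<le> 9 * (\<delta> * real K * (L2norm M f + 1))\<^sup>2"
    using \<delta>(1) by (intro mult_mono power_mono mult_left_mono) auto
  also have "\<delta> * real K * (L2norm M f + 1) = e / 3 * real K"
    unfolding \<delta>(2)[symmetric] by simp
  finally show thesis
    using that[OF K] by (simp add: power_mult_distrib power_divide)
qed

lemma L2norm_square_lincomb_le: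
  assumes F: "\<And>i. i \<in> I \<Longrightarrow> L2fun M (F i)"
  shows "(L2norm M (\<lambda>x. \<Sum>i\<in>I. c i * F i x))\<^sup>2
    \<le> (\<Sum>i\<in>I. (cmod (c i))\<^sup>2) * sqrt (\<Sum>i\<in>I. \<Sum>j\<in>I. (cmod (L2inner M (F i) (F j)))\<^sup>2)"
proof -
  define s where "s = (\<Sum>i\<in>I. (cmod (c i))\<^sup>2)"
  define Q where "Q = (\<Sum>i\<in>I. \<Sum>j\<in>I. (cmod (L2inner M (F i) (F j)))\<^sup>2)"
  have "(L2norm M (\<lambda>x. \<Sum>i\<in>I. c i * F i x))\<^sup>2 = cmod (complex_of_real ((L2norm M (\<lambda>x. \<Sum>i\<in>I. c i * F i x))\<^sup>2))"
    by (simp del: of_real_power)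
  also have "\<dots> = cmod (\<Sum>i\<in>I. \<Sum>j\<in>I. c i * cnj (c j) * L2inner M (F i) (F j))"
    by (simp only: L2norm_square_sum F)
  also have "\<dots> \<le> (\<Sum>i\<in>I. \<Sum>j\<in>I. cmod (c i * cnj (c j) * L2inner M (F i) (F j)))"
    by (intro order_trans[OF norm_sum] sum_mono norm_sum)
  also have "\<dots> = (\<Sum>(i, j)\<in>I \<times> I. (cmod (c i) * cmod (c j)) * cmod (L2inner M (F i) (F j)))"
    by (simp add: sum.cartesian_product norm_mult)
  also have "\<dots> \<le> sqrt (s\<^sup>2 * Q)"
  proof (rule real_le_rsqrt)
    have "(\<Sum>(i, j)\<in>I \<times> I. (cmod (c i) * cmod (c j)) * cmod (L2inner M (F i) (F j)))\<^sup>2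
       \<le> (\<Sum>(i, j)\<in>I \<times> I. (cmod (c i) * cmod (c j))\<^sup>2) * (\<Sum>(i, j)\<in>I \<times> I. (cmod (L2inner M (F i) (F j)))\<^sup>2)"
      unfolding case_prod_unfold by (rule Cauchy_Schwarz_ineq_sum)
    also have "(\<Sum>(i, j)\<in>I \<times> I. (cmod (c i) * cmod (c j))\<^sup>2) = s\<^sup>2"
      unfolding s_def power2_eq_square[of "sum _ _"] sum_product sum.cartesian_product
      by (simp add: power_mult_distrib)
    finally show "(\<Sum>(i, j)\<in>I \<times> I. (cmod (c i) * cmod (c j)) * cmod (L2inner M (F i) (F j)))\<^sup>2 \<le> s\<^sup>2 * Q"
      by (simp add: Q_def sum.cartesian_product)
  qed
  also have "\<dots> = s * sqrt Q"
    by (simp add: s_def real_sqrt_mult sum_nonneg)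
  finally show ?thesis
    by (simp only: s_def Q_def)
qed

lemma sum_square_L2inner_le:
  assumes F: "\<And>i. i \<in> I \<Longrightarrow> L2fun M (F i)" and h: "L2fun M h"
  shows "(\<Sum>i\<in>I. (cmod (L2inner M (F i) h))\<^sup>2)
    \<le> (L2norm M h)\<^sup>2 * sqrt (\<Sum>i\<in>I. \<Sum>j\<in>I. (cmod (L2inner M (F i) (F j)))\<^sup>2)"
proof -
  define c where "c i = L2inner M (F i) h" for i
  define s where "s = (\<Sum>i\<in>I. (cmod (c i))\<^sup>2)"
  define q where "q = sqrt (\<Sum>i\<in>I. \<Sum>j\<in>I. (cmod (L2inner M (F i) (F j)))\<^sup>2)"
  let ?v = "\<lambda>x. \<Sum>i\<in>I. cnj (c i) * F i x"
  have v: "L2fun M ?v"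
    by (intro L2fun_sum L2fun_cmult F)
  have s: "s \<ge> 0" and q: "q \<ge> 0"
    unfolding s_def q_def by (intro real_sqrt_ge_zero sum_nonneg zero_le_power2)+
  have "L2inner M ?v h = (\<Sum>i\<in>I. cnj (c i) * c i)"
    using F h by (simp add: L2inner_sum_left L2fun_cmult L2inner_cmult_left c_def)
  also have "\<dots> = of_real s"
    unfolding s_def of_real_sum complex_norm_square by (simp add: mult.commute)
  finally have "s \<le> L2norm M ?v * L2norm M h"
    using L2_Cauchy_Schwarz[OF v h] s by simp
  then have "s\<^sup>2 \<le> (L2norm M ?v)\<^sup>2 * (L2norm M h)\<^sup>2"
    using s unfolding power_mult_distrib[symmetric] by (rule power_mono)
  also have "\<dots> \<le> (s * q) * (L2norm M h)\<^sup>2"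
    using L2norm_square_lincomb_le[of I M F "\<lambda>i. cnj (c i)", OF F]
    by (intro mult_right_mono) (auto simp: s_def q_def)
  finally have "s * s \<le> s * ((L2norm M h)\<^sup>2 * q)"
    by (simp add: power2_eq_square mult_ac)
  then have "s \<le> (L2norm M h)\<^sup>2 * q"
    using s q by (cases "s = 0") (auto simp: mult_le_cancel_left)
  then show ?thesis
    by (simp add: s_def q_def c_def)
qed

theorem eigen_orthogonal_small_correlations:
  assumes T: "mp_map M T" and f: "eigen_orthogonal M T f" and e: "e > 0"
    and I: "finite I" and h: "\<And>i. i \<in> I \<Longrightarrow> L2fun M (h i)"
  shows "\<exists>n. \<forall>i\<in>I. cmod (L2inner M (\<lambda>x. f ((T ^^ n) x)) (h i)) < e"
proof -
  note fL2 = eigen_orthogonal_L2fun[OF f]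
  define F where "F n x = f ((T ^^ n) x)" for n x
  have F: "L2fun M (F n)" for n
    unfolding F_def[abs_def] by (intro L2fun_funpow T fL2)
  define H where "H = (\<Sum>i\<in>I. (L2norm M (h i))\<^sup>2)"
  have "H \<ge> 0"
    unfolding H_def by (intro sum_nonneg) auto
  then obtain \<delta> where \<delta>: "\<delta> > 0" "\<delta> * (H + 1) = e\<^sup>2"
    using obtain_scaled_epsilon[of H "e\<^sup>2"] e by auto
  obtain K where K: "K \<ge> 1"
    and mean: "(\<Sum>n<K. \<Sum>m<K. (cmod (L2inner M (F n) (F m)))\<^sup>2) \<le> (\<delta> * real K)\<^sup>2"
    unfolding F_def L2inner_funpow_eq_autocorrelation[OF T fL2]
    using mean_square_autocorrelation_small[OF T f \<delta>(1)] by blast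
  have "(\<Sum>n<K. \<Sum>i\<in>I. (cmod (L2inner M (F n) (h i)))\<^sup>2) = (\<Sum>i\<in>I. \<Sum>n<K. (cmod (L2inner M (F n) (h i)))\<^sup>2)"
    by (rule sum.swap)
  also have "\<dots> \<le> (\<Sum>i\<in>I. (L2norm M (h i))\<^sup>2 * (\<delta> * real K))"
    using \<delta>(1)
    by (intro sum_mono order_trans[OF sum_square_L2inner_le[OF F h]] mult_left_mono real_le_lsqrt mean) auto
  also have "\<dots> = real K * (\<delta> * H)"
    by (simp add: H_def sum_distrib_left mult_ac)
  also have "\<dots> < real K * e\<^sup>2"
    unfolding \<delta>(2)[symmetric] using \<delta>(1) K by simp
  finally have "(\<Sum>n<K. \<Sum>i\<in>I. (cmod (L2inner M (F n) (h i)))\<^sup>2) < (\<Sum>n<K. e\<^sup>2)"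
    by simp
  then obtain n where n: "(\<Sum>i\<in>I. (cmod (L2inner M (F n) (h i)))\<^sup>2) < e\<^sup>2"
    by (metis (no_types, lifting) linorder_not_le sum_mono)
  have "cmod (L2inner M (F n) (h i)) < e" if "i \<in> I" for i
  proof (rule power2_less_imp_less)
    have "(cmod (L2inner M (F n) (h i)))\<^sup>2 \<le> (\<Sum>i\<in>I. (cmod (L2inner M (F n) (h i)))\<^sup>2)"
      using I that by (intro member_le_sum) auto
    then show "(cmod (L2inner M (F n) (h i)))\<^sup>2 < e\<^sup>2"
      using n by simp
  qed (use e in simp)
  then show ?thesis
    unfolding F_def by blast
qed

section \<open>Self-couplings\<close>

lemma C2D:
  assumes "\<rho> \<in> C2 M"
  shows "sets \<rho> = sets (M \<Otimes>\<^sub>M M)" "prob_space \<rho>" "space \<rho> = space M \<times> space M"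
    "\<And>A. A \<in> sets M \<Longrightarrow> measure \<rho> (A \<times> space M) = measure M A"
    "\<And>B. B \<in> sets M \<Longrightarrow> measure \<rho> (space M \<times> B) = measure M B"
  using assms sets_eq_imp_space_eq[of \<rho> "M \<Otimes>\<^sub>M M"] by (auto simp: C2_def measure_def space_pair_measure)

lemma (in prob_space) C2I:
  assumes sets: "sets \<rho> = sets (M \<Otimes>\<^sub>M M)"
    and marginals: "\<And>A. A \<in> sets M \<Longrightarrow> emeasure \<rho> (A \<times> space M) = emeasure M A"
      "\<And>B. B \<in> sets M \<Longrightarrow> emeasure \<rho> (space M \<times> B) = emeasure M B"
  shows "\<rho> \<in> C2 M"
proof -
  have "space \<rho> = space M \<times> space M"
    using sets_eq_imp_space_eq[OF sets] by (simp add: space_pair_measure)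
  then have "prob_space \<rho>"
    using marginals(1)[OF sets.top] by (intro prob_spaceI) (simp add: emeasure_space_1)
  with assms show ?thesis
    by (simp add: C2_def)
qed

lemma C2_Times_in_sets: "\<rho> \<in> C2 M \<Longrightarrow> A \<in> sets M \<Longrightarrow> B \<in> sets M \<Longrightarrow> A \<times> B \<in> sets \<rho>"
  by (simp add: C2D(1))

lemma C2_eqI:
  assumes \<rho>: "\<rho> \<in> C2 M" and \<sigma>: "\<sigma> \<in> C2 M"
    and eq: "\<And>A B. A \<in> sets M \<Longrightarrow> B \<in> sets M \<Longrightarrow> measure \<rho> (A \<times> B) = measure \<sigma> (A \<times> B)"
  shows "\<rho> = \<sigma>"
proof (rule measure_eqI_generator_eq)
  interpret \<rho>: prob_space \<rho> by (rule C2D(2)[OF \<rho>])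
  interpret \<sigma>: prob_space \<sigma> by (rule C2D(2)[OF \<sigma>])
  let ?R = "{A \<times> B | A B. A \<in> sets M \<and> B \<in> sets M}"
  show "Int_stable ?R"
    by (rule Int_stable_pair_measure_generator)
  show "?R \<subseteq> Pow (space M \<times> space M)"
    by (rule pair_measure_closed)
  show "sets \<rho> = sigma_sets (space M \<times> space M) ?R" "sets \<sigma> = sigma_sets (space M \<times> space M) ?R"
    using C2D(1)[OF \<rho>] C2D(1)[OF \<sigma>] by (simp_all add: sets_pair_measure)
  show "emeasure \<rho> X = emeasure \<sigma> X" if "X \<in> ?R" for X
    using that eq by (auto simp: \<rho>.emeasure_eq_measure \<sigma>.emeasure_eq_measure)
  show "range (\<lambda>_. space M \<times> space M) \<subseteq> ?R" "(\<Union>i::nat. space M \<times> space M) = space M \<times> space M"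
    by auto
  show "emeasure \<rho> (space M \<times> space M) \<noteq> \<infinity>"
    by (simp add: \<rho>.emeasure_eq_measure)
qed

lemma (in prob_space) measure_pair_Times:
  "A \<in> sets M \<Longrightarrow> B \<in> sets M \<Longrightarrow> measure (M \<Otimes>\<^sub>M M) (A \<times> B) = measure M A * measure M B"
  by (simp add: measure_def emeasure_pair_measure_Times enn2real_mult)

lemma (in prob_space) pair_measure_in_C2: "M \<Otimes>\<^sub>M M \<in> C2 M"
  by (intro C2I) (simp_all add: emeasure_pair_measure_Times emeasure_space_1)

lemma C2_measure_Times_le:
  assumes \<rho>: "\<rho> \<in> C2 M" and sets: "A \<in> sets M" "B \<in> sets M" "C \<in> sets M" "D \<in> sets M"
  shows "measure \<rho> (A \<times> B) \<le> measure \<rho> (C \<times> D) + (measure M (A - C) + measure M (B - D))"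
proof -
  interpret \<rho>: prob_space \<rho> by (rule C2D(2)[OF \<rho>])
  let ?X = "(A - C) \<times> space M" and ?Y = "space M \<times> (B - D)"
  have in_sets: "C \<times> D \<in> sets \<rho>" "?X \<in> sets \<rho>" "?Y \<in> sets \<rho>"
    using sets by (auto intro!: C2_Times_in_sets[OF \<rho>])
  have "measure \<rho> (A \<times> B) \<le> measure \<rho> (C \<times> D \<union> (?X \<union> ?Y))"
    using in_sets sets sets.sets_into_space[of A M] sets.sets_into_space[of B M]
    by (intro \<rho>.finite_measure_mono) auto
  also have "\<dots> \<le> measure \<rho> (C \<times> D) + (measure \<rho> ?X + measure \<rho> ?Y)"
    using in_sets by (intro order_trans[OF measure_Un_le] add_left_mono measure_Un_le) auto
  finally show ?thesis
    using sets by (simp add: C2D(4,5)[OF \<rho>])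
qed

lemma (in prob_space) C2_measure_Times_diff_le:
  assumes \<rho>: "\<rho> \<in> C2 M" and sets: "A \<in> sets M" "B \<in> sets M" "C \<in> sets M" "D \<in> sets M"
  shows "\<bar>measure \<rho> (A \<times> B) - measure \<rho> (C \<times> D)\<bar> \<le> measure M (sym_diff A C) + measure M (sym_diff B D)"
proof -
  have "measure M (A - C) \<le> measure M (sym_diff A C)" "measure M (C - A) \<le> measure M (sym_diff A C)"
    "measure M (B - D) \<le> measure M (sym_diff B D)" "measure M (D - B) \<le> measure M (sym_diff B D)"
    using sets by (auto intro!: finite_measure_mono)
  then show ?thesis
    using C2_measure_Times_le[OF \<rho> sets] C2_measure_Times_le[OF \<rho> sets(3,4,1,2)] by linarith
qed

subsection \<open>Topology\<close>

lemma topspace_C2_topology [simp]: "topspace (C2_topology M) = C2 M"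
  unfolding C2_topology_def topology_generated_by_topspace
proof (intro equalityI subsetI)
  fix \<rho> assume "\<rho> \<in> C2 M"
  then have "\<rho> \<in> {\<rho> \<in> C2 M. measure \<rho> ({} \<times> {}) \<in> UNIV}"
    by simp
  then show "\<rho> \<in> \<Union> {{\<rho> \<in> C2 M. measure \<rho> (A \<times> B) \<in> U} |A B U. A \<in> sets M \<and> B \<in> sets M \<and> open U}"
    by (intro UnionI[rotated], assumption) (use open_UNIV in blast)
qed blast

lemma continuous_map_C2_measure_Times:
  assumes "A \<in> sets M" "B \<in> sets M"
  shows "continuous_map (C2_topology M) euclideanreal (\<lambda>\<rho>. measure \<rho> (A \<times> B))"
  unfolding continuous_map_def
proof (intro conjI allI impI)
  fix U :: "real set" assume "openin euclideanreal U"
  then show "openin (C2_topology M) {\<rho> \<in> topspace (C2_topology M). measure \<rho> (A \<times> B) \<in> U}"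
    using assms unfolding topspace_C2_topology unfolding C2_topology_def
    by (intro topology_generated_by_Basis) auto
qed simp

lemma continuous_map_into_C2_topology:
  assumes C2: "\<And>x. x \<in> topspace X \<Longrightarrow> g x \<in> C2 M"
    and rectangles: "\<And>A B. A \<in> sets M \<Longrightarrow> B \<in> sets M \<Longrightarrow>
      continuous_map X euclideanreal (\<lambda>x. measure (g x) (A \<times> B))"
  shows "continuous_map X (C2_topology M) g"
  unfolding C2_topology_def
proof (rule continuous_on_generated_topo)
  fix V assume "V \<in> {{\<rho>\<in>C2 M. measure \<rho> (A \<times> B) \<in> U} | A B U. A \<in> sets M \<and> B \<in> sets M \<and> open U}"
  then obtain A B U where V: "V = {\<rho>\<in>C2 M. measure \<rho> (A \<times> B) \<in> U}" "A \<in> sets M" "B \<in> sets M" "open U"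
    by blast
  have "g -` V \<inter> topspace X = {x \<in> topspace X. measure (g x) (A \<times> B) \<in> U}"
    using C2 by (auto simp: V(1))
  then show "openin X (g -` V \<inter> topspace X)"
    using rectangles[OF V(2,3)] V(4) by (simp add: continuous_map_def)
next
  show "g ` topspace X \<subseteq> \<Union> {{\<rho>\<in>C2 M. measure \<rho> (A \<times> B) \<in> U} | A B U. A \<in> sets M \<and> B \<in> sets M \<and> open U}"
    using topspace_C2_topology[of M] C2 by (auto simp: C2_topology_def)
qed

lemma C2_topology_neighbourhood:
  assumes "openin (C2_topology M) V" "\<sigma> \<in> V"
  obtains P e where "finite P" "P \<subseteq> sets M \<times> sets M" "e > 0"
    "\<And>\<rho>. \<rho> \<in> C2 M \<Longrightarrow> (\<And>A B. (A, B) \<in> P \<Longrightarrow> \<bar>measure \<rho> (A \<times> B) - measure \<sigma> (A \<times> B)\<bar> < e) \<Longrightarrow> \<rho> \<in> V"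
proof -
  let ?close = "\<lambda>P e \<rho>. \<forall>(A, B)\<in>P. \<bar>measure \<rho> (A \<times> B) - measure \<sigma> (A \<times> B)\<bar> < e"
  let ?nhd = "\<lambda>V. \<exists>P e. finite P \<and> P \<subseteq> sets M \<times> sets M \<and> e > 0 \<and> (\<forall>\<rho>\<in>C2 M. ?close P e \<rho> \<longrightarrow> \<rho> \<in> V)"
  have "generate_topology_on {{\<rho>\<in>C2 M. measure \<rho> (A \<times> B) \<in> U} | A B U. A \<in> sets M \<and> B \<in> sets M \<and> open U} V"
    using assms(1) by (simp add: C2_topology_def openin_topology_generated_by_iff)
  then have "\<sigma> \<in> V \<longrightarrow> ?nhd V"
  proof (induction rule: generate_topology_on.induct)
    case (Int a b)
    show ?case
    proof
      assume "\<sigma> \<in> a \<inter> b"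
      then obtain P e Q d
        where P: "finite P" "P \<subseteq> sets M \<times> sets M" "e > 0" "\<forall>\<rho>\<in>C2 M. ?close P e \<rho> \<longrightarrow> \<rho> \<in> a"
          and Q: "finite Q" "Q \<subseteq> sets M \<times> sets M" "d > 0" "\<forall>\<rho>\<in>C2 M. ?close Q d \<rho> \<longrightarrow> \<rho> \<in> b"
        using Int by auto
      have "?close P e \<rho>" "?close Q d \<rho>" if "?close (P \<union> Q) (min e d) \<rho>" for \<rho>
        using that by (auto simp: case_prod_unfold)
      then show "?nhd (a \<inter> b)"
        using P Q by (intro exI[of _ "P \<union> Q"] exI[of _ "min e d"]) auto
    qed
  next
    case (UN K)
    then show ?case
      by (meson Union_iff)
  next
    case (Basis s)
    then obtain A B U where s: "A \<in> sets M" "B \<in> sets M" "open U" "s = {\<rho>\<in>C2 M. measure \<rho> (A \<times> B) \<in> U}"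
      by blast
    show ?case
    proof
      assume "\<sigma> \<in> s"
      with s obtain e where "e > 0" "\<forall>y. dist y (measure \<sigma> (A \<times> B)) < e \<longrightarrow> y \<in> U"
        by (auto simp: open_dist)
      with s show "?nhd s"
        by (intro exI[of _ "{(A, B)}"] exI[of _ e]) (auto simp: dist_real_def)
    qed
  qed simp
  with assms(2) that show thesis
    by (auto simp: case_prod_unfold)
qed

subsection \<open>Lifts of measure-preserving maps\<close>

lemma lift_map_measurable:
  assumes "\<rho> \<in> C2 M" and [measurable]: "R \<in> measurable M M"
  shows "(\<lambda>(x, y). (R x, R y)) \<in> measurable \<rho> (M \<Otimes>\<^sub>M M)"
  by (subst measurable_cong_sets[OF C2D(1)[OF assms(1)] refl]) measurable

lemma emeasure_lift_map:
  assumes "\<rho> \<in> C2 M" "R \<in> measurable M M" "A \<in> sets M" "B \<in> sets M"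
  shows "emeasure (lift_map M R \<rho>) (A \<times> B) = emeasure \<rho> ((R -` A \<inter> space M) \<times> (R -` B \<inter> space M))"
  unfolding lift_map_def using assms
  by (subst emeasure_distr[OF lift_map_measurable])
    (auto simp: C2D(3) intro!: arg_cong[where f = "emeasure \<rho>"])

lemma measure_lift_map:
  assumes "\<rho> \<in> C2 M" "R \<in> measurable M M" "A \<in> sets M" "B \<in> sets M"
  shows "measure (lift_map M R \<rho>) (A \<times> B) = measure \<rho> ((R -` A \<inter> space M) \<times> (R -` B \<inter> space M))"
  using emeasure_lift_map[OF assms] by (simp add: measure_def)

lemma (in prob_space) lift_map_in_C2:
  assumes \<rho>: "\<rho> \<in> C2 M" and R: "mp_map M R"
  shows "lift_map M R \<rho> \<in> C2 M"
proof (rule C2I)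
  note [measurable] = R
  have Rspace: "R -` space M \<inter> space M = space M"
    using measurable_space[OF mp_map_measurable[OF R]] by auto
  show "emeasure (lift_map M R \<rho>) (A \<times> space M) = emeasure M A"
    "emeasure (lift_map M R \<rho>) (space M \<times> A) = emeasure M A" if "A \<in> sets M" for A
    using \<rho> that measurable_sets[OF mp_map_measurable[OF R] that]
    by (simp_all add: emeasure_lift_map[OF \<rho> mp_map_measurable[OF R]] Rspace emeasure_mp_map[OF R] C2_def)
qed (simp add: lift_map_def)

lemma lift_map_lift_map:
  assumes "\<rho> \<in> C2 M" and [measurable]: "R \<in> measurable M M" "R' \<in> measurable M M"
  shows "lift_map M R (lift_map M R' \<rho>) = lift_map M (\<lambda>x. R (R' x)) \<rho>"
  unfolding lift_map_def
  by (subst distr_distr[OF _ lift_map_measurable[OF assms(1)]]) (auto simp: comp_def case_prod_unfold)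

lemma lift_map_ident:
  assumes \<rho>: "\<rho> \<in> C2 M" and R: "\<And>x. x \<in> space M \<Longrightarrow> R x = x"
  shows "lift_map M R \<rho> = \<rho>"
proof -
  have "lift_map M R \<rho> = distr \<rho> (M \<Otimes>\<^sub>M M) (\<lambda>z. z)"
    unfolding lift_map_def by (rule distr_cong) (auto simp: C2D(3)[OF \<rho>] R)
  also have "\<dots> = \<rho>"
    by (rule distr_id2) (simp add: C2D(1)[OF \<rho>])
  finally show ?thesis .
qed

lemma (in prob_space) lift_map_pair_measure:
  assumes R: "mp_map M R"
  shows "lift_map M R (M \<Otimes>\<^sub>M M) = M \<Otimes>\<^sub>M M"
proof (rule C2_eqI[OF lift_map_in_C2[OF pair_measure_in_C2 R] pair_measure_in_C2])
  note R_meas = mp_map_measurable[OF R]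
  have "measure M (R -` A \<inter> space M) = measure M A" if "A \<in> sets M" for A
    using emeasure_mp_map[OF R that] by (simp add: measure_def)
  then show "measure (lift_map M R (M \<Otimes>\<^sub>M M)) (A \<times> B) = measure (M \<Otimes>\<^sub>M M) (A \<times> B)"
    if "A \<in> sets M" "B \<in> sets M" for A B
    using that measurable_sets[OF R_meas]
    by (simp add: measure_lift_map[OF pair_measure_in_C2 R_meas] measure_pair_Times)
qed

lemma (in prob_space) lift_map_funpow:
  assumes R: "mp_map M R" and \<rho>: "\<rho> \<in> C2 M"
  shows "(lift_map M R ^^ n) \<rho> = lift_map M (R ^^ n) \<rho>"
proof (induction n)
  case 0
  then show ?case
    by (simp add: lift_map_ident[OF \<rho>])
next
  case (Suc n)
  then show ?case
    using lift_map_lift_map[OF \<rho> mp_map_measurable[OF R] mp_map_measurable[OF mp_map_funpow[OF R, of n]]]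
    by (simp add: comp_def)
qed

locale mp_automorphism = prob_space M for M :: "'a measure" +
  fixes T :: "'a \<Rightarrow> 'a"
  assumes aut: "mp_aut M T"
begin

definition Tinv :: "'a \<Rightarrow> 'a" where
  "Tinv = inv_into (space M) T"

definition Tpow :: "int \<Rightarrow> 'a \<Rightarrow> 'a" where
  "Tpow n = (if 0 \<le> n then T ^^ nat n else Tinv ^^ nat (- n))"

lemma T_Tinv: "x \<in> space M \<Longrightarrow> T (Tinv x) = x"
  using aut by (auto simp: mp_aut_def Tinv_def bij_betw_def intro: f_inv_into_f)

lemma Tinv_T: "x \<in> space M \<Longrightarrow> Tinv (T x) = x"
  using aut by (auto simp: mp_aut_def Tinv_def bij_betw_def)

lemma mp_T: "mp_map M T"
  using aut by (simp add: mp_aut_def mp_map_def)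

lemma mp_Tinv: "mp_map M Tinv"
proof -
  have Tinv: "Tinv \<in> measurable M M"
    using aut by (simp add: mp_aut_def Tinv_def)
  have "distr M M Tinv = distr (distr M M T) M Tinv"
    using mp_T by (simp add: mp_map_def)
  also have "\<dots> = distr M M (Tinv \<circ> T)"
    by (rule distr_distr[OF Tinv mp_map_measurable[OF mp_T]])
  also have "\<dots> = distr M M (\<lambda>x. x)"
    by (rule distr_cong) (simp_all add: Tinv_T)
  finally show ?thesis
    using Tinv by (simp add: mp_map_def distr_id2)
qed

lemma mp_Tpow: "mp_map M (Tpow n)"
  by (simp add: Tpow_def mp_map_funpow mp_T mp_Tinv)

lemma funpow_Tinv_funpow_T: "x \<in> space M \<Longrightarrow> (Tinv ^^ n) ((T ^^ n) x) = x"
proof (induction n arbitrary: x)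
  case (Suc n)
  have "(T ^^ n) x \<in> space M"
    using Suc.prems measurable_space[OF mp_map_measurable[OF mp_map_funpow[OF mp_T]]] by blast
  then show ?case
    using Suc by (simp add: funpow_swap1[of Tinv] Tinv_T)
qed simp

lemma vimage_Tpow_in_sets: "A \<in> sets M \<Longrightarrow> Tpow n -` A \<inter> space M \<in> sets M"
  using measurable_sets[OF mp_map_measurable[OF mp_Tpow]] .

lemma inv_into_lift_map:
  assumes \<rho>: "\<rho> \<in> C2 M"
  shows "inv_into (C2 M) (lift_map M T) \<rho> = lift_map M Tinv \<rho>"
proof (rule inv_into_f_eq)
  note T = mp_map_measurable[OF mp_T] and Tinv = mp_map_measurable[OF mp_Tinv]
  show "inj_on (lift_map M T) (C2 M)"
    by (rule inj_on_inverseI[of _ "lift_map M Tinv"])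
      (simp add: lift_map_lift_map[OF _ Tinv T] lift_map_ident Tinv_T)
  show "lift_map M Tinv \<rho> \<in> C2 M"
    by (rule lift_map_in_C2[OF \<rho> mp_Tinv])
  show "lift_map M T (lift_map M Tinv \<rho>) = \<rho>"
    by (simp add: lift_map_lift_map[OF \<rho> T Tinv] lift_map_ident[OF \<rho>] T_Tinv)
qed

lemma zpow_lift_map:
  assumes \<rho>: "\<rho> \<in> C2 M"
  shows "zpow (C2_topology M) (lift_map M T) n \<rho> = lift_map M (Tpow n) \<rho>"
proof -
  have "(inv_into (C2 M) (lift_map M T) ^^ k) \<rho> = (lift_map M Tinv ^^ k) \<rho>
      \<and> (lift_map M Tinv ^^ k) \<rho> \<in> C2 M" for k
    by (induction k) (use \<rho> in \<open>auto simp: inv_into_lift_map lift_map_in_C2[OF _ mp_Tinv]\<close>)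
  then show ?thesis
    by (simp add: zpow_def Tpow_def lift_map_funpow[OF mp_T \<rho>] lift_map_funpow[OF mp_Tinv \<rho>])
qed

lemma zpow_lift_map_in_C2: "\<rho> \<in> C2 M \<Longrightarrow> zpow (C2_topology M) (lift_map M T) n \<rho> \<in> C2 M"
  by (simp add: zpow_lift_map lift_map_in_C2 mp_Tpow)

lemma measure_zpow_lift_map:
  assumes "\<rho> \<in> C2 M" "A \<in> sets M" "B \<in> sets M"
  shows "measure (zpow (C2_topology M) (lift_map M T) n \<rho>) (A \<times> B)
    = measure \<rho> ((Tpow n -` A \<inter> space M) \<times> (Tpow n -` B \<inter> space M))"
  using assms by (simp add: zpow_lift_map measure_lift_map[OF _ mp_map_measurable[OF mp_Tpow]])

end

subsection \<open>Compactness\<close>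

lemma inner_regular_approx:
  fixes N :: "'b::polish_space measure"
  assumes N: "finite_measure N" and borel: "sets N = sets borel" and A: "A \<in> sets N" and e: "e > 0"
  obtains K where "K \<subseteq> A" "compact K" "K \<in> sets N" "measure N (A - K) < e"
proof -
  interpret finite_measure N by (rule N)
  have fin: "emeasure N B \<noteq> \<infinity>" for B
    by simp
  have "\<exists>K\<in>{K. K \<subseteq> A \<and> compact K}. emeasure N A < emeasure N K + ennreal e"
    using A e by (intro SUP_approx_ennreal[OF _ _ inner_regular[OF borel fin] fin]) (auto simp: borel)
  then obtain K where K: "K \<subseteq> A" "compact K" "emeasure N A < emeasure N K + ennreal e"
    by blast
  have K_sets: "K \<in> sets N"
    using K(2) by (simp add: borel borel_compact)
  have "measure N A < measure N K + e"
    using K(3) e by (simp add: emeasure_eq_measure ennreal_less_iff flip: ennreal_plus)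
  then show thesis
    using that[OF K(1,2) K_sets] A K(1) K_sets by (simp add: finite_measure_Diff)
qed

lemma outer_regular_approx:
  fixes N :: "'b::polish_space measure"
  assumes N: "finite_measure N" and borel: "sets N = sets borel" and A: "A \<in> sets N" and e: "e > 0"
  obtains U where "A \<subseteq> U" "open U" "U \<in> sets N" "measure N (U - A) < e"
proof -
  interpret finite_measure N by (rule N)
  have fin: "emeasure N B \<noteq> \<infinity>" for B
    by simp
  have "\<exists>U\<in>{U. A \<subseteq> U \<and> open U}. emeasure N U < emeasure N A + ennreal e"
    using A e by (intro INF_approx_ennreal[OF _ outer_regular[OF borel fin] fin]) (auto simp: borel)
  then obtain U where U: "A \<subseteq> U" "open U" "emeasure N U < emeasure N A + ennreal e"
    by blast
  have U_sets: "U \<in> sets N"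
    using U(2) by (simp add: borel)
  have "measure N U < measure N A + e"
    using U(3) e by (simp add: emeasure_eq_measure ennreal_less_iff flip: ennreal_plus)
  then show thesis
    using that[OF U(1,2) U_sets] A U(1) U_sets by (simp add: finite_measure_Diff)
qed

lemma semiring_of_rectangles:
  "semiring_of_sets (space M \<times> space M) {A \<times> B | A B. A \<in> sets M \<and> B \<in> sets M}"
proof
  let ?R = "{A \<times> B | A B. A \<in> sets M \<and> B \<in> sets M}"
  have rectangle: "A \<times> B \<in> ?R" if "A \<in> sets M" "B \<in> sets M" for A B
    using that by blast
  show "?R \<subseteq> Pow (space M \<times> space M)"
    by (rule pair_measure_closed)
  show "{} \<in> ?R"
    using rectangle[of "{}" "{}"] by simp
  fix X Y assume "X \<in> ?R" "Y \<in> ?R"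
  then obtain A B C D where X: "X = A \<times> B" "A \<in> sets M" "B \<in> sets M"
    and Y: "Y = C \<times> D" "C \<in> sets M" "D \<in> sets M"
    by blast
  have "X \<inter> Y = (A \<inter> C) \<times> (B \<inter> D)"
    using X Y by auto
  then show "X \<inter> Y \<in> ?R"
    using X Y rectangle[of "A \<inter> C" "B \<inter> D"] by (simp only:) auto
  let ?C = "{(A - C) \<times> B, (A \<inter> C) \<times> (B - D)}"
  have "?C \<subseteq> ?R"
    using rectangle[of "A - C" B] rectangle[of "A \<inter> C" "B - D"] X Y by auto
  moreover have "disjoint ?C"
    by (auto simp: disjoint_def)
  moreover have "X - Y = \<Union>?C"
    unfolding X(1) Y(1) by auto
  ultimately show "\<exists>C\<subseteq>?R. finite C \<and> disjoint C \<and> X - Y = \<Union>C"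
    by (intro exI[of _ ?C]) simp
qed

definition precoupling :: "'a measure \<Rightarrow> ('a set \<times> 'a set \<Rightarrow> real) \<Rightarrow> bool" where
  "precoupling M \<beta> \<longleftrightarrow> (\<forall>A\<in>sets M. \<beta> (A, space M) = measure M A) \<and> (\<forall>B\<in>sets M. \<beta> (space M, B) = measure M B)
     \<and> (\<forall>(I :: nat set) (J :: nat set) A B C D. finite I \<longrightarrow> finite J
        \<longrightarrow> range A \<union> range B \<union> range C \<union> range D \<subseteq> sets M
        \<longrightarrow> (\<forall>z. (\<Sum>i\<in>I. indicat_real (A i \<times> B i) z) \<le> (\<Sum>j\<in>J. indicator (C j \<times> D j) z))
        \<longrightarrow> (\<Sum>i\<in>I. \<beta> (A i, B i)) \<le> (\<Sum>j\<in>J. \<beta> (C j, D j)))"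

lemma precoupling_C2:
  assumes \<rho>: "\<rho> \<in> C2 M"
  shows "precoupling M (\<lambda>(A, B). measure \<rho> (A \<times> B))"
proof -
  interpret \<rho>: prob_space \<rho> by (rule C2D(2)[OF \<rho>])
  have sum_indicators: "(\<Sum>i\<in>I. measure \<rho> (A i \<times> B i)) = (\<integral>z. (\<Sum>i\<in>I. indicator (A i \<times> B i) z) \<partial>\<rho>)"
    "integrable \<rho> (\<lambda>z. \<Sum>i\<in>I. indicat_real (A i \<times> B i) z)"
    if "range A \<subseteq> sets M" "range B \<subseteq> sets M" for I :: "nat set" and A B
  proof -
    have [measurable]: "A i \<times> B i \<in> sets \<rho>" for i
      using that by (intro C2_Times_in_sets[OF \<rho>]) auto
    have integrable: "integrable \<rho> (indicat_real (A i \<times> B i))" for i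
      by (simp add: less_top[symmetric])
    show "integrable \<rho> (\<lambda>z. \<Sum>i\<in>I. indicat_real (A i \<times> B i) z)"
      by (intro Bochner_Integration.integrable_sum integrable)
    show "(\<Sum>i\<in>I. measure \<rho> (A i \<times> B i)) = (\<integral>z. (\<Sum>i\<in>I. indicator (A i \<times> B i) z) \<partial>\<rho>)"
      by (subst Bochner_Integration.integral_sum[OF integrable]) simp
  qed
  show ?thesis
    unfolding precoupling_def
    by (auto simp: C2D(4,5)[OF \<rho>] sum_indicators intro!: integral_mono)
qed

lemma closed_precoupling: "closed {\<beta>. precoupling M \<beta>}"
  unfolding precoupling_def Ball_def
  by (intro closed_Collect_conj closed_Collect_all closed_Collect_imp open_Collect_const
      closed_Collect_eq closed_Collect_le continuous_intros) auto

locale prob_precoupling = prob_space M for M :: "'a measure" +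
  fixes \<beta> :: "'a set \<times> 'a set \<Rightarrow> real"
  assumes precoupling: "precoupling M \<beta>"
begin

lemma marginals:
  "A \<in> sets M \<Longrightarrow> \<beta> (A, space M) = measure M A"
  "B \<in> sets M \<Longrightarrow> \<beta> (space M, B) = measure M B"
  using precoupling by (auto simp: precoupling_def)

lemma sum_mono_indicator:
  fixes I J :: "nat set"
  assumes "finite I" "finite J" "\<And>i. A i \<in> sets M" "\<And>i. B i \<in> sets M" "\<And>j. C j \<in> sets M" "\<And>j. D j \<in> sets M"
    and "\<And>z. (\<Sum>i\<in>I. indicat_real (A i \<times> B i) z) \<le> (\<Sum>j\<in>J. indicator (C j \<times> D j) z)"
  shows "(\<Sum>i\<in>I. \<beta> (A i, B i)) \<le> (\<Sum>j\<in>J. \<beta> (C j, D j))"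
proof -
  have "range A \<union> range B \<union> range C \<union> range D \<subseteq> sets M"
    using assms(3-6) by auto
  then show ?thesis
    using precoupling assms(1,2,7) unfolding precoupling_def by blast
qed

lemma subadditive:
  fixes I :: "nat set"
  assumes I: "finite I" and sets: "\<And>i. A i \<in> sets M" "\<And>i. B i \<in> sets M" "C \<in> sets M" "D \<in> sets M"
    and cover: "C \<times> D \<subseteq> (\<Union>i\<in>I. A i \<times> B i)"
  shows "\<beta> (C, D) \<le> (\<Sum>i\<in>I. \<beta> (A i, B i))"
proof -
  have "indicat_real (C \<times> D) z \<le> (\<Sum>i\<in>I. indicator (A i \<times> B i) z)" for z
  proof (cases "z \<in> C \<times> D")
    case True
    then obtain i where "i \<in> I" "z \<in> A i \<times> B i"
      using cover by blast
    then show ?thesis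
      using True member_le_sum[of i I "\<lambda>i. indicat_real (A i \<times> B i) z"] I by simp
  qed (simp add: sum_nonneg)
  then show ?thesis
    using sum_mono_indicator[of "{0}" I "\<lambda>_. C" "\<lambda>_. D" A B] I sets by simp
qed

lemma superadditive:
  fixes I :: "nat set"
  assumes I: "finite I" and sets: "\<And>i. A i \<in> sets M" "\<And>i. B i \<in> sets M" "C \<in> sets M" "D \<in> sets M"
    and disjoint: "disjoint_family_on (\<lambda>i. A i \<times> B i) I" and subset: "(\<Union>i\<in>I. A i \<times> B i) \<subseteq> C \<times> D"
  shows "(\<Sum>i\<in>I. \<beta> (A i, B i)) \<le> \<beta> (C, D)"
proof -
  have "(\<Sum>i\<in>I. indicat_real (A i \<times> B i) z) \<le> indicator (C \<times> D) z" for z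
    unfolding indicator_UN_disjoint[OF I disjoint, symmetric] using subset by (auto simp: indicator_def)
  then show ?thesis
    using sum_mono_indicator[of I "{0}" A B "\<lambda>_. C" "\<lambda>_. D"] I sets by simp
qed

lemma nonneg: "A \<in> sets M \<Longrightarrow> B \<in> sets M \<Longrightarrow> 0 \<le> \<beta> (A, B)"
  using superadditive[of "{}" "\<lambda>_. A" "\<lambda>_. B" A B] by (simp add: disjoint_family_on_def)

lemma empty_rectangle: "A \<in> sets M \<Longrightarrow> B \<in> sets M \<Longrightarrow> A \<times> B = {} \<Longrightarrow> \<beta> (A, B) = 0"
  using subadditive[of "{}" "\<lambda>_. A" "\<lambda>_. B" A B] nonneg[of A B] by simp

lemma eq_if_Times_eq:
  assumes "A \<in> sets M" "B \<in> sets M" "C \<in> sets M" "D \<in> sets M" "A \<times> B = C \<times> D"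
  shows "\<beta> (A, B) = \<beta> (C, D)"
  using subadditive[of "{0}" "\<lambda>_. A" "\<lambda>_. B" C D] subadditive[of "{0}" "\<lambda>_. C" "\<lambda>_. D" A B] assms by simp

lemma le_add_diffs:
  assumes sets: "A \<in> sets M" "B \<in> sets M" "C \<in> sets M" "D \<in> sets M"
  shows "\<beta> (A, B) \<le> \<beta> (C, D) + measure M (A - C) + measure M (B - D)"
proof -
  let ?A = "\<lambda>i::nat. if i = 0 then C else if i = 1 then A - C else space M"
  let ?B = "\<lambda>i::nat. if i = 0 then D else if i = 1 then space M else B - D"
  have "\<beta> (A, B) \<le> (\<Sum>i\<in>{0, 1, 2}. \<beta> (?A i, ?B i))"
    using sets sets.sets_into_space[OF sets(1)] sets.sets_into_space[OF sets(2)]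
    by (intro subadditive) auto
  also have "\<dots> = \<beta> (C, D) + measure M (A - C) + measure M (B - D)"
    using sets by (simp add: marginals)
  finally show ?thesis .
qed

end

locale polish_precoupling = prob_precoupling M \<beta>
  for M :: "'a::polish_space measure" and \<beta> +
  assumes borel: "sets M = sets borel"
begin

lemma compact_rectangle_approx:
  assumes C: "C \<in> sets M" and D: "D \<in> sets M" and e: "e > 0"
  obtains C' D' where "C' \<subseteq> C" "D' \<subseteq> D" "compact C'" "compact D'" "C' \<in> sets M" "D' \<in> sets M"
    "\<beta> (C, D) \<le> \<beta> (C', D') + e"
proof -
  obtain C' where C': "C' \<subseteq> C" "compact C'" "C' \<in> sets M" "measure M (C - C') < e / 2"
    using inner_regular_approx[OF finite_measure_axioms borel C half_gt_zero[OF e]] .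
  obtain D' where D': "D' \<subseteq> D" "compact D'" "D' \<in> sets M" "measure M (D - D') < e / 2"
    using inner_regular_approx[OF finite_measure_axioms borel D half_gt_zero[OF e]] .
  have "\<beta> (C, D) \<le> \<beta> (C', D') + e"
    using le_add_diffs[OF C D C'(3) D'(3)] C'(4) D'(4) by linarith
  with C'(1-3) D'(1-3) that show thesis
    by blast
qed

lemma open_rectangle_approx:
  assumes A: "A \<in> sets M" and B: "B \<in> sets M" and e: "e > 0"
  shows "\<exists>U V. A \<subseteq> U \<and> B \<subseteq> V \<and> open U \<and> open V \<and> U \<in> sets M \<and> V \<in> sets M \<and> \<beta> (U, V) \<le> \<beta> (A, B) + e"
proof -
  obtain U where U: "A \<subseteq> U" "open U" "U \<in> sets M" "measure M (U - A) < e / 2"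
    using outer_regular_approx[OF finite_measure_axioms borel A half_gt_zero[OF e]] .
  obtain V where V: "B \<subseteq> V" "open V" "V \<in> sets M" "measure M (V - B) < e / 2"
    using outer_regular_approx[OF finite_measure_axioms borel B half_gt_zero[OF e]] .
  have "\<beta> (U, V) \<le> \<beta> (A, B) + e"
    using le_add_diffs[OF U(3) V(3) A B] U(4) V(4) by linarith
  with U(1-3) V(1-3) show ?thesis
    by blast
qed

lemma subadditive_finite_approx:
  fixes A B :: "nat \<Rightarrow> 'a set"
  assumes A: "\<And>n. A n \<in> sets M" and B: "\<And>n. B n \<in> sets M" and C: "C \<in> sets M" and D: "D \<in> sets M"
    and cover: "C \<times> D \<subseteq> (\<Union>n. A n \<times> B n)" and e: "e > 0"
  obtains I where "finite I" "\<beta> (C, D) \<le> (\<Sum>n\<in>I. \<beta> (A n, B n)) + e"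
proof -
  define \<epsilon> where "\<epsilon> n = e / 4 * (1/2)^n" for n :: nat
  have \<epsilon>: "\<epsilon> n > 0" for n
    using e by (simp add: \<epsilon>_def)
  obtain C' D' where CD: "C' \<subseteq> C" "D' \<subseteq> D" "compact C'" "compact D'" "C' \<in> sets M" "D' \<in> sets M"
    and inner: "\<beta> (C, D) \<le> \<beta> (C', D') + e / 2"
    using compact_rectangle_approx[OF C D half_gt_zero[OF e]] .
  have "\<exists>U V. A n \<subseteq> U \<and> B n \<subseteq> V \<and> open U \<and> open V \<and> U \<in> sets M \<and> V \<in> sets M
      \<and> \<beta> (U, V) \<le> \<beta> (A n, B n) + \<epsilon> n" for n
    by (rule open_rectangle_approx[OF A B \<epsilon>])
  then obtain U V where UV: "\<And>n. A n \<subseteq> U n" "\<And>n. B n \<subseteq> V n" "\<And>n. open (U n)" "\<And>n. open (V n)"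
    "\<And>n. U n \<in> sets M" "\<And>n. V n \<in> sets M"
    and outer: "\<And>n. \<beta> (U n, V n) \<le> \<beta> (A n, B n) + \<epsilon> n"
    by metis
  have "C' \<times> D' \<subseteq> C \<times> D"
    using CD(1,2) by (rule Sigma_mono)
  also note cover
  also have "(\<Union>n. A n \<times> B n) \<subseteq> (\<Union>n. U n \<times> V n)"
    by (intro UN_mono Sigma_mono UV order_refl)
  finally obtain I where I: "finite I" "C' \<times> D' \<subseteq> (\<Union>n\<in>I. U n \<times> V n)"
    by (rule compactE_image[OF compact_Times[OF CD(3,4)] open_Times[OF UV(3,4)]])
  have "\<beta> (C', D') \<le> (\<Sum>n\<in>I. \<beta> (U n, V n))"
    by (rule subadditive[OF I(1) UV(5,6) CD(5,6) I(2)])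
  also have "\<dots> \<le> (\<Sum>n\<in>I. \<beta> (A n, B n)) + (\<Sum>n\<in>I. \<epsilon> n)"
    unfolding sum.distrib[symmetric] by (intro sum_mono outer)
  also have "(\<Sum>n\<in>I. \<epsilon> n) = e / 4 * (\<Sum>n\<in>I. (1/2)^n)"
    by (simp add: \<epsilon>_def sum_distrib_left)
  also have "(\<Sum>n\<in>I. (1/2::real)^n) \<le> 2"
    using sum_le_suminf[of "\<lambda>n. (1/2::real)^n" I] I(1) by (simp add: suminf_geometric summable_geometric)
  finally have "\<beta> (C, D) \<le> (\<Sum>n\<in>I. \<beta> (A n, B n)) + e"
    using inner e by simp
  with I(1) show thesis
    by (rule that)
qed

lemma countably_additive:
  fixes A B :: "nat \<Rightarrow> 'a set"
  assumes A: "\<And>n. A n \<in> sets M" and B: "\<And>n. B n \<in> sets M" and C: "C \<in> sets M" and D: "D \<in> sets M"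
    and disjoint: "disjoint_family (\<lambda>n. A n \<times> B n)" and union: "(\<Union>n. A n \<times> B n) = C \<times> D"
  shows "(\<Sum>n. ennreal (\<beta> (A n, B n))) = ennreal (\<beta> (C, D))"
proof (rule antisym)
  show "(\<Sum>n. ennreal (\<beta> (A n, B n))) \<le> ennreal (\<beta> (C, D))"
  proof (rule suminf_le_const[OF summableI])
    fix n
    have "(\<Sum>i<n. \<beta> (A i, B i)) \<le> \<beta> (C, D)"
      using disjoint by (intro superadditive A B C D)
        (auto simp: disjoint_family_on_def union[symmetric])
    then show "(\<Sum>i<n. ennreal (\<beta> (A i, B i))) \<le> ennreal (\<beta> (C, D))"
      by (simp add: nonneg A B ennreal_leI)
  qed
  show "ennreal (\<beta> (C, D)) \<le> (\<Sum>n. ennreal (\<beta> (A n, B n)))"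
  proof (rule ennreal_le_epsilon)
    fix e :: real assume "0 < e"
    then obtain I where I: "finite I" "\<beta> (C, D) \<le> (\<Sum>n\<in>I. \<beta> (A n, B n)) + e"
      by (rule subadditive_finite_approx[OF A B C D equalityD2[OF union]])
    then have "ennreal (\<beta> (C, D)) \<le> (\<Sum>n\<in>I. ennreal (\<beta> (A n, B n))) + ennreal e"
      using \<open>0 < e\<close> by (simp add: nonneg A B sum_nonneg ennreal_leI flip: ennreal_plus)
    also have "\<dots> \<le> (\<Sum>n. ennreal (\<beta> (A n, B n))) + ennreal e"
      by (intro add_right_mono sum_le_suminf summableI I) auto
    finally show "ennreal (\<beta> (C, D)) \<le> (\<Sum>n. ennreal (\<beta> (A n, B n))) + ennreal e" .
  qed
qed

theorem coupling_exists:
  obtains \<rho> where "\<rho> \<in> C2 M" "\<And>A B. A \<in> sets M \<Longrightarrow> B \<in> sets M \<Longrightarrow> measure \<rho> (A \<times> B) = \<beta> (A, B)"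
proof -
  define \<rho> where "\<rho> = extend_measure (space M \<times> space M) {(A, B). A \<in> sets M \<and> B \<in> sets M}
    (\<lambda>(A, B). A \<times> B) (\<lambda>(A, B). ennreal (\<beta> (A, B)))"
  have rectangle: "emeasure \<rho> (A \<times> B) = ennreal (\<beta> (A, B))" if "A \<in> sets M" "B \<in> sets M" for A B
  proof (rule extend_measure_caratheodory_pair[OF \<rho>_def])
    show "semiring_of_sets (space M \<times> space M) {A \<times> B | A B. A \<in> sets M \<and> B \<in> sets M}"
      by (rule semiring_of_rectangles)
    show "(\<Sum>n. ennreal (\<beta> (A n, B n))) = ennreal (\<beta> (C, D))"
      if "\<And>n. A n \<in> sets M \<and> B n \<in> sets M" "C \<in> sets M \<and> D \<in> sets M"
        "disjoint_family (\<lambda>n. A n \<times> B n)" "(\<Union>n. A n \<times> B n) = C \<times> D" for A B C D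
      by (rule countably_additive) (use that in auto)
    show "ennreal (\<beta> (A, B)) = ennreal (\<beta> (C, D))"
      if "A \<in> sets M \<and> B \<in> sets M" "C \<in> sets M \<and> D \<in> sets M" "A \<times> B = C \<times> D" for A B C D
      using eq_if_Times_eq[of A B C D] that by simp
  qed (use that empty_rectangle in auto)
  have "sets \<rho> = sigma_sets (space M \<times> space M) ((\<lambda>(A, B). A \<times> B) ` {(A, B). A \<in> sets M \<and> B \<in> sets M})"
    unfolding \<rho>_def by (rule sets_extend_measure) (use sets.sets_into_space in auto)
  also have "(\<lambda>(A, B). A \<times> B) ` {(A, B). A \<in> sets M \<and> B \<in> sets M} = {A \<times> B | A B. A \<in> sets M \<and> B \<in> sets M}"
    by auto
  finally have "sets \<rho> = sets (M \<Otimes>\<^sub>M M)"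
    by (simp add: sets_pair_measure)
  then have "\<rho> \<in> C2 M"
    by (rule C2I) (simp_all add: rectangle marginals emeasure_eq_measure)
  moreover have "measure \<rho> (A \<times> B) = \<beta> (A, B)" if "A \<in> sets M" "B \<in> sets M" for A B
    using that by (simp add: measure_def rectangle nonneg)
  ultimately show thesis
    by (rule that)
qed

end

lemma compact_precouplings: "compact {\<beta> \<in> (\<Pi>\<^sub>E p\<in>UNIV. {0..1}). precoupling M \<beta>}"
proof -
  have "compactin (product_topology (\<lambda>_::'a set \<times> 'a set. euclideanreal) UNIV) (\<Pi>\<^sub>E p\<in>UNIV. {0..1})"
    by (simp add: compactin_PiE)
  then have "compact ((\<Pi>\<^sub>E p\<in>UNIV. {0..1}) \<inter> {\<beta>. precoupling M \<beta>})"
    by (intro compact_Int_closed closed_precoupling) (simp add: euclidean_product_topology)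
  then show ?thesis
    by (simp add: Collect_conj_eq)
qed

lemma precoupling_imp_coupling:
  fixes M :: "'a::polish_space measure"
  assumes "prob_space M" "sets M = sets borel" "precoupling M \<beta>"
  shows "\<exists>\<rho>. \<rho> \<in> C2 M \<and> (\<forall>A\<in>sets M. \<forall>B\<in>sets M. measure \<rho> (A \<times> B) = \<beta> (A, B))"
proof -
  interpret prob_space M by (rule assms(1))
  interpret polish_precoupling M \<beta>
    using assms(2,3) by unfold_locales
  show ?thesis
    using coupling_exists by metis
qed

theorem compact_space_C2_topology:
  fixes M :: "'a::polish_space measure"
  assumes M: "prob_space M" and borel: "sets M = sets borel"
  shows "compact_space (C2_topology M)"
proof -
  define K where "K = {\<beta> \<in> (\<Pi>\<^sub>E p\<in>UNIV. {0..1}). precoupling M \<beta>}"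
  have "\<exists>\<rho>. \<rho> \<in> C2 M \<and> (\<forall>A\<in>sets M. \<forall>B\<in>sets M. measure \<rho> (A \<times> B) = \<beta> (A, B))" if "\<beta> \<in> K" for \<beta>
    using that by (intro precoupling_imp_coupling M borel) (simp add: K_def)
  then obtain g where g: "\<And>\<beta>. \<beta> \<in> K \<Longrightarrow> g \<beta> \<in> C2 M"
    "\<And>\<beta> A B. \<beta> \<in> K \<Longrightarrow> A \<in> sets M \<Longrightarrow> B \<in> sets M \<Longrightarrow> measure (g \<beta>) (A \<times> B) = \<beta> (A, B)"
    by metis
  have "compactin (top_of_set K) K"
    using compact_precouplings[of M] by (simp add: K_def compactin_subtopology)
  moreover have "continuous_map (top_of_set K) (C2_topology M) g"
  proof (rule continuous_map_into_C2_topology)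
    fix A B assume sets: "A \<in> sets M" "B \<in> sets M"
    have "continuous_on K (\<lambda>\<beta>. \<beta> (A, B))"
      by (rule continuous_on_subset[of UNIV]) auto
    then have "continuous_on K (\<lambda>\<beta>. measure (g \<beta>) (A \<times> B))"
      by (rule continuous_on_cong[THEN iffD1, rotated 2]) (simp_all add: g(2) sets)
    then show "continuous_map (top_of_set K) euclideanreal (\<lambda>\<beta>. measure (g \<beta>) (A \<times> B))"
      by simp
  qed (use g(1) in simp)
  ultimately have "compactin (C2_topology M) (g ` K)"
    by (rule image_compactin)
  moreover have "g ` K = C2 M"
  proof
    show "C2 M \<subseteq> g ` K"
    proof
      fix \<rho> assume \<rho>: "\<rho> \<in> C2 M"
      let ?\<beta> = "\<lambda>(A, B). measure \<rho> (A \<times> B)"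
      have "?\<beta> \<in> K"
        using precoupling_C2[OF \<rho>] prob_space.prob_le_1[OF C2D(2)[OF \<rho>]] by (auto simp: K_def)
      then show "\<rho> \<in> g ` K"
        using g \<rho> by (intro image_eqI[of _ _ ?\<beta>] C2_eqI[OF \<rho>]) auto
    qed
  qed (use g(1) in blast)
  ultimately show ?thesis
    by (simp add: compact_space_def)
qed

section \<open>Distality\<close>

lemma (in prob_space) integral_pair_mult:
  fixes f g :: "'a \<Rightarrow> real"
  assumes f: "integrable M f" and g: "integrable M g"
  shows "integrable (M \<Otimes>\<^sub>M M) (\<lambda>(x, y). f x * g y)"
    and "(\<integral>(x, y). f x * g y \<partial>(M \<Otimes>\<^sub>M M)) = (\<integral>x. f x \<partial>M) * (\<integral>y. g y \<partial>M)"
proof -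
  interpret P: pair_prob_space M M ..
  note [measurable] = borel_measurable_integrable[OF f] borel_measurable_integrable[OF g]
  show integrable: "integrable (M \<Otimes>\<^sub>M M) (\<lambda>(x, y). f x * g y)"
    by (rule P.Fubini_integrable) (use f g in \<open>auto simp: abs_mult\<close>)
  show "(\<integral>(x, y). f x * g y \<partial>(M \<Otimes>\<^sub>M M)) = (\<integral>x. f x \<partial>M) * (\<integral>y. g y \<partial>M)"
    using P.integral_fst'[OF integrable] by simp
qed

lemma (in prob_space) integrable_if_abs_le_1:
  fixes f :: "'a \<Rightarrow> real"
  shows "f \<in> borel_measurable M \<Longrightarrow> (\<And>x. \<bar>f x\<bar> \<le> 1) \<Longrightarrow> integrable M f"
  by (rule integrable_const_bound[of _ 1]) auto

lemma (in prob_space) abs_set_integral_le_1: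
  fixes f :: "'a \<Rightarrow> real"
  assumes f: "f \<in> borel_measurable M" and bound: "\<And>x. \<bar>f x\<bar> \<le> 1" and A: "A \<in> sets M"
  shows "\<bar>LINT x:A|M. f x\<bar> \<le> 1"
proof -
  have "\<bar>LINT x:A|M. f x\<bar> \<le> (\<integral>x. \<bar>indicator A x *\<^sub>R f x\<bar> \<partial>M)"
    unfolding set_lebesgue_integral_def by (rule integral_abs_bound)
  also have "\<dots> \<le> (\<integral>x. 1 \<partial>M)"
    using A integrable_if_abs_le_1[OF f bound] bound
    by (intro integral_mono integrable_abs integrable_mult_indicator) (auto simp: indicator_def)
  finally show ?thesis
    by (simp add: prob_space)
qed

definition perturbed_product :: "'a measure \<Rightarrow> ('a \<Rightarrow> real) \<Rightarrow> ('a \<times> 'a) measure" where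
  "perturbed_product M f = density (M \<Otimes>\<^sub>M M) (\<lambda>(x, y). ennreal (1 + f x * f y))"

lemma (in prob_space) emeasure_perturbed_product_Times:
  assumes f [measurable]: "f \<in> borel_measurable M" and bound: "\<And>x. \<bar>f x\<bar> \<le> 1"
    and [measurable]: "A \<in> sets M" "B \<in> sets M"
  shows "emeasure (perturbed_product M f) (A \<times> B)
      = ennreal (measure M A * measure M B + (LINT x:A|M. f x) * (LINT x:B|M. f x))"
    and "0 \<le> measure M A * measure M B + (LINT x:A|M. f x) * (LINT x:B|M. f x)"
proof -
  define g where "g A x = indicat_real A x * f x" for A x
  let ?h = "\<lambda>z. (\<lambda>(x, y). indicat_real A x * indicat_real B y) z + (\<lambda>(x, y). g A x * g B y) z"
  have g_integrable: "integrable M (g C)" if [measurable]: "C \<in> sets M" for C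
    unfolding g_def using integrable_if_abs_le_1[OF f bound]
    by (intro integrable_mult_indicator[where 'b = real, simplified]) auto
  have indicator_integrable: "integrable M (indicat_real C)" if "C \<in> sets M" for C
    using that by (simp add: less_top[symmetric])
  note indicators = integral_pair_mult[OF indicator_integrable indicator_integrable]
    and perturbation = integral_pair_mult[OF g_integrable g_integrable]
  have "\<bar>f x * f y\<bar> \<le> 1" for x y
    unfolding abs_mult using mult_mono[OF bound[of x] bound[of y]] by simp
  then have "0 \<le> 1 + f x * f y" for x y
    by (smt (verit))
  then have h_nonneg: "0 \<le> ?h z" for z
    by (cases z) (auto simp: g_def indicator_def)
  have density: "ennreal (1 + f x * f y) * indicator (A \<times> B) (x, y) = ennreal (?h (x, y))" for x y
    by (cases "x \<in> A"; cases "y \<in> B") (simp_all add: g_def)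
  have integral: "(\<integral>z. ?h z \<partial>(M \<Otimes>\<^sub>M M)) = measure M A * measure M B + (LINT x:A|M. f x) * (LINT x:B|M. f x)"
    by (subst Bochner_Integration.integral_add)
      (simp_all add: indicators perturbation, simp add: set_lebesgue_integral_def g_def[abs_def])
  have "emeasure (perturbed_product M f) (A \<times> B)
      = (\<integral>\<^sup>+z. (\<lambda>(x, y). ennreal (1 + f x * f y)) z * indicator (A \<times> B) z \<partial>(M \<Otimes>\<^sub>M M))"
    unfolding perturbed_product_def by (rule emeasure_density) measurable
  also have "\<dots> = (\<integral>\<^sup>+z. ennreal (?h z) \<partial>(M \<Otimes>\<^sub>M M))"
    by (intro nn_integral_cong) (auto simp: density)
  also have "\<dots> = ennreal (\<integral>z. ?h z \<partial>(M \<Otimes>\<^sub>M M))"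
    using h_nonneg
    by (intro nn_integral_eq_integral Bochner_Integration.integrable_add indicators perturbation AE_I2) auto
  finally show "emeasure (perturbed_product M f) (A \<times> B)
      = ennreal (measure M A * measure M B + (LINT x:A|M. f x) * (LINT x:B|M. f x))"
    by (simp only: integral)
  show "0 \<le> measure M A * measure M B + (LINT x:A|M. f x) * (LINT x:B|M. f x)"
    unfolding integral[symmetric] by (rule Bochner_Integration.integral_nonneg) (rule h_nonneg)
qed

lemma (in prob_space) measure_perturbed_product_Times:
  assumes "f \<in> borel_measurable M" "\<And>x. \<bar>f x\<bar> \<le> 1" "A \<in> sets M" "B \<in> sets M"
  shows "measure (perturbed_product M f) (A \<times> B)
    = measure M A * measure M B + (LINT x:A|M. f x) * (LINT x:B|M. f x)"
  using emeasure_perturbed_product_Times[OF assms] by (simp add: measure_def[of "perturbed_product M f"])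

lemma (in prob_space) perturbed_product_in_C2:
  assumes "f \<in> borel_measurable M" "\<And>x. \<bar>f x\<bar> \<le> 1" and zero: "(\<integral>x. f x \<partial>M) = 0"
  shows "perturbed_product M f \<in> C2 M"
proof (rule C2I)
  have "(LINT x:space M|M. f x) = 0"
    using zero set_integral_space[OF integrable_if_abs_le_1[OF assms(1,2)]] by simp
  then show "emeasure (perturbed_product M f) (A \<times> space M) = emeasure M A"
    "emeasure (perturbed_product M f) (space M \<times> A) = emeasure M A" if "A \<in> sets M" for A
    using emeasure_perturbed_product_Times(1)[OF assms(1,2)] that
    by (simp_all add: prob_space emeasure_eq_measure)
qed (simp add: perturbed_product_def)

lemma distal_proximal_fixed_point:
  assumes distal: "distal Z R" and z: "z \<in> topspace Z" and w: "w \<in> topspace Z"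
    and fixed: "\<And>n. zpow Z R n z = z" and proximal: "z \<in> Z closure_of range (\<lambda>n. zpow Z R n w)"
  shows "w = z"
proof (rule ccontr)
  assume "w \<noteq> z"
  have diagonal: "(z, z) \<in> prod_topology Z Z closure_of ({z} \<times> range (\<lambda>n. zpow Z R n w))"
    using z proximal closure_of_subset[of "{z}" Z] by (simp add: closure_of_Times)
  have "{z} \<times> range (\<lambda>n. zpow Z R n w) = {(zpow Z R n z, zpow Z R n w) | n. True}"
    unfolding fixed by auto
  moreover have "prod_topology Z Z closure_of {(zpow Z R n z, zpow Z R n w) | n. True}
      \<inter> {(z, z) | z. True} = {}"
    using distal z w \<open>w \<noteq> z\<close> unfolding distal_def by simp
  ultimately show False
    using diagonal by auto
qed

context mp_automorphism begin

lemma eigenfunction_const: "eigenfunction M T (\<lambda>x. 1)"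
  unfolding eigenfunction_def
  by (auto intro!: exI[of _ 1] L2fun_bounded[of _ 1] simp: AE_iff_null emeasure_space_1 null_sets_def)

lemma set_integral_vimage_Tpow:
  fixes f :: "'a \<Rightarrow> real"
  assumes [measurable]: "f \<in> borel_measurable M" "A \<in> sets M"
  shows "complex_of_real (LINT x:(Tpow (- int n) -` A \<inter> space M)|M. f x)
    = L2inner M (\<lambda>x. complex_of_real (f ((T ^^ n) x))) (\<lambda>x. indicator A x)"
proof -
  let ?B = "Tpow (- int n) -` A \<inter> space M"
  have [measurable]: "?B \<in> sets M"
    by (rule vimage_Tpow_in_sets) fact
  note Tn = mp_map_funpow[OF mp_T, of n]
  have Tpow: "Tpow (- int n) = Tinv ^^ n"
    by (simp add: Tpow_def)
  have "(LINT x:?B|M. f x) = (\<integral>x. indicator ?B ((T ^^ n) x) * f ((T ^^ n) x) \<partial>M)"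
    unfolding set_lebesgue_integral_def
    using integral_mp_map[OF Tn, of "\<lambda>x. indicator ?B x * f x"] by simp
  also have "\<dots> = (\<integral>x. indicator A x * f ((T ^^ n) x) \<partial>M)"
    using measurable_space[OF mp_map_measurable[OF Tn]]
    by (intro Bochner_Integration.integral_cong refl)
      (auto simp: Tpow funpow_Tinv_funpow_T indicator_def)
  finally have "complex_of_real (LINT x:?B|M. f x)
      = (\<integral>x. complex_of_real (indicator A x * f ((T ^^ n) x)) \<partial>M)"
    by (simp only: integral_complex_of_real)
  also have "\<dots> = L2inner M (\<lambda>x. complex_of_real (f ((T ^^ n) x))) (\<lambda>x. indicator A x)"
    unfolding L2inner_def by (intro Bochner_Integration.integral_cong refl) (simp add: indicator_def)
  finally show ?thesis .
qed

lemma measure_zpow_perturbed_product_diff_le: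
  fixes f :: "'a \<Rightarrow> real"
  assumes f: "f \<in> borel_measurable M" and bound: "\<And>x. \<bar>f x\<bar> \<le> 1"
    and coupling: "perturbed_product M f \<in> C2 M" and A: "A \<in> sets M" and B: "B \<in> sets M"
  shows "\<bar>measure (zpow (C2_topology M) (lift_map M T) (- int n) (perturbed_product M f)) (A \<times> B)
      - measure (M \<Otimes>\<^sub>M M) (A \<times> B)\<bar>
    \<le> cmod (L2inner M (\<lambda>x. complex_of_real (f ((T ^^ n) x))) (\<lambda>x. indicator A x))"
proof -
  define S where "S A = Tpow (- int n) -` A \<inter> space M" for A
  have S: "S A \<in> sets M" "measure M (S A) = measure M A" if "A \<in> sets M" for A
    using vimage_Tpow_in_sets[OF that] emeasure_mp_map[OF mp_Tpow that, of "- int n"]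
    by (simp_all add: S_def measure_def)
  have "\<bar>measure (zpow (C2_topology M) (lift_map M T) (- int n) (perturbed_product M f)) (A \<times> B)
      - measure (M \<Otimes>\<^sub>M M) (A \<times> B)\<bar> = \<bar>LINT x:S A|M. f x\<bar> * \<bar>LINT x:S B|M. f x\<bar>"
    using A B S by (simp add: measure_zpow_lift_map[OF coupling] measure_pair_Times abs_mult
        measure_perturbed_product_Times[OF f bound] flip: S_def)
  also have "\<dots> \<le> \<bar>LINT x:S A|M. f x\<bar> * 1"
    by (intro mult_left_mono abs_set_integral_le_1[OF f bound S(1)[OF B]]) simp
  also have "\<dots> = cmod (L2inner M (\<lambda>x. complex_of_real (f ((T ^^ n) x))) (\<lambda>x. indicator A x))"
    by (simp add: S_def flip: set_integral_vimage_Tpow[OF f A])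
  finally show ?thesis .
qed

lemma eigen_orthogonal_proximal:
  fixes f :: "'a \<Rightarrow> real"
  assumes f: "f \<in> borel_measurable M" and bound: "\<And>x. \<bar>f x\<bar> \<le> 1"
    and orthogonal: "eigen_orthogonal M T (\<lambda>x. complex_of_real (f x))"
    and coupling: "perturbed_product M f \<in> C2 M"
  shows "M \<Otimes>\<^sub>M M \<in> C2_topology M closure_of
    range (\<lambda>n. zpow (C2_topology M) (lift_map M T) n (perturbed_product M f))"
  unfolding in_closure_of
proof (intro conjI allI impI)
  let ?orbit = "\<lambda>n. zpow (C2_topology M) (lift_map M T) n (perturbed_product M f)"
  show "M \<Otimes>\<^sub>M M \<in> topspace (C2_topology M)"
    by (simp add: pair_measure_in_C2)
  fix V assume "M \<Otimes>\<^sub>M M \<in> V \<and> openin (C2_topology M) V"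
  then obtain P e where P: "finite P" "P \<subseteq> sets M \<times> sets M" and e: "e > 0"
    and V: "\<And>\<rho>. \<rho> \<in> C2 M \<Longrightarrow> (\<And>A B. (A, B) \<in> P \<Longrightarrow>
      \<bar>measure \<rho> (A \<times> B) - measure (M \<Otimes>\<^sub>M M) (A \<times> B)\<bar> < e) \<Longrightarrow> \<rho> \<in> V"
    using C2_topology_neighbourhood[of M V "M \<Otimes>\<^sub>M M"] by blast
  have indicators: "L2fun M (\<lambda>x. indicator A x)" if "A \<in> fst ` P" for A
    using P(2) that by (intro L2fun_indicator) auto
  obtain n where n: "\<forall>A\<in>fst ` P.
      cmod (L2inner M (\<lambda>x. complex_of_real (f ((T ^^ n) x))) (\<lambda>x. indicator A x)) < e"
    using eigen_orthogonal_small_correlations[OF mp_T orthogonal e finite_imageI[OF P(1)] indicators] ..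
  have "?orbit (- int n) \<in> V"
  proof (rule V)
    show "?orbit (- int n) \<in> C2 M"
      by (rule zpow_lift_map_in_C2[OF coupling])
    fix A B assume AB: "(A, B) \<in> P"
    then have "A \<in> sets M" "B \<in> sets M"
      using P(2) by auto
    from measure_zpow_perturbed_product_diff_le[OF f bound coupling this]
    show "\<bar>measure (?orbit (- int n)) (A \<times> B) - measure (M \<Otimes>\<^sub>M M) (A \<times> B)\<bar> < e"
      using n AB by (force intro: le_less_trans)
  qed
  then show "\<exists>\<rho>. \<rho> \<in> range ?orbit \<and> \<rho> \<in> V"
    by blast
qed

theorem distal_eigen_orthogonal_eq_0:
  fixes f :: "'a \<Rightarrow> real"
  assumes distal: "distal (C2_topology M) (lift_map M T)"
    and f: "f \<in> borel_measurable M" and bound: "\<And>x. \<bar>f x\<bar> \<le> 1"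
    and orthogonal: "eigen_orthogonal M T (\<lambda>x. complex_of_real (f x))"
  shows "AE x in M. f x = 0"
proof (rule density_zero)
  show "integrable M f"
    by (rule integrable_if_abs_le_1[OF f bound])
  have "L2inner M (\<lambda>x. complex_of_real (f x)) (\<lambda>x. 1) = 0"
    using orthogonal eigenfunction_const by (simp add: eigen_orthogonal_def)
  then have "(\<integral>x. f x \<partial>M) = 0"
    by (simp add: L2inner_def)
  then have coupling: "perturbed_product M f \<in> C2 M"
    by (rule perturbed_product_in_C2[OF f bound])
  have "zpow (C2_topology M) (lift_map M T) n (M \<Otimes>\<^sub>M M) = M \<Otimes>\<^sub>M M" for n
    by (simp add: zpow_lift_map[OF pair_measure_in_C2] lift_map_pair_measure[OF mp_Tpow])
  from distal_proximal_fixed_point[OF distal _ _ this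
      eigen_orthogonal_proximal[OF f bound orthogonal coupling]]
  have "perturbed_product M f = M \<Otimes>\<^sub>M M"
    using coupling pair_measure_in_C2 by (simp only: topspace_C2_topology)
  then show "(LINT x:A|M. f x) = 0" if "A \<in> sets M" for A
    using measure_perturbed_product_Times[OF f bound that that] measure_pair_Times[OF that that] by simp
qed

end

section \<open>Almost periodic functions\<close>

definition L2_totally_bounded :: "'a measure \<Rightarrow> ('i \<Rightarrow> 'a \<Rightarrow> complex) \<Rightarrow> bool" where
  "L2_totally_bounded M F \<longleftrightarrow> (\<forall>e>0. \<exists>C. finite C \<and> (\<forall>c\<in>C. L2fun M c)
     \<and> (\<forall>i. \<exists>c\<in>C. L2norm M (\<lambda>x. F i x - c x) < e))"

lemma L2_totally_boundedE:
  assumes "L2_totally_bounded M F" "e > 0"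
  obtains C where "finite C" "\<And>c. c \<in> C \<Longrightarrow> L2fun M c" "\<And>i. \<exists>c\<in>C. L2norm M (\<lambda>x. F i x - c x) < e"
  using assms unfolding L2_totally_bounded_def by metis

lemma L2_totally_bounded_add_cmult:
  assumes F: "\<And>i. L2fun M (F i)" "L2_totally_bounded M F" and G: "\<And>i. L2fun M (G i)" "L2_totally_bounded M G"
  shows "L2_totally_bounded M (\<lambda>i x. F i x + a * G i x)"
  unfolding L2_totally_bounded_def
proof (intro allI impI)
  fix e :: real assume e: "e > 0"
  obtain d where d: "d > 0" "d * (cmod a + 1 + 1) = e"
    using obtain_scaled_epsilon[of "cmod a + 1" e] e by auto
  obtain C where C: "finite C" "\<And>c. c \<in> C \<Longrightarrow> L2fun M c" "\<And>i. \<exists>c\<in>C. L2norm M (\<lambda>x. F i x - c x) < d"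
    using L2_totally_boundedE[OF F(2) d(1)] by metis
  obtain D where D: "finite D" "\<And>c. c \<in> D \<Longrightarrow> L2fun M c" "\<And>i. \<exists>c\<in>D. L2norm M (\<lambda>x. G i x - c x) < d"
    using L2_totally_boundedE[OF G(2) d(1)] by metis
  define E where "E = (\<lambda>(c, c') x. c x + a * c' x) ` (C \<times> D)"
  have "\<exists>c\<in>E. L2norm M (\<lambda>x. F i x + a * G i x - c x) < e" for i
  proof -
    obtain c c' where c: "c \<in> C" "L2norm M (\<lambda>x. F i x - c x) < d"
      and c': "c' \<in> D" "L2norm M (\<lambda>x. G i x - c' x) < d"
      using C(3) D(3) by blast
    have "L2norm M (\<lambda>x. F i x + a * G i x - (c x + a * c' x))
        = L2norm M (\<lambda>x. (F i x - c x) + a * (G i x - c' x))"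
      by (simp add: algebra_simps)
    also have "\<dots> \<le> L2norm M (\<lambda>x. F i x - c x) + cmod a * L2norm M (\<lambda>x. G i x - c' x)"
      unfolding L2norm_cmult[symmetric]
      by (intro L2norm_triangle L2fun_diff L2fun_cmult F G C(2) D(2) c c')
    also have "\<dots> \<le> d + cmod a * d"
      using c c' by (intro add_mono mult_left_mono) auto
    also have "\<dots> < e"
      unfolding d(2)[symmetric] using d(1) by (simp add: algebra_simps)
    finally show ?thesis
      using c(1) c'(1) by (intro bexI[of _ "\<lambda>x. c x + a * c' x"]) (auto simp: E_def)
  qed
  moreover have "finite E" "\<forall>c\<in>E. L2fun M c"
    using C(1,2) D(1,2) by (auto simp: E_def intro!: L2fun_add L2fun_cmult)
  ultimately show "\<exists>C. finite C \<and> (\<forall>c\<in>C. L2fun M c) \<and> (\<forall>i. \<exists>c\<in>C. L2norm M (\<lambda>x. F i x + a * G i x - c x) < e)"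
    by blast
qed

lemma L2_totally_bounded_uniform_limit:
  assumes F: "\<And>i. L2fun M (F i)"
    and approx: "\<And>e. e > 0 \<Longrightarrow>
      \<exists>G. L2_totally_bounded M G \<and> (\<forall>i. L2fun M (G i) \<and> L2norm M (\<lambda>x. F i x - G i x) < e)"
  shows "L2_totally_bounded M F"
  unfolding L2_totally_bounded_def
proof (intro allI impI)
  fix e :: real assume "e > 0"
  then obtain G where G: "L2_totally_bounded M G" "\<And>i. L2fun M (G i)"
    "\<And>i. L2norm M (\<lambda>x. F i x - G i x) < e / 2"
    using approx[of "e / 2"] by auto
  obtain C where C: "finite C" "\<And>c. c \<in> C \<Longrightarrow> L2fun M c" "\<And>i. \<exists>c\<in>C. L2norm M (\<lambda>x. G i x - c x) < e / 2"
    using L2_totally_boundedE[OF G(1), of "e / 2"] \<open>e > 0\<close> by (metis half_gt_zero)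
  have "\<exists>c\<in>C. L2norm M (\<lambda>x. F i x - c x) < e" for i
  proof -
    obtain c where "c \<in> C" "L2norm M (\<lambda>x. G i x - c x) < e / 2"
      using C(3) by blast
    then show ?thesis
      using L2norm_diff_triangle[OF F[of i] G(2)[of i] C(2)[of c]] G(3)[of i] by (intro bexI[of _ c]) auto
  qed
  with C(1,2) show "\<exists>C. finite C \<and> (\<forall>c\<in>C. L2fun M c) \<and> (\<forall>i. \<exists>c\<in>C. L2norm M (\<lambda>x. F i x - c x) < e)"
    by blast
qed

lemma L2_totally_bounded_contraction:
  assumes F: "\<And>i. L2fun M (F i)" "L2_totally_bounded M F"
    and \<phi>: "\<And>g. L2fun M g \<Longrightarrow> L2fun M (\<lambda>x. \<phi> (g x))" and contraction: "\<And>a b. cmod (\<phi> a - \<phi> b) \<le> cmod (a - b)"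
  shows "L2_totally_bounded M (\<lambda>i x. \<phi> (F i x))"
  unfolding L2_totally_bounded_def
proof (intro allI impI)
  fix e :: real assume "e > 0"
  then obtain C where C: "finite C" "\<And>c. c \<in> C \<Longrightarrow> L2fun M c" "\<And>i. \<exists>c\<in>C. L2norm M (\<lambda>x. F i x - c x) < e"
    using L2_totally_boundedE[OF F(2)] by metis
  have "\<exists>c\<in>(\<lambda>c x. \<phi> (c x)) ` C. L2norm M (\<lambda>x. \<phi> (F i x) - c x) < e" for i
  proof -
    obtain c where c: "c \<in> C" "L2norm M (\<lambda>x. F i x - c x) < e"
      using C(3) by blast
    have "L2norm M (\<lambda>x. \<phi> (F i x) - \<phi> (c x)) \<le> L2norm M (\<lambda>x. F i x - c x)"
      by (intro L2norm_mono L2fun_measurable L2fun_diff \<phi> F(1) C(2)[OF c(1)] contraction)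
    with c show ?thesis
      by (intro bexI[of _ "\<lambda>x. \<phi> (c x)"]) auto
  qed
  moreover have "\<forall>c\<in>(\<lambda>c x. \<phi> (c x)) ` C. L2fun M c"
    using C(2) \<phi> by auto
  ultimately show "\<exists>C. finite C \<and> (\<forall>c\<in>C. L2fun M c) \<and> (\<forall>i. \<exists>c\<in>C. L2norm M (\<lambda>x. \<phi> (F i x) - c x) < e)"
    using C(1) by (intro exI[of _ "(\<lambda>c x. \<phi> (c x)) ` C"]) auto
qed

lemma L2_totally_bounded_multiples:
  assumes g: "L2fun M g" and a: "\<And>i. cmod (a i) \<le> B"
  shows "L2_totally_bounded M (\<lambda>i x. a i * g x)"
  unfolding L2_totally_bounded_def
proof (intro allI impI)
  fix e :: real assume e: "e > 0"
  obtain d where d: "d > 0" "d * (L2norm M g + 1) = e"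
    using obtain_scaled_epsilon[of "L2norm M g" e] e by auto
  obtain D where D: "finite D" "cball (0::complex) B \<subseteq> (\<Union>z\<in>D. ball z d)"
  proof (rule compactE_image[OF compact_cball open_ball])
    show "cball (0::complex) B \<subseteq> (\<Union>z\<in>UNIV. ball z d)"
      using d(1) centre_in_ball by blast
  qed
  have "\<exists>c\<in>(\<lambda>z x. z * g x) ` D. L2norm M (\<lambda>x. a i * g x - c x) < e" for i
  proof -
    have "a i \<in> cball 0 B"
      using a by simp
    then obtain z where z: "z \<in> D" "cmod (a i - z) < d"
      using D(2) by (auto simp: dist_norm norm_minus_commute)
    have "L2norm M (\<lambda>x. a i * g x - z * g x) = cmod (a i - z) * L2norm M g"
      unfolding L2norm_cmult[symmetric] by (simp add: left_diff_distrib)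
    also have "\<dots> \<le> d * L2norm M g"
      using z(2) by (intro mult_right_mono) auto
    also have "\<dots> < e"
      unfolding d(2)[symmetric] using d(1) by (simp add: algebra_simps)
    finally show ?thesis
      using z(1) by (intro bexI[of _ "\<lambda>x. z * g x"]) auto
  qed
  then show "\<exists>C. finite C \<and> (\<forall>c\<in>C. L2fun M c) \<and> (\<forall>i. \<exists>c\<in>C. L2norm M (\<lambda>x. a i * g x - c x) < e)"
    using D(1) g by (intro exI[of _ "(\<lambda>z x. z * g x) ` D"]) (auto intro: L2fun_cmult)
qed

lemma L2_totally_bounded_finite_index_net:
  assumes F: "\<And>i. L2fun M (F i)" "L2_totally_bounded M F" and e: "e > 0"
  obtains J where "finite J" "\<And>i. \<exists>j\<in>J. L2norm M (\<lambda>x. F i x - F j x) < e"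
proof -
  obtain C where C: "finite C" "\<And>c. c \<in> C \<Longrightarrow> L2fun M c" "\<And>i. \<exists>c\<in>C. L2norm M (\<lambda>x. F i x - c x) < e / 2"
    using L2_totally_boundedE[OF F(2), of "e / 2"] e by (metis half_gt_zero)
  define index where "index c = (SOME i. L2norm M (\<lambda>x. F i x - c x) < e / 2)" for c
  have "\<exists>j\<in>index ` C. L2norm M (\<lambda>x. F i x - F j x) < e" for i
  proof -
    obtain c where c: "c \<in> C" "L2norm M (\<lambda>x. F i x - c x) < e / 2"
      using C(3) by blast
    have "L2norm M (\<lambda>x. F (index c) x - c x) < e / 2"
      unfolding index_def by (rule someI[of "\<lambda>j. L2norm M (\<lambda>x. F j x - c x) < e / 2"]) (rule c(2))
    then have "L2norm M (\<lambda>x. F i x - F (index c) x) < e"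
      using L2norm_diff_triangle[OF F(1)[of i] C(2)[OF c(1)] F(1)[of "index c"]] c(2)
        L2norm_minus_commute[of M c "F (index c)"] by simp
    then show ?thesis
      using c(1) by blast
  qed
  then show thesis
    using that C(1) by blast
qed

context mp_automorphism begin

definition almost_periodic :: "('a \<Rightarrow> complex) \<Rightarrow> bool" where
  "almost_periodic f \<longleftrightarrow> L2fun M f \<and> L2_totally_bounded M (\<lambda>n x. f (Tpow n x))"

lemma L2fun_Tpow: "L2fun M f \<Longrightarrow> L2fun M (\<lambda>x. f (Tpow n x))"
  by (rule L2fun_mp_map[OF mp_Tpow])

lemma almost_periodic_L2fun: "almost_periodic f \<Longrightarrow> L2fun M f"
  by (simp add: almost_periodic_def)

lemma almost_periodic_totally_bounded: "almost_periodic f \<Longrightarrow> L2_totally_bounded M (\<lambda>n x. f (Tpow n x))"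
  by (simp add: almost_periodic_def)

lemma L2_subspace_almost_periodic: "L2_subspace M {f. almost_periodic f}"
  unfolding L2_subspace_def
proof (intro conjI ballI allI)
  show "(\<lambda>x. 0) \<in> {f. almost_periodic f}"
    using L2_totally_bounded_multiples[OF L2fun_zero, of "\<lambda>_. 0" 0]
    by (simp add: almost_periodic_def L2fun_zero)
  show "(\<lambda>x. f x + c * g x) \<in> {f. almost_periodic f}"
    if "f \<in> {f. almost_periodic f}" "g \<in> {f. almost_periodic f}" for f g c
    using that L2_totally_bounded_add_cmult[of M "\<lambda>n x. f (Tpow n x)" "\<lambda>n x. g (Tpow n x)" c]
    by (simp add: almost_periodic_def L2fun_Tpow L2fun_add L2fun_cmult)
qed (simp add: almost_periodic_L2fun)

lemma almost_periodic_L2_closure: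
  assumes p: "p \<in> L2_closure M {f. almost_periodic f}"
  shows "almost_periodic p"
  unfolding almost_periodic_def
proof
  show pL2: "L2fun M p"
    by (rule L2_closure_L2fun[OF p])
  show "L2_totally_bounded M (\<lambda>n x. p (Tpow n x))"
  proof (rule L2_totally_bounded_uniform_limit[OF L2fun_Tpow[OF pL2]])
    fix e :: real assume "e > 0"
    then obtain s where s: "almost_periodic s" "L2norm M (\<lambda>x. p x - s x) < e"
      using L2_closureE[OF p] by blast
    note sL2 = almost_periodic_L2fun[OF s(1)]
    have "L2norm M (\<lambda>x. p (Tpow n x) - s (Tpow n x)) < e" for n
      using s(2) L2norm_mp_map[OF mp_Tpow L2fun_diff[OF pL2 sL2]] by simp
    then show "\<exists>G. L2_totally_bounded M G \<and> (\<forall>n. L2fun M (G n) \<and> L2norm M (\<lambda>x. p (Tpow n x) - G n x) < e)"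
      using s(1) L2fun_Tpow[OF sL2] by (intro exI[of _ "\<lambda>n x. s (Tpow n x)"]) (auto simp: almost_periodic_def)
  qed
qed

lemma almost_periodic_contraction:
  assumes f: "almost_periodic f" and contraction: "\<And>a b. cmod (\<phi> a - \<phi> b) \<le> cmod (a - b)" and zero: "\<phi> 0 = 0"
  shows "almost_periodic (\<lambda>x. \<phi> (f x))"
proof -
  have "continuous_on UNIV \<phi>"
    by (rule lipschitz_on_continuous_on[of 1]) (auto intro!: lipschitz_onI simp: dist_norm contraction)
  then have [measurable]: "\<phi> \<in> borel_measurable borel"
    by (rule borel_measurable_continuous_onI)
  have \<phi>: "L2fun M (\<lambda>x. \<phi> (g x))" if g [measurable]: "L2fun M g" for g
    by (rule L2fun_dominated[OF g]) (measurable, use contraction[of _ 0] zero in simp)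
  show ?thesis
    using f L2_totally_bounded_contraction[of M "\<lambda>n x. f (Tpow n x)" \<phi>] \<phi> contraction
    by (simp add: almost_periodic_def L2fun_Tpow)
qed

lemma eigenfunction_iterate:
  assumes R: "mp_map M R" and eigen: "AE x in M. g (R x) = c * g x"
  shows "AE x in M. g ((R ^^ n) x) = (c::complex) ^ n * g x"
proof (induction n)
  case (Suc n)
  show ?case
    using AE_mp_map[OF mp_map_funpow[OF R, of n] eigen] Suc by eventually_elim (simp add: mult.assoc)
qed simp

lemma eigenvalue_norm_1:
  assumes g: "eigenfunction M T g" and c: "AE x in M. g (T x) = c * g x"
  shows "cmod c = 1"
proof -
  have gL2: "L2fun M g" and nonzero: "\<not> (AE x in M. g x = 0)"
    using g by (auto simp: eigenfunction_def)
  have "L2norm M g = L2norm M (\<lambda>x. g (T x))"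
    by (rule L2norm_mp_map[OF mp_T gL2, symmetric])
  also have "\<dots> = L2norm M (\<lambda>x. c * g x)"
    by (intro L2norm_cong_AE c L2fun_measurable L2fun_cmult L2fun_mp_map[OF mp_T] gL2)
  finally show ?thesis
    using nonzero L2norm_eq_0_iff[OF gL2] by (simp add: L2norm_cmult)
qed

lemma eigenfunction_Tpow:
  assumes g: "eigenfunction M T g"
  obtains d where "cmod d = 1" "AE x in M. g (Tpow n x) = d * g x"
proof -
  obtain c where c: "AE x in M. g (T x) = c * g x"
    using g by (auto simp: eigenfunction_def)
  have norm_c: "cmod c = 1"
    by (rule eigenvalue_norm_1[OF g c])
  show thesis
  proof (cases "0 \<le> n")
    case True
    then show ?thesis
      using that[of "c ^ nat n"] eigenfunction_iterate[OF mp_T c] norm_c by (simp add: Tpow_def norm_power)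
  next
    case False
    have "AE x in M. g (Tinv x) = inverse c * g x"
      using AE_mp_map[OF mp_Tinv c] AE_space
    proof eventually_elim
      case (elim x)
      then show ?case
        using norm_c by (auto simp: T_Tinv field_simps)
    qed
    from eigenfunction_iterate[OF mp_Tinv this, of "nat (- n)"] show ?thesis
      using that[of "inverse c ^ nat (- n)"] False norm_c by (simp add: Tpow_def norm_power norm_inverse)
  qed
qed

lemma almost_periodic_eigenfunction:
  assumes g: "eigenfunction M T g"
  shows "almost_periodic g"
  unfolding almost_periodic_def
proof
  show gL2: "L2fun M g"
    using g by (simp add: eigenfunction_def)
  have "\<exists>d. cmod d = 1 \<and> (AE x in M. g (Tpow n x) = d * g x)" for n
    using eigenfunction_Tpow[OF g] by metis
  then obtain d where d: "\<And>n. cmod (d n) = 1" "\<And>n. AE x in M. g (Tpow n x) = d n * g x"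
    by metis
  show "L2_totally_bounded M (\<lambda>n x. g (Tpow n x))"
  proof (rule L2_totally_bounded_uniform_limit[OF L2fun_Tpow[OF gL2]])
    fix e :: real assume "e > 0"
    have "AE x in M. g (Tpow n x) - d n * g x = 0" for n
      using d(2) by simp
    then have "L2norm M (\<lambda>x. g (Tpow n x) - d n * g x) = 0" for n
      using L2norm_eq_0_iff[OF L2fun_diff[OF L2fun_Tpow[OF gL2] L2fun_cmult[OF gL2]]] by blast
    then show "\<exists>G. L2_totally_bounded M G \<and> (\<forall>n. L2fun M (G n) \<and> L2norm M (\<lambda>x. g (Tpow n x) - G n x) < e)"
      using L2_totally_bounded_multiples[OF gL2, of d 1] d(1) L2fun_cmult[OF gL2] \<open>e > 0\<close>
      by (intro exI[of _ "\<lambda>n x. d n * g x"]) auto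
  qed
qed

lemma eigen_orthogonal_almost_periodic:
  assumes r: "eigen_orthogonal M T r" and g: "almost_periodic g"
  shows "L2inner M r g = 0"
proof (rule ccontr)
  assume nonzero: "L2inner M r g \<noteq> 0"
  note rL2 = eigen_orthogonal_L2fun[OF r] and gL2 = almost_periodic_L2fun[OF g]
  obtain e where e: "e > 0" "e * (L2norm M r + 1) = cmod (L2inner M r g)"
    using obtain_scaled_epsilon[of "L2norm M r" "cmod (L2inner M r g)"] nonzero by auto
  obtain C where C: "finite C" "\<And>c. c \<in> C \<Longrightarrow> L2fun M c" "\<And>n. \<exists>c\<in>C. L2norm M (\<lambda>x. g (Tpow n x) - c x) < e"
    using L2_totally_boundedE[OF almost_periodic_totally_bounded[OF g] e(1)] by metis
  obtain n where "\<forall>c\<in>C. cmod (L2inner M (\<lambda>x. r ((T ^^ n) x)) c) < e"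
    using eigen_orthogonal_small_correlations[OF mp_T r e(1) C(1,2)] ..
  then have n: "\<And>c. c \<in> C \<Longrightarrow> cmod (L2inner M (\<lambda>x. r (Tpow (int n) x)) c) < e"
    by (simp add: Tpow_def)
  let ?r = "\<lambda>x. r (Tpow (int n) x)" and ?g = "\<lambda>x. g (Tpow (int n) x)"
  have rn: "L2fun M ?r" and gn: "L2fun M ?g"
    by (intro L2fun_Tpow rL2 gL2)+
  obtain c where c: "c \<in> C" "L2norm M (\<lambda>x. ?g x - c x) < e"
    using C(3) by blast
  have "L2inner M r g = L2inner M ?r ?g"
    by (rule L2inner_mp_map[OF mp_Tpow rL2 gL2, symmetric])
  also have "\<dots> = L2inner M ?r (\<lambda>x. ?g x - c x) + L2inner M ?r c"
    by (simp add: L2inner_diff_right[OF rn gn C(2)[OF c(1)]])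
  finally have "cmod (L2inner M r g) \<le> cmod (L2inner M ?r (\<lambda>x. ?g x - c x)) + cmod (L2inner M ?r c)"
    by (simp add: norm_triangle_ineq)
  also have "\<dots> < L2norm M ?r * L2norm M (\<lambda>x. ?g x - c x) + e"
    by (intro add_le_less_mono L2_Cauchy_Schwarz L2fun_diff rn gn C(2) n c)
  also have "\<dots> \<le> L2norm M r * e + e"
    using c(2) by (intro add_right_mono mult_mono) (auto simp: L2norm_mp_map[OF mp_Tpow rL2])
  also have "\<dots> = cmod (L2inner M r g)"
    unfolding e(2)[symmetric] by (simp add: algebra_simps)
  finally show False
    by simp
qed

definition clip :: "complex \<Rightarrow> complex" where
  "clip z = of_real (max 0 (min 1 (Re z)))"

lemma clip_contraction: "cmod (clip a - clip b) \<le> cmod (a - b)"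
proof -
  have "cmod (clip a - clip b) = \<bar>max 0 (min 1 (Re a)) - max 0 (min 1 (Re b))\<bar>"
    unfolding clip_def of_real_diff[symmetric] by (rule norm_of_real)
  also have "\<dots> \<le> \<bar>Re (a - b)\<bar>"
    by auto
  also have "\<dots> \<le> cmod (a - b)"
    by (rule abs_Re_le_cmod)
  finally show ?thesis .
qed

text \<open>Truncating the best almost periodic approximation to the unit interval does not increase its distance
  from the indicator function, so by uniqueness it changes nothing.\<close>

lemma indicator_minus_clip_eigen_orthogonal:
  assumes A: "A \<in> sets M"
  obtains p where "L2fun M p" "almost_periodic (\<lambda>x. clip (p x))"
    "eigen_orthogonal M T (\<lambda>x. indicator A x - clip (p x))"
proof -
  let ?f = "\<lambda>x. indicator A x :: complex" and ?AP = "{f. almost_periodic f}"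
  note fL2 = L2fun_indicator[OF A]
  obtain p where p: "p \<in> L2_closure M ?AP" and perp: "\<And>g. g \<in> ?AP \<Longrightarrow> L2inner M (\<lambda>x. ?f x - p x) g = 0"
    using L2_projection[OF fL2 L2_subspace_almost_periodic] by blast
  let ?q = "\<lambda>x. clip (p x)"
  have q: "almost_periodic ?q"
    by (rule almost_periodic_contraction[OF almost_periodic_L2_closure[OF p] clip_contraction])
      (simp add: clip_def)
  note pL2 = L2_closure_L2fun[OF p] and qL2 = almost_periodic_L2fun[OF q]
  have fp: "L2fun M (\<lambda>x. ?f x - p x)" and pq: "L2fun M (\<lambda>x. p x - ?q x)" and fq: "L2fun M (\<lambda>x. ?f x - ?q x)"
    by (intro L2fun_diff fL2 pL2 qL2)+
  have "cmod (?f x - ?q x) \<le> cmod (?f x - p x)" for x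
    using clip_contraction[of "?f x" "p x"] by (simp add: clip_def indicator_def split: if_splits)
  then have "L2norm M (\<lambda>x. ?f x - ?q x) \<le> L2norm M (\<lambda>x. ?f x - p x)"
    by (intro L2norm_mono fp L2fun_measurable fq)
  then have "L2norm M (\<lambda>x. p x - ?q x) = 0"
    using q by (intro L2_projection_unique[OF fL2 L2_subspace_almost_periodic p _ perp]) auto
  then have pq_zero: "AE x in M. p x - ?q x = 0"
    by (simp only: L2norm_eq_0_iff[OF pq])
  have "L2inner M (\<lambda>x. ?f x - ?q x) g = 0" if "eigenfunction M T g" for g
  proof -
    have g: "almost_periodic g"
      by (rule almost_periodic_eigenfunction[OF that])
    have "L2inner M (\<lambda>x. (?f x - p x) + (p x - ?q x)) g
        = L2inner M (\<lambda>x. ?f x - p x) g + L2inner M (\<lambda>x. p x - ?q x) g"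
      by (rule L2inner_add_left[OF fp pq almost_periodic_L2fun[OF g]])
    then show ?thesis
      using perp g L2inner_eq_0_if_AE[OF pq_zero] by simp
  qed
  then show thesis
    using that[OF pL2 q] fq by (simp add: eigen_orthogonal_def)
qed

theorem distal_almost_periodic_indicator:
  assumes distal: "distal (C2_topology M) (lift_map M T)" and A [measurable]: "A \<in> sets M"
  shows "almost_periodic (\<lambda>x. indicator A x)"
proof (rule almost_periodic_L2_closure)
  obtain p where p [measurable]: "L2fun M p" and q: "almost_periodic (\<lambda>x. clip (p x))"
    and orthogonal: "eigen_orthogonal M T (\<lambda>x. indicator A x - clip (p x))"
    by (rule indicator_minus_clip_eigen_orthogonal[OF A])
  define r where "r x = indicator A x - max 0 (min 1 (Re (p x)))" for x
  have r: "(\<lambda>x. indicator A x - clip (p x)) = (\<lambda>x. complex_of_real (r x))"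
    by (auto simp: r_def clip_def indicator_def)
  have "AE x in M. r x = 0"
  proof (rule distal_eigen_orthogonal_eq_0[OF distal])
    show "r \<in> borel_measurable M"
      unfolding r_def by measurable
    show "\<bar>r x\<bar> \<le> 1" for x
      by (auto simp: r_def indicator_def)
  qed (use orthogonal in \<open>simp only: r\<close>)
  then have "AE x in M. indicator A x - clip (p x) = 0"
    unfolding fun_cong[OF r] by simp
  then have "L2norm M (\<lambda>x. indicator A x - clip (p x)) = 0"
    by (simp only: L2norm_eq_0_iff[OF eigen_orthogonal_L2fun[OF orthogonal]])
  then show "(\<lambda>x. indicator A x) \<in> L2_closure M {f. almost_periodic f}"
    using q L2fun_indicator[OF A] by (auto simp: L2_closure_def intro!: exI[of _ "\<lambda>x. clip (p x)"])
qed

end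

section \<open>Discrete spectrum\<close>

definition eigen_span :: "'a measure \<Rightarrow> ('a \<Rightarrow> 'a) \<Rightarrow> ('a \<Rightarrow> complex) set" where
  "eigen_span M T = {\<lambda>x. \<Sum>f\<in>F. c f * f x | F c. finite F \<and> (\<forall>f\<in>F. eigenfunction M T f)}"

lemma eigen_spanI:
  assumes "finite F" "\<forall>f\<in>F. eigenfunction M T f" "\<And>x. s x = (\<Sum>f\<in>F. c f * f x)"
  shows "s \<in> eigen_span M T"
proof -
  have "s = (\<lambda>x. \<Sum>f\<in>F. c f * f x)"
    using assms(3) by auto
  then show ?thesis
    using assms(1,2) unfolding eigen_span_def mem_Collect_eq by blast
qed

lemma eigen_spanE:
  assumes "s \<in> eigen_span M T"
  obtains F c where "finite F" "\<forall>f\<in>F. eigenfunction M T f" "s = (\<lambda>x. \<Sum>f\<in>F. c f * f x)"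
  using assms unfolding eigen_span_def mem_Collect_eq by blast

lemma L2_subspace_eigen_span: "L2_subspace M (eigen_span M T)"
  unfolding L2_subspace_def
proof (intro conjI ballI allI)
  show "(\<lambda>x. 0) \<in> eigen_span M T"
    by (rule eigen_spanI[of "{}"]) auto
next
  fix s assume "s \<in> eigen_span M T"
  then show "L2fun M s"
    by (elim eigen_spanE) (auto simp: eigenfunction_def intro!: L2fun_sum L2fun_cmult)
next
  fix s t a assume s_span: "s \<in> eigen_span M T" and t_span: "t \<in> eigen_span M T"
  obtain F c where F: "finite F" "\<forall>f\<in>F. eigenfunction M T f" and s: "s = (\<lambda>x. \<Sum>f\<in>F. c f * f x)"
    by (rule eigen_spanE[OF s_span])
  obtain G d where G: "finite G" "\<forall>f\<in>G. eigenfunction M T f" and t: "t = (\<lambda>x. \<Sum>f\<in>G. d f * f x)"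
    by (rule eigen_spanE[OF t_span])
  let ?c = "\<lambda>f. if f \<in> F then c f else 0" and ?d = "\<lambda>f. if f \<in> G then d f else 0"
  have "s x + a * t x = (\<Sum>f\<in>F \<union> G. (?c f + a * ?d f) * f x)" for x
  proof -
    have "s x = (\<Sum>f\<in>F \<union> G. ?c f * f x)" "t x = (\<Sum>f\<in>F \<union> G. ?d f * f x)"
      unfolding s t by (rule sum.mono_neutral_cong_left; use F G in auto)+
    then show ?thesis
      by (simp only: distrib_right sum.distrib sum_distrib_left mult.assoc)
  qed
  then show "(\<lambda>x. s x + a * t x) \<in> eigen_span M T"
    using F G by (intro eigen_spanI[of "F \<union> G"]) auto
qed

lemma discrete_spectrumI:
  assumes "\<And>g. L2fun M g \<Longrightarrow> g \<in> L2_closure M (eigen_span M T)"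
  shows "discrete_spectrum M T"
  unfolding discrete_spectrum_def
proof (intro allI impI)
  fix g and e :: real assume "L2fun M g" "e > 0"
  then obtain s where s: "s \<in> eigen_span M T" "L2norm M (\<lambda>x. g x - s x) < sqrt e"
    using L2_closureE[OF assms, of g "sqrt e"] by auto
  then have "(\<integral>x. (cmod (g x - s x))\<^sup>2 \<partial>M) < e"
    by (simp add: L2norm_def)
  with s(1) show "\<exists>F c. finite F \<and> (\<forall>f\<in>F. eigenfunction M T f)
      \<and> (\<integral>x. (cmod (g x - (\<Sum>f\<in>F. c f * f x)))\<^sup>2 \<partial>M) < e"
    by (elim eigen_spanE) blast
qed

theorem (in mp_automorphism) discrete_spectrum_if_almost_periodic_indicators:
  assumes ap: "\<And>A. A \<in> sets M \<Longrightarrow> almost_periodic (\<lambda>x. indicator A x)"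
  shows "discrete_spectrum M T"
proof (intro discrete_spectrumI L2_closureI_orthogonal L2_subspace_eigen_span)
  fix g r assume r: "L2fun M r" "\<And>s. s \<in> eigen_span M T \<Longrightarrow> L2inner M r s = 0"
  have "L2inner M r u = 0" if "eigenfunction M T u" for u
    using that by (intro r(2) eigen_spanI[of "{u}" _ _ _ "\<lambda>_. 1"]) auto
  then have "eigen_orthogonal M T r"
    using r(1) by (simp add: eigen_orthogonal_def)
  then have "AE x in M. r x = 0"
    by (intro AE_eq_0_if_orthogonal_indicators r(1) eigen_orthogonal_almost_periodic ap)
  then show "L2inner M r g = 0"
    by (rule L2inner_eq_0_if_AE)
qed

section \<open>Equicontinuity\<close>

lemma (in Metric_space) uniformly_continuous_finite_family:
  fixes \<phi> :: "'i \<Rightarrow> 'a \<Rightarrow> real"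
  assumes compact: "compact_space mtopology" and P: "finite P"
    and continuous: "\<And>i. i \<in> P \<Longrightarrow> continuous_map mtopology euclideanreal (\<phi> i)" and e: "e > 0"
  shows "\<exists>\<delta>>0. \<forall>z\<in>M. \<forall>w\<in>M. d z w < \<delta> \<longrightarrow> (\<forall>i\<in>P. \<bar>\<phi> i z - \<phi> i w\<bar> < e)"
proof -
  have "\<exists>\<delta>>0. \<forall>z\<in>M. \<forall>w\<in>M. d z w < \<delta> \<longrightarrow> \<bar>\<phi> i z - \<phi> i w\<bar> < e" if "i \<in> P" for i
  proof -
    have "uniformly_continuous_map (metric (M, d)) euclidean_metric (\<phi> i)"
      using compact continuous[OF that] by (intro continuous_imp_uniformly_continuous_map) simp
    then show ?thesis
      using e by (fastforce simp: uniformly_continuous_map_def dist_real_def abs_minus_commute commute)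
  qed
  then obtain \<delta> where \<delta>: "\<And>i. i \<in> P \<Longrightarrow> \<delta> i > 0"
    "\<And>i z w. i \<in> P \<Longrightarrow> z \<in> M \<Longrightarrow> w \<in> M \<Longrightarrow> d z w < \<delta> i \<Longrightarrow> \<bar>\<phi> i z - \<phi> i w\<bar> < e"
    by metis
  show ?thesis
    by (rule exI[of _ "Min (insert 1 (\<delta> ` P))"]) (use P \<delta> in auto)
qed

lemma (in Metric_space) compact_convergent_subsequence_pair:
  fixes a b :: "nat \<Rightarrow> 'a"
  assumes compact: "compact_space mtopology" and M: "\<And>k. a k \<in> M" "\<And>k. b k \<in> M"
  obtains u v t where "u \<in> M" "v \<in> M" "strict_mono t"
    "limitin mtopology (a \<circ> t) u sequentially" "limitin mtopology (b \<circ> t) v sequentially"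
proof -
  have subsequence: "\<exists>l r. l \<in> M \<and> strict_mono r \<and> limitin mtopology (c \<circ> r) l sequentially"
    if "range c \<subseteq> M" for c :: "nat \<Rightarrow> 'a"
    using compact that by (simp add: compact_space_sequentially)
  obtain u r where u: "u \<in> M" "strict_mono r" "limitin mtopology (a \<circ> r) u sequentially"
    using subsequence[of a] M(1) by blast
  obtain v s where v: "v \<in> M" "strict_mono s" "limitin mtopology ((b \<circ> r) \<circ> s) v sequentially"
    using subsequence[of "b \<circ> r"] M(2) by auto
  show thesis
  proof (rule that[of u v "r \<circ> s"])
    show "strict_mono (r \<circ> s)"
      by (rule strict_mono_o[OF u(2) v(2)])
    show "limitin mtopology (a \<circ> (r \<circ> s)) u sequentially"
      using limitin_subsequence[OF v(2) u(3)] by (simp add: o_assoc)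
  qed (use u v in \<open>simp_all add: o_assoc\<close>)
qed

lemma (in Metric_space) uniformly_equicontinuous_diff_tendsto_0:
  fixes g :: "'n \<Rightarrow> 'a \<Rightarrow> real" and z w :: "nat \<Rightarrow> 'a"
  assumes equicontinuous: "\<And>e. e > 0 \<Longrightarrow> \<exists>\<delta>>0. \<forall>z\<in>M. \<forall>w\<in>M. d z w < \<delta> \<longrightarrow> (\<forall>n. \<bar>g n z - g n w\<bar> < e)"
    and M: "\<And>k. z k \<in> M" "\<And>k. w k \<in> M" and near: "(\<lambda>k. d (z k) (w k)) \<longlonglongrightarrow> 0"
  shows "(\<lambda>k. g (n k) (z k) - g (n k) (w k)) \<longlonglongrightarrow> 0"
proof (rule tendstoI)
  fix e :: real assume "e > 0"
  then obtain \<delta> where \<delta>: "\<delta> > 0" "\<forall>z\<in>M. \<forall>w\<in>M. d z w < \<delta> \<longrightarrow> (\<forall>n. \<bar>g n z - g n w\<bar> < e)"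
    using equicontinuous by blast
  have "\<forall>\<^sub>F k in sequentially. d (z k) (w k) < \<delta>"
    by (rule order_tendstoD(2)[OF near \<delta>(1)])
  then show "\<forall>\<^sub>F k in sequentially. dist (g (n k) (z k) - g (n k) (w k)) 0 < e"
    by eventually_elim (use \<delta>(2) M in \<open>simp add: dist_real_def\<close>)
qed

lemma (in Metric_space) equicontinuous_sequentiallyI:
  fixes R :: "'n \<Rightarrow> 'a \<Rightarrow> 'a"
  assumes subsequence: "\<And>z w n. (\<And>k. z k \<in> M) \<Longrightarrow> (\<And>k. w k \<in> M) \<Longrightarrow> (\<lambda>k. d (z k) (w k)) \<longlonglongrightarrow> 0 \<Longrightarrow>
      \<exists>t::nat \<Rightarrow> nat. (\<lambda>k. d (R (n (t k)) (z (t k))) (R (n (t k)) (w (t k)))) \<longlonglongrightarrow> 0"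
    and e: "e > 0"
  shows "\<exists>\<delta>>0. \<forall>z\<in>M. \<forall>w\<in>M. d z w < \<delta> \<longrightarrow> (\<forall>n. d (R n z) (R n w) < e)"
proof (rule ccontr)
  assume "\<not> ?thesis"
  then have "\<exists>z w n. z \<in> M \<and> w \<in> M \<and> d z w < inverse (real (Suc k)) \<and> e \<le> d (R n z) (R n w)" for k
    by (metis inverse_positive_iff_positive not_le of_nat_0_less_iff zero_less_Suc)
  then obtain z w n where zw: "\<And>k. z k \<in> M" "\<And>k. w k \<in> M"
    and near: "\<And>k. d (z k) (w k) < inverse (real (Suc k))"
    and far: "\<And>k. e \<le> d (R (n k) (z k)) (R (n k) (w k))"
    by metis
  have "(\<lambda>k. d (z k) (w k)) \<longlonglongrightarrow> 0"
    by (rule tendsto_sandwich[OF _ _ tendsto_const LIMSEQ_inverse_real_of_nat])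
      (use near in \<open>auto intro!: always_eventually less_imp_le\<close>)
  then obtain t :: "nat \<Rightarrow> nat" where "(\<lambda>k. d (R (n (t k)) (z (t k))) (R (n (t k)) (w (t k)))) \<longlonglongrightarrow> 0"
    using subsequence[of z w n] zw by blast
  then have "e \<le> 0"
    by (rule LIMSEQ_le_const) (use far in blast)
  then show False
    using e by simp
qed

lemma (in Metric_space) equicontinuous_if_separating_family:
  fixes R :: "'n \<Rightarrow> 'a \<Rightarrow> 'a" and \<phi> :: "'i \<Rightarrow> 'a \<Rightarrow> real"
  assumes compact: "compact_space mtopology" and R: "\<And>n z. z \<in> M \<Longrightarrow> R n z \<in> M"
    and continuous: "\<And>i. i \<in> I \<Longrightarrow> continuous_map mtopology euclideanreal (\<phi> i)"
    and separating: "\<And>z w. z \<in> M \<Longrightarrow> w \<in> M \<Longrightarrow> (\<And>i. i \<in> I \<Longrightarrow> \<phi> i z = \<phi> i w) \<Longrightarrow> z = w"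
    and equicontinuous: "\<And>i e. i \<in> I \<Longrightarrow> e > 0 \<Longrightarrow>
      \<exists>\<delta>>0. \<forall>z\<in>M. \<forall>w\<in>M. d z w < \<delta> \<longrightarrow> (\<forall>n. \<bar>\<phi> i (R n z) - \<phi> i (R n w)\<bar> < e)"
    and e: "e > 0"
  shows "\<exists>\<delta>>0. \<forall>z\<in>M. \<forall>w\<in>M. d z w < \<delta> \<longrightarrow> (\<forall>n. d (R n z) (R n w) < e)"
proof (rule equicontinuous_sequentiallyI[OF _ e])
  fix z w :: "nat \<Rightarrow> 'a" and n :: "nat \<Rightarrow> 'n"
  assume zw: "\<And>k. z k \<in> M" "\<And>k. w k \<in> M" and near: "(\<lambda>k. d (z k) (w k)) \<longlonglongrightarrow> 0"
  define Rz Rw where "Rz k = R (n k) (z k)" and "Rw k = R (n k) (w k)" for k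
  have RM: "Rz k \<in> M" "Rw k \<in> M" for k
    by (simp_all add: Rz_def Rw_def R zw)
  obtain u v t where u: "u \<in> M" and v: "v \<in> M" and t: "strict_mono t"
    and lim_u: "limitin mtopology (Rz \<circ> t) u sequentially"
    and lim_v: "limitin mtopology (Rw \<circ> t) v sequentially"
    by (rule compact_convergent_subsequence_pair[OF compact RM])
  have "u = v"
  proof (rule separating[OF u v])
    fix i assume i: "i \<in> I"
    have "(\<lambda>k. \<phi> i (Rz k) - \<phi> i (Rw k)) \<longlonglongrightarrow> 0"
      unfolding Rz_def Rw_def
      by (rule uniformly_equicontinuous_diff_tendsto_0[OF equicontinuous[OF i] zw near])
    from LIMSEQ_subseq_LIMSEQ[OF this t]
    have "(\<lambda>k. \<phi> i (Rz (t k)) - \<phi> i (Rw (t k))) \<longlonglongrightarrow> 0"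
      by (simp add: comp_def)
    moreover have "(\<lambda>k. \<phi> i (Rz (t k)) - \<phi> i (Rw (t k))) \<longlonglongrightarrow> \<phi> i u - \<phi> i v"
      using continuous_map_limit[OF continuous[OF i] lim_u] continuous_map_limit[OF continuous[OF i] lim_v]
      by (intro tendsto_diff) (auto simp: comp_def)
    ultimately show "\<phi> i u = \<phi> i v"
      using LIMSEQ_unique by fastforce
  qed
  have "(\<lambda>k. d (Rz (t k)) (Rw (t k))) \<longlonglongrightarrow> 0"
  proof (rule tendsto_sandwich[OF _ _ tendsto_const])
    show "(\<lambda>k. d (Rz (t k)) u + d (Rw (t k)) u) \<longlonglongrightarrow> 0"
      using lim_u lim_v \<open>u = v\<close> by (intro tendsto_add_zero) (simp_all add: limitin_metric_dist_null comp_def)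
  qed (use triangle'[OF RM(1) u RM(2)] in auto)
  then show "\<exists>t. (\<lambda>k. d (R (n (t k)) (z (t k))) (R (n (t k)) (w (t k)))) \<longlonglongrightarrow> 0"
    unfolding Rz_def Rw_def by (rule exI[of _ t])
qed

context mp_automorphism begin

lemma almost_periodic_indicator_finite_net:
  assumes ap: "almost_periodic (\<lambda>x. indicator A x)" and A: "A \<in> sets M" and e: "e > 0"
  obtains J where "finite J"
    "\<And>n. \<exists>j\<in>J. measure M (sym_diff (Tpow n -` A \<inter> space M) (Tpow j -` A \<inter> space M)) < e"
proof -
  let ?f = "\<lambda>n x. indicator A (Tpow n x) :: complex"
  have "sqrt e > 0"
    using e by simp
  then obtain J where J: "finite J" "\<And>n. \<exists>j\<in>J. L2norm M (\<lambda>x. ?f n x - ?f j x) < sqrt e"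
    using L2_totally_bounded_finite_index_net[OF
        L2fun_Tpow[OF L2fun_indicator[OF A]] almost_periodic_totally_bounded[OF ap]]
    by blast
  have "measure M (sym_diff (Tpow n -` A \<inter> space M) (Tpow j -` A \<inter> space M))
      = (L2norm M (\<lambda>x. ?f n x - ?f j x))\<^sup>2" for n j
  proof -
    let ?D = "sym_diff (Tpow n -` A \<inter> space M) (Tpow j -` A \<inter> space M)"
    have "?D \<in> sets M"
      using A by (intro sets.Un sets.Diff vimage_Tpow_in_sets)
    then have "measure M ?D = (\<integral>x. indicator ?D x \<partial>M)"
      by simp
    also have "\<dots> = (L2norm M (\<lambda>x. ?f n x - ?f j x))\<^sup>2"
      unfolding L2norm_square by (intro Bochner_Integration.integral_cong refl) (auto simp: indicator_def)
    finally show ?thesis .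
  qed
  moreover have "(L2norm M (\<lambda>x. ?f n x - ?f j x))\<^sup>2 < e" if "L2norm M (\<lambda>x. ?f n x - ?f j x) < sqrt e" for n j
    using power_strict_mono[OF that, of 2] e by simp
  ultimately show thesis
    using J by (intro that[OF J(1)]) metis
qed

lemma orbit_of_rectangle_finitely_determined:
  assumes ap: "\<And>A. A \<in> sets M \<Longrightarrow> almost_periodic (\<lambda>x. indicator A x)"
    and A: "A \<in> sets M" and B: "B \<in> sets M" and e: "e > 0"
  obtains P \<eta> where "finite P" "P \<subseteq> sets M \<times> sets M" "\<eta> > 0"
    "\<forall>\<rho>\<in>C2 M. \<forall>\<sigma>\<in>C2 M. (\<forall>(C, D)\<in>P. \<bar>measure \<rho> (C \<times> D) - measure \<sigma> (C \<times> D)\<bar> < \<eta>) \<longrightarrow>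
      (\<forall>n. \<bar>measure (zpow (C2_topology M) (lift_map M T) n \<rho>) (A \<times> B)
        - measure (zpow (C2_topology M) (lift_map M T) n \<sigma>) (A \<times> B)\<bar> < e)"
proof -
  define \<eta> where "\<eta> = e / 5"
  have \<eta>: "\<eta> > 0"
    using e by (simp add: \<eta>_def)
  define S where "S A n = Tpow n -` A \<inter> space M" for A n
  obtain J where J: "finite J" "\<And>n. \<exists>j\<in>J. measure M (sym_diff (S A n) (S A j)) < \<eta>"
    unfolding S_def using almost_periodic_indicator_finite_net[OF ap[OF A] A \<eta>] by blast
  obtain K where K: "finite K" "\<And>n. \<exists>k\<in>K. measure M (sym_diff (S B n) (S B k)) < \<eta>"
    unfolding S_def using almost_periodic_indicator_finite_net[OF ap[OF B] B \<eta>] by blast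
  define P where "P = S A ` J \<times> S B ` K"
  have sets: "S A n \<in> sets M" "S B n \<in> sets M" for n
    unfolding S_def by (intro vimage_Tpow_in_sets A B)+
  show thesis
  proof (rule that[of P \<eta>], safe)
    show "finite P" "\<eta> > 0"
      using J(1) K(1) \<eta> by (auto simp: P_def)
    show "C \<in> sets M" "D \<in> sets M" if "(C, D) \<in> P" for C D
      using that sets by (auto simp: P_def)
    fix \<rho> \<sigma> n assume C2: "\<rho> \<in> C2 M" "\<sigma> \<in> C2 M"
      and near: "\<forall>(C, D)\<in>P. \<bar>measure \<rho> (C \<times> D) - measure \<sigma> (C \<times> D)\<bar> < \<eta>"
    obtain j where j: "j \<in> J" "measure M (sym_diff (S A n) (S A j)) < \<eta>"
      using J(2) by blast
    obtain k where k: "k \<in> K" "measure M (sym_diff (S B n) (S B k)) < \<eta>"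
      using K(2) by blast
    have "\<bar>measure \<rho> (S A j \<times> S B k) - measure \<sigma> (S A j \<times> S B k)\<bar> < \<eta>"
      using near j(1) k(1) by (auto simp: P_def)
    then have "\<bar>measure \<rho> (S A n \<times> S B n) - measure \<sigma> (S A n \<times> S B n)\<bar> < 5 * \<eta>"
      using C2_measure_Times_diff_le[OF C2(1) sets(1,2) sets(1,2), of n n j k]
        C2_measure_Times_diff_le[OF C2(2) sets(1,2) sets(1,2), of n n j k] j(2) k(2)
      by linarith
    then show "\<bar>measure (zpow (C2_topology M) (lift_map M T) n \<rho>) (A \<times> B)
        - measure (zpow (C2_topology M) (lift_map M T) n \<sigma>) (A \<times> B)\<bar> < e"
      by (simp add: measure_zpow_lift_map[OF C2(1) A B] measure_zpow_lift_map[OF C2(2) A B] S_def \<eta>_def)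
  qed
qed

theorem equicontinuous_if_almost_periodic_indicators:
  assumes compact: "compact_space (C2_topology M)"
    and ap: "\<And>A. A \<in> sets M \<Longrightarrow> almost_periodic (\<lambda>x. indicator A x)"
  shows "equicontinuous (C2_topology M) (lift_map M T)"
  unfolding equicontinuous_def topspace_C2_topology
proof (intro allI impI)
  fix d and e :: real
  assume d: "Metric_space (C2 M) d \<and> Metric_space.mtopology (C2 M) d = C2_topology M" and e: "e > 0"
  interpret D: Metric_space "C2 M" d
    using d by simp
  have top: "D.mtopology = C2_topology M"
    using d by simp
  let ?eval = "\<lambda>p \<rho>. measure \<rho> (fst p \<times> snd p)" and ?R = "zpow (C2_topology M) (lift_map M T)"
  have continuous: "continuous_map D.mtopology euclideanreal (?eval p)" if "p \<in> sets M \<times> sets M" for p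
    using that continuous_map_C2_measure_Times unfolding top by auto
  show "\<exists>\<delta>>0. \<forall>\<rho>\<in>C2 M. \<forall>\<sigma>\<in>C2 M. d \<rho> \<sigma> < \<delta> \<longrightarrow> (\<forall>n. d (?R n \<rho>) (?R n \<sigma>) < e)"
  proof (rule D.equicontinuous_if_separating_family[OF _ zpow_lift_map_in_C2 continuous _ _ e])
    show compact_mtopology: "compact_space D.mtopology"
      using compact by (simp add: top)
    show "\<rho> = \<sigma>" if "\<rho> \<in> C2 M" "\<sigma> \<in> C2 M" "\<And>p. p \<in> sets M \<times> sets M \<Longrightarrow> ?eval p \<rho> = ?eval p \<sigma>" for \<rho> \<sigma>
      using that by (intro C2_eqI[of \<rho> M]) auto
    fix p and \<epsilon> :: real assume "p \<in> sets M \<times> sets M" "\<epsilon> > 0"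
    then obtain A B where p: "p = (A, B)" "A \<in> sets M" "B \<in> sets M"
      by blast
    obtain P \<eta> where P: "finite P" "P \<subseteq> sets M \<times> sets M" and \<eta>: "\<eta> > 0"
      and determined: "\<forall>\<rho>\<in>C2 M. \<forall>\<sigma>\<in>C2 M. (\<forall>(C, D)\<in>P. \<bar>measure \<rho> (C \<times> D) - measure \<sigma> (C \<times> D)\<bar> < \<eta>) \<longrightarrow>
        (\<forall>n. \<bar>measure (?R n \<rho>) (A \<times> B) - measure (?R n \<sigma>) (A \<times> B)\<bar> < \<epsilon>)"
      by (rule orbit_of_rectangle_finitely_determined[OF ap p(2,3) \<open>\<epsilon> > 0\<close>])
    obtain \<delta> where \<delta>: "\<delta> > 0"
      "\<forall>\<rho>\<in>C2 M. \<forall>\<sigma>\<in>C2 M. d \<rho> \<sigma> < \<delta> \<longrightarrow> (\<forall>q\<in>P. \<bar>?eval q \<rho> - ?eval q \<sigma>\<bar> < \<eta>)"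
      using D.uniformly_continuous_finite_family[OF compact_mtopology P(1) _ \<eta>, of ?eval]
        continuous P(2) by blast
    have "\<bar>measure (?R n \<rho>) (A \<times> B) - measure (?R n \<sigma>) (A \<times> B)\<bar> < \<epsilon>"
      if C2: "\<rho> \<in> C2 M" "\<sigma> \<in> C2 M" and "d \<rho> \<sigma> < \<delta>" for \<rho> \<sigma> n
    proof -
      have "\<forall>(C, D)\<in>P. \<bar>measure \<rho> (C \<times> D) - measure \<sigma> (C \<times> D)\<bar> < \<eta>"
        using \<delta>(2) that by (auto simp: case_prod_unfold)
      then show ?thesis
        using determined C2 by blast
    qed
    then show "\<exists>\<delta>>0. \<forall>\<rho>\<in>C2 M. \<forall>\<sigma>\<in>C2 M. d \<rho> \<sigma> < \<delta> \<longrightarrow> (\<forall>n. \<bar>?eval p (?R n \<rho>) - ?eval p (?R n \<sigma>)\<bar> < \<epsilon>)"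
      using \<delta>(1) by (auto simp: p(1))
  qed
qed

end

theorem mainTheorem5:
  fixes M :: "'a::polish_space measure" and T :: "'a \<Rightarrow> 'a"
  assumes "prob_space M" and "sets M = sets borel"
    and "mp_aut M T" and "ergodic M T"
    and "distal (C2_topology M) (lift_map M T)"
  shows "discrete_spectrum M T \<and> equicontinuous (C2_topology M) (lift_map M T)"
proof
  interpret mp_automorphism M T
    using assms(1,3) by (simp add: mp_automorphism_def mp_automorphism_axioms_def)
  have ap: "almost_periodic (\<lambda>x. indicator A x)" if "A \<in> sets M" for A
    by (rule distal_almost_periodic_indicator[OF assms(5) that])
  then show "discrete_spectrum M T"
    by (rule discrete_spectrum_if_almost_periodic_indicators)
  show "equicontinuous (C2_topology M) (lift_map M T)"
    using compact_space_C2_topology[OF assms(1,2)] ap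
    by (rule equicontinuous_if_almost_periodic_indicators)
qed

end
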